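(* Let $G_1$ and $G_2$ be $OE$-groups having a finite common subgroup $H$ (isomorphic finite subgroups $H_1\le G_1$ and $H_2\le G_2$, identified with $H$), $G_1\neq H\neq G_2$. Suppose that there is no isomorphism $\gamma:G_1\rightarrow G_2$ such that $\gamma(H)=H$. Then the number of isomorphism classes of amalgamated free products $G_1*_{H,\mu_2}G_2$, $\mu_2\in Aut(H)$, is $$ |\widetilde{Aut}_{G_2}(H)\backslash Out(H)/ \widetilde{Aut}_{G_1}(H)|.$$
   Context: A finitely generated residually finite group is called an $OE$-group if it has fewer than $2$ ends, i.e. it is finite or one-ended (equivalently, every action of it on a tree with finite edge stabilizers has a global fixed point). $G_1*_{H,\mu_2}G_2$ is the amalgamated free product in which $h\in H\le G_1$ is identified with $\mu_2(h)\in H\le G_2$. $\gamma(H)=H$ means that $\gamma$ carries the copy of $H$ in $G_1$ onto the copy of $H$ in $G_2$. $\widetilde{Aut}_{G_i}(H)$ is the image in $Out(H)$ (by restriction to $H$) of the group of automorphisms of $G_i$ that leave $H$ invariant. $A\backslash X/B$ denotes the set of double cosets. *)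

theory Defs
  imports "HOL-Algebra.Bij" "HOL-Algebra.Generated_Groups" "HOL-Library.Extended_Nat"
begin

section \<open>Ends, residual finiteness, OE-groups\<close>

text \<open>
  The Cayley graph of \<open>G\<close> with respect to \<open>S\<close>, as a symmetric relation: \<open>x\<close> is joined to
  \<open>x s\<close> for \<open>s \<in> S\<close>.
\<close>

definition cayley_edges :: "('a, 'm) monoid_scheme \<Rightarrow> 'a set \<Rightarrow> ('a \<times> 'a) set"
  where "cayley_edges G S =
    {(x, y). x \<in> carrier G \<and> y \<in> carrier G \<and> (\<exists>s\<in>S. y = x \<otimes>\<^bsub>G\<^esub> s \<or> x = y \<otimes>\<^bsub>G\<^esub> s)}"

definition complement_components :: "('a, 'm) monoid_scheme \<Rightarrow> 'a set \<Rightarrow> 'a set \<Rightarrow> 'a set set"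
  where "complement_components G S K =
    (carrier G - K) // ((cayley_edges G S \<inter> (carrier G - K) \<times> (carrier G - K))\<^sup>*)"

text \<open>
  The number of ends is the supremum, over finite vertex sets \<open>K\<close>, of the number of infinite
  components of the Cayley graph minus \<open>K\<close>.  It is only used for finite generating sets \<open>S\<close>:
  then the Cayley graph is connected and locally finite, so the complement of \<open>K\<close> has finitely
  many components (hence \<open>card\<close> is harmless), and the value does not depend on \<open>S\<close>.
\<close>

definition number_of_ends :: "('a, 'm) monoid_scheme \<Rightarrow> 'a set \<Rightarrow> enat"
  where "number_of_ends G S =
    (SUP K\<in>{K. finite K \<and> K \<subseteq> carrier G}.
       enat (card {C \<in> complement_components G S K. infinite C}))"

definition residually_finite :: "('a, 'm) monoid_scheme \<Rightarrow> bool"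
  where "residually_finite G \<longleftrightarrow>
    (\<forall>g \<in> carrier G - {\<one>\<^bsub>G\<^esub>}. \<exists>N. N \<lhd> G \<and> finite (rcosets\<^bsub>G\<^esub> N) \<and> g \<notin> N)"

definition OE_group :: "('a, 'm) monoid_scheme \<Rightarrow> bool"
  where "OE_group G \<longleftrightarrow> group G \<and> residually_finite G \<and>
    (\<exists>S. finite S \<and> S \<subseteq> carrier G \<and> generate G S = carrier G \<and> number_of_ends G S < 2)"


section \<open>Outer automorphisms and double cosets\<close>

definition Inn :: "('a, 'm) monoid_scheme \<Rightarrow> ('a \<Rightarrow> 'a) set"
  where "Inn G = (\<lambda>g. \<lambda>x\<in>carrier G. g \<otimes>\<^bsub>G\<^esub> x \<otimes>\<^bsub>G\<^esub> inv\<^bsub>G\<^esub> g) ` carrier G"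

definition Out :: "('a, 'm) monoid_scheme \<Rightarrow> ('a \<Rightarrow> 'a) set monoid"
  where "Out G = AutoGroup G Mod Inn G"

lemma (in group) Inn_subset_auto: "Inn G \<subseteq> auto G"
proof
  fix \<phi> assume "\<phi> \<in> Inn G"
  then obtain g where g: "g \<in> carrier G"
    and \<phi>: "\<phi> = (\<lambda>x\<in>carrier G. g \<otimes> x \<otimes> inv g)" by (auto simp: Inn_def)
  have "bij_betw \<phi> (carrier G) (carrier G)"
    by (rule bij_betw_byWitness[where f' = "\<lambda>x. inv g \<otimes> x \<otimes> g"])
      (use g in \<open>auto simp: \<phi> m_assoc inv_solve_left'\<close>, auto simp: m_assoc[symmetric])
  moreover have "\<phi> \<in> hom G G"
    using g by (auto simp: \<phi> hom_def m_assoc inv_solve_left')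
      (auto simp: m_assoc[symmetric])
  ultimately show "\<phi> \<in> auto G" by (simp add: auto_def Bij_def \<phi>)
qed

lemma (in group) Inn_normal: "Inn G \<lhd> AutoGroup G"
proof -
  interpret A: group "AutoGroup G" by (rule AutoGroup)
  define c where "c = (\<lambda>g. \<lambda>x\<in>carrier G. g \<otimes> x \<otimes> inv g)"
  have c: "c g \<in> auto G" if "g \<in> carrier G" for g
    using Inn_subset_auto that by (auto simp: Inn_def c_def)
  have mult: "\<phi> \<otimes>\<^bsub>AutoGroup G\<^esub> \<psi> = compose (carrier G) \<phi> \<psi>"
    if "\<phi> \<in> auto G" "\<psi> \<in> auto G" for \<phi> \<psi>
    using that by (simp add: AutoGroup_def BijGroup_def auto_def)
  have "c \<in> hom G (AutoGroup G)"
  proof (rule homI)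
    fix g h assume gh: "g \<in> carrier G" "h \<in> carrier G"
    show "c (g \<otimes> h) = c g \<otimes>\<^bsub>AutoGroup G\<^esub> c h"
      by (subst mult) (use gh c in \<open>auto simp: compose_def c_def inv_mult_group m_assoc\<close>)
  qed (use c in \<open>simp add: AutoGroup_def\<close>)
  then interpret c: group_hom G "AutoGroup G" c
    by unfold_locales
  have I: "Inn G = c ` carrier G" by (simp add: Inn_def c_def)
  have "subgroup (Inn G) (AutoGroup G)"
    unfolding I by (rule c.img_is_subgroup)
  moreover have "\<phi> \<otimes>\<^bsub>AutoGroup G\<^esub> \<iota> \<otimes>\<^bsub>AutoGroup G\<^esub> inv\<^bsub>AutoGroup G\<^esub> \<phi> \<in> Inn G"
    if "\<phi> \<in> carrier (AutoGroup G)" "\<iota> \<in> Inn G" for \<phi> \<iota>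
  proof -
    obtain g where g: "g \<in> carrier G" "\<iota> = c g" using \<open>\<iota> \<in> Inn G\<close> unfolding I by blast
    have \<phi>: "\<phi> \<in> auto G" using that by (simp add: AutoGroup_def)
    then interpret p: group_hom G G \<phi>
      by unfold_locales (simp add: auto_def)
    have pg: "\<phi> g \<in> carrier G" using g by simp
    have "compose (carrier G) \<phi> (c g) = compose (carrier G) (c (\<phi> g)) \<phi>"
      using g pg by (auto simp: compose_def c_def)
    then have "\<phi> \<otimes>\<^bsub>AutoGroup G\<^esub> c g = c (\<phi> g) \<otimes>\<^bsub>AutoGroup G\<^esub> \<phi>"
      by (simp add: mult \<phi> c g(1) pg)
    then have "\<phi> \<otimes>\<^bsub>AutoGroup G\<^esub> c g \<otimes>\<^bsub>AutoGroup G\<^esub> inv\<^bsub>AutoGroup G\<^esub> \<phi> = c (\<phi> g)"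
      using that g pg by (simp add: A.m_assoc)
    then show ?thesis using g pg I by simp
  qed
  ultimately show ?thesis by (simp add: A.normal_inv_iff)
qed

lemma (in group) group_Out: "group (Out G)"
  unfolding Out_def by (rule normal.factorgroup_is_group[OF Inn_normal])

text \<open>
  Subgroups isomorphic to \<open>H\<close> are given as the images of monomorphisms \<open>i\<close> from \<open>H\<close>.  An
  automorphism \<open>\<alpha>\<close> of \<open>G\<close> that leaves \<open>i(H)\<close> invariant restricts to \<open>i(H)\<close>, and, via the
  identification \<open>i\<close>, to the automorphism \<open>i\<inverse> \<circ> \<alpha> \<circ> i\<close> of \<open>H\<close>.
\<close>

definition restrict_auto ::
  "('h, 'n) monoid_scheme \<Rightarrow> ('h \<Rightarrow> 'a) \<Rightarrow> ('a \<Rightarrow> 'a) \<Rightarrow> 'h \<Rightarrow> 'h"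
  where "restrict_auto H i \<alpha> = (\<lambda>h\<in>carrier H. inv_into (carrier H) i (\<alpha> (i h)))"

definition Aut_tilde ::
  "('a, 'm) monoid_scheme \<Rightarrow> ('h, 'n) monoid_scheme \<Rightarrow> ('h \<Rightarrow> 'a) \<Rightarrow> ('h \<Rightarrow> 'h) set set"
  where "Aut_tilde G H i =
    {Inn H #>\<^bsub>AutoGroup H\<^esub> restrict_auto H i \<alpha> | \<alpha>.
       \<alpha> \<in> auto G \<and> \<alpha> ` (i ` carrier H) = i ` carrier H}"

definition double_cosets :: "('a, 'm) monoid_scheme \<Rightarrow> 'a set \<Rightarrow> 'a set \<Rightarrow> 'a set set"
  where "double_cosets G A B = {A <#>\<^bsub>G\<^esub> {x} <#>\<^bsub>G\<^esub> B | x. x \<in> carrier G}"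


section \<open>Amalgamated free products\<close>

text \<open>
  For homomorphisms \<open>f : H \<rightarrow> A\<close> and \<open>g : H \<rightarrow> B\<close>, the group \<open>A *\<^sub>H B\<close> in which \<open>f h\<close> is identified
  with \<open>g h\<close> is the monoid of words over the disjoint union of \<open>A\<close> and \<open>B\<close> modulo the congruence
  generated by the multiplication tables of \<open>A\<close> and \<open>B\<close> and the identifications.
\<close>

inductive amalg_eq ::
  "('a, 'm) monoid_scheme \<Rightarrow> ('b, 'n) monoid_scheme \<Rightarrow> ('h, 'k) monoid_scheme \<Rightarrow>
   ('h \<Rightarrow> 'a) \<Rightarrow> ('h \<Rightarrow> 'b) \<Rightarrow> ('a + 'b) list \<Rightarrow> ('a + 'b) list \<Rightarrow> bool"
  for A B H f g
  where
  refl: "w \<in> lists (carrier A <+> carrier B) \<Longrightarrow> amalg_eq A B H f g w w"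
| sym: "amalg_eq A B H f g u v \<Longrightarrow> amalg_eq A B H f g v u"
| trans: "amalg_eq A B H f g u v \<Longrightarrow> amalg_eq A B H f g v w \<Longrightarrow> amalg_eq A B H f g u w"
| append: "amalg_eq A B H f g u v \<Longrightarrow> amalg_eq A B H f g u' v' \<Longrightarrow>
    amalg_eq A B H f g (u @ u') (v @ v')"
| one_left: "amalg_eq A B H f g [Inl \<one>\<^bsub>A\<^esub>] []"
| one_right: "amalg_eq A B H f g [Inr \<one>\<^bsub>B\<^esub>] []"
| mult_left: "a \<in> carrier A \<Longrightarrow> a' \<in> carrier A \<Longrightarrow>
    amalg_eq A B H f g [Inl a, Inl a'] [Inl (a \<otimes>\<^bsub>A\<^esub> a')]"
| mult_right: "b \<in> carrier B \<Longrightarrow> b' \<in> carrier B \<Longrightarrow>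
    amalg_eq A B H f g [Inr b, Inr b'] [Inr (b \<otimes>\<^bsub>B\<^esub> b')]"
| glue: "h \<in> carrier H \<Longrightarrow> amalg_eq A B H f g [Inl (f h)] [Inr (g h)]"

definition amalg_class ::
  "('a, 'm) monoid_scheme \<Rightarrow> ('b, 'n) monoid_scheme \<Rightarrow> ('h, 'k) monoid_scheme \<Rightarrow>
   ('h \<Rightarrow> 'a) \<Rightarrow> ('h \<Rightarrow> 'b) \<Rightarrow> ('a + 'b) list \<Rightarrow> ('a + 'b) list set"
  where "amalg_class A B H f g w = {v. amalg_eq A B H f g w v}"

definition amalgam ::
  "('a, 'm) monoid_scheme \<Rightarrow> ('b, 'n) monoid_scheme \<Rightarrow> ('h, 'k) monoid_scheme \<Rightarrow>
   ('h \<Rightarrow> 'a) \<Rightarrow> ('h \<Rightarrow> 'b) \<Rightarrow> ('a + 'b) list set monoid"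
  where "amalgam A B H f g =
    \<lparr>carrier = amalg_class A B H f g ` lists (carrier A <+> carrier B),
     mult = (\<lambda>U V. \<Union>u\<in>U. \<Union>v\<in>V. amalg_class A B H f g (u @ v)),
     one = amalg_class A B H f g []\<rparr>"

text \<open>
  The construction is a group with the universal property of the pushout; injectivity of \<open>f\<close> and
  \<open>g\<close> plays no role here.
\<close>

locale amalgam_setting =
  A: group A + B: group B + H: group H
  for A :: "('a, 'm) monoid_scheme" and B :: "('b, 'n) monoid_scheme"
    and H :: "('h, 'k) monoid_scheme" +
  fixes f :: "'h \<Rightarrow> 'a" and g :: "'h \<Rightarrow> 'b"
  assumes f_hom: "f \<in> hom H A" and g_hom: "g \<in> hom H B"
begin

abbreviation eqv (infix "\<approx>" 50) where "u \<approx> v \<equiv> amalg_eq A B H f g u v"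
abbreviation cls where "cls w \<equiv> amalg_class A B H f g w"
abbreviation W where "W \<equiv> lists (carrier A <+> carrier B)"

lemma eqv_words: "u \<approx> v \<Longrightarrow> u \<in> W \<and> v \<in> W"
  by (induction rule: amalg_eq.induct)
    (use hom_carrier[OF f_hom] hom_carrier[OF g_hom] in auto)

lemma cls_eq_iff: "v \<in> W \<Longrightarrow> cls u = cls v \<longleftrightarrow> u \<approx> v"
  unfolding amalg_class_def
  by (blast intro: amalg_eq.sym amalg_eq.trans amalg_eq.refl)

lemma mult_cls: "u \<in> W \<Longrightarrow> v \<in> W \<Longrightarrow>
   cls u \<otimes>\<^bsub>amalgam A B H f g\<^esub> cls v = cls (u @ v)"
proof -
  assume u: "u \<in> W" and v: "v \<in> W"
  have "cls (u' @ v') = cls (u @ v)" if "u \<approx> u'" "v \<approx> v'" for u' v'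
    using that u v by (subst cls_eq_iff) (auto intro: amalg_eq.append amalg_eq.sym)
  then have "(\<Union>u'\<in>cls u. \<Union>v'\<in>cls v. cls (u' @ v')) = (\<Union>u'\<in>cls u. \<Union>v'\<in>cls v. cls (u @ v))"
    by (auto simp: amalg_class_def)
  also have "\<dots> = cls (u @ v)"
    using u v by (auto simp: amalg_class_def intro: amalg_eq.refl)
  finally show ?thesis by (simp add: amalgam_def)
qed

lemma left_inverse: "w \<in> W \<Longrightarrow> \<exists>v\<in>W. v @ w \<approx> []"
proof (induction w)
  case Nil
  then show ?case by (auto intro!: bexI[of _ "[]"] amalg_eq.refl)
next
  case (Cons x w)
  then obtain v where v: "v \<in> W" "v @ w \<approx> []" by auto
  obtain y where y: "y \<in> carrier A <+> carrier B" "[y, x] \<approx> []"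
  proof (cases x)
    case (Inl a)
    then have a: "a \<in> carrier A" using Cons by auto
    have "[Inl (inv\<^bsub>A\<^esub> a), Inl a] \<approx> [Inl (inv\<^bsub>A\<^esub> a \<otimes>\<^bsub>A\<^esub> a)]"
      using a by (intro amalg_eq.mult_left) auto
    with a Inl show ?thesis
      by (intro that[of "Inl (inv\<^bsub>A\<^esub> a)"]) (auto intro: amalg_eq.trans amalg_eq.one_left)
  next
    case (Inr a)
    then have a: "a \<in> carrier B" using Cons by auto
    have "[Inr (inv\<^bsub>B\<^esub> a), Inr a] \<approx> [Inr (inv\<^bsub>B\<^esub> a \<otimes>\<^bsub>B\<^esub> a)]"
      using a by (intro amalg_eq.mult_right) auto
    with a Inr show ?thesis
      by (intro that[of "Inr (inv\<^bsub>B\<^esub> a)"]) (auto intro: amalg_eq.trans amalg_eq.one_right)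
  qed
  have w: "w \<in> W" using Cons by auto
  have "([y, x]) @ w \<approx> [] @ w"
    using y w by (intro amalg_eq.append amalg_eq.refl) auto
  then have "v @ ([y, x] @ w) \<approx> v @ w"
    using v by (intro amalg_eq.append amalg_eq.refl) auto
  then have "(v @ [y]) @ (x # w) \<approx> []" using v amalg_eq.trans by fastforce
  then show ?case using v y by (intro bexI[of _ "v @ [y]"]) auto
qed

lemma group_amalgam: "group (amalgam A B H f g)"
proof (rule groupI)
  fix x assume "x \<in> carrier (amalgam A B H f g)"
  then obtain w where w: "w \<in> W" "x = cls w" by (auto simp: amalgam_def)
  obtain v where "v \<in> W" "v @ w \<approx> []" using left_inverse w by blast
  then have "cls v \<otimes>\<^bsub>amalgam A B H f g\<^esub> x = cls []"
    using w mult_cls cls_eq_iff[of "[]" "v @ w"] by simp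
  then show "\<exists>y\<in>carrier (amalgam A B H f g). y \<otimes>\<^bsub>amalgam A B H f g\<^esub> x = \<one>\<^bsub>amalgam A B H f g\<^esub>"
    using \<open>v \<in> W\<close> by (intro bexI[of _ "cls v"]) (auto simp: amalgam_def)
next
  fix x assume "x \<in> carrier (amalgam A B H f g)"
  then obtain w where w: "w \<in> W" "x = cls w" by (auto simp: amalgam_def)
  then show "\<one>\<^bsub>amalgam A B H f g\<^esub> \<otimes>\<^bsub>amalgam A B H f g\<^esub> x = x"
    using mult_cls[of "[]" w] by (simp add: amalgam_def)
next
  fix x y assume "x \<in> carrier (amalgam A B H f g)" "y \<in> carrier (amalgam A B H f g)"
  then obtain u v where "u \<in> W" "x = cls u" "v \<in> W" "y = cls v" by (auto simp: amalgam_def)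
  then show "x \<otimes>\<^bsub>amalgam A B H f g\<^esub> y \<in> carrier (amalgam A B H f g)"
    by (simp add: mult_cls) (auto simp: amalgam_def)
next
  fix x y z assume "x \<in> carrier (amalgam A B H f g)" "y \<in> carrier (amalgam A B H f g)"
    "z \<in> carrier (amalgam A B H f g)"
  then obtain u v w where "u \<in> W" "x = cls u" "v \<in> W" "y = cls v" "w \<in> W" "z = cls w"
    by (auto simp: amalgam_def)
  then show "x \<otimes>\<^bsub>amalgam A B H f g\<^esub> y \<otimes>\<^bsub>amalgam A B H f g\<^esub> z =
    x \<otimes>\<^bsub>amalgam A B H f g\<^esub> (y \<otimes>\<^bsub>amalgam A B H f g\<^esub> z)"
    by (simp add: mult_cls)
qed (auto simp: amalgam_def)

lemma amalgam_inl_hom: "(\<lambda>a. cls [Inl a]) \<in> hom A (amalgam A B H f g)"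
proof (rule homI)
  fix a b assume "a \<in> carrier A" "b \<in> carrier A"
  then have "[Inl a] \<in> W" "[Inl b] \<in> W" "[Inl (a \<otimes>\<^bsub>A\<^esub> b)] \<approx> [Inl a, Inl b]"
    by (auto intro: amalg_eq.sym amalg_eq.mult_left)
  then show "cls [Inl (a \<otimes>\<^bsub>A\<^esub> b)] = cls [Inl a] \<otimes>\<^bsub>amalgam A B H f g\<^esub> cls [Inl b]"
    by (simp add: mult_cls cls_eq_iff)
qed (auto simp: amalgam_def)

lemma amalgam_inr_hom: "(\<lambda>b. cls [Inr b]) \<in> hom B (amalgam A B H f g)"
proof (rule homI)
  fix a b assume "a \<in> carrier B" "b \<in> carrier B"
  then have "[Inr a] \<in> W" "[Inr b] \<in> W" "[Inr (a \<otimes>\<^bsub>B\<^esub> b)] \<approx> [Inr a, Inr b]"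
    by (auto intro: amalg_eq.sym amalg_eq.mult_right)
  then show "cls [Inr (a \<otimes>\<^bsub>B\<^esub> b)] = cls [Inr a] \<otimes>\<^bsub>amalgam A B H f g\<^esub> cls [Inr b]"
    by (simp add: mult_cls cls_eq_iff)
qed (auto simp: amalgam_def)

lemma amalgam_glue: "h \<in> carrier H \<Longrightarrow> cls [Inl (f h)] = cls [Inr (g h)]"
  using eqv_words[OF amalg_eq.glue] by (simp add: cls_eq_iff amalg_eq.glue)

theorem amalgam_universal:
  fixes K :: "('c, 'l) monoid_scheme"
  assumes "group K" and \<phi>: "\<phi> \<in> hom A K" and \<psi>: "\<psi> \<in> hom B K"
    and agree: "\<And>h. h \<in> carrier H \<Longrightarrow> \<phi> (f h) = \<psi> (g h)"
  shows "\<exists>!\<theta>. \<theta> \<in> hom (amalgam A B H f g) K \<and> \<theta> \<in> extensional (carrier (amalgam A B H f g)) \<and>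
    (\<forall>a\<in>carrier A. \<theta> (cls [Inl a]) = \<phi> a) \<and> (\<forall>b\<in>carrier B. \<theta> (cls [Inr b]) = \<psi> b)"
proof -
  interpret K: group K by fact
  interpret P: group "amalgam A B H f g" by (rule group_amalgam)
  interpret p: group_hom A K \<phi> using \<phi> by unfold_locales
  interpret q: group_hom B K \<psi> using \<psi> by unfold_locales
  define ev where "ev w = foldr (\<lambda>x y. case_sum \<phi> \<psi> x \<otimes>\<^bsub>K\<^esub> y) w \<one>\<^bsub>K\<^esub>" for w
  have ev_simps [simp]: "ev [] = \<one>\<^bsub>K\<^esub>" "ev (x # w) = case_sum \<phi> \<psi> x \<otimes>\<^bsub>K\<^esub> ev w" for x w
    by (simp_all add: ev_def)
  have letter: "case_sum \<phi> \<psi> x \<in> carrier K" if "x \<in> carrier A <+> carrier B" for x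
    using that by auto
  have ev_closed [simp]: "ev w \<in> carrier K" if "w \<in> W" for w
    using that by (induction w) (auto simp: letter simp del: Plus_def)
  have ev_append: "ev (u @ v) = ev u \<otimes>\<^bsub>K\<^esub> ev v" if "u \<in> W" "v \<in> W" for u v
    using that(1)
  proof (induction u)
    case Nil
    then show ?case using that(2) by simp
  next
    case (Cons x u)
    then have x: "x \<in> carrier A <+> carrier B" and u: "u \<in> W" by auto
    show ?case
      using Cons.IH letter[OF x] ev_closed[OF u] ev_closed[OF that(2)]
      by (simp add: K.m_assoc del: ev_closed)
  qed
  have ev_eq: "ev u = ev v" if "u \<approx> v" for u v
    using that
  proof (induction rule: amalg_eq.induct)
    case (append u v u' v')
    then show ?case using eqv_words by (simp add: ev_append)
  next
    case (glue h)
    then show ?case using agree by simp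
  qed (auto simp: K.m_assoc)
  define \<theta> where "\<theta> = (\<lambda>X\<in>carrier (amalgam A B H f g). ev (SOME w. w \<in> X))"
  have \<theta>: "\<theta> (cls w) = ev w" if "w \<in> W" for w
  proof -
    have "w \<in> cls w" using that by (simp add: amalg_class_def amalg_eq.refl)
    then have "(SOME v. v \<in> cls w) \<in> cls w" by (rule someI)
    then have "ev w = ev (SOME v. v \<in> cls w)" by (intro ev_eq) (simp add: amalg_class_def)
    then show ?thesis using that by (simp add: \<theta>_def amalgam_def)
  qed
  have "\<theta> \<in> hom (amalgam A B H f g) K"
  proof (rule homI)
    fix x assume "x \<in> carrier (amalgam A B H f g)"
    then obtain w where "w \<in> W" "x = cls w" by (auto simp: amalgam_def)
    then show "\<theta> x \<in> carrier K" by (simp only: \<theta> ev_closed)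
  next
    fix x y assume "x \<in> carrier (amalgam A B H f g)" "y \<in> carrier (amalgam A B H f g)"
    then obtain u v where uv: "u \<in> W" "x = cls u" "v \<in> W" "y = cls v" by (auto simp: amalgam_def)
    then have "u @ v \<in> W" by auto
    then show "\<theta> (x \<otimes>\<^bsub>amalgam A B H f g\<^esub> y) = \<theta> x \<otimes>\<^bsub>K\<^esub> \<theta> y"
      using uv by (simp add: mult_cls \<theta> ev_append)
  qed
  moreover have "\<forall>a\<in>carrier A. \<theta> (cls [Inl a]) = \<phi> a" "\<forall>b\<in>carrier B. \<theta> (cls [Inr b]) = \<psi> b"
    using \<theta>[of "[Inl _]"] \<theta>[of "[Inr _]"] by (auto simp: InlI InrI)
  moreover have "\<theta> \<in> extensional (carrier (amalgam A B H f g))" by (simp add: \<theta>_def)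
  moreover have "\<theta>' = \<theta>" if h: "\<theta>' \<in> hom (amalgam A B H f g) K"
    and e: "\<theta>' \<in> extensional (carrier (amalgam A B H f g))"
    and l: "\<forall>a\<in>carrier A. \<theta>' (cls [Inl a]) = \<phi> a" and r: "\<forall>b\<in>carrier B. \<theta>' (cls [Inr b]) = \<psi> b"
    for \<theta>'
  proof -
    interpret t: group_hom "amalgam A B H f g" K \<theta>' using h by unfold_locales
    have "\<theta>' (cls w) = ev w" if "w \<in> W" for w
      using that
    proof (induction w)
      case Nil
      then show ?case using t.hom_one by (simp add: amalgam_def)
    next
      case (Cons x w)
      then have x: "[x] \<in> W" and w: "w \<in> W" by auto
      have "cls (x # w) = cls [x] \<otimes>\<^bsub>amalgam A B H f g\<^esub> cls w" using mult_cls[OF x w] by simp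
      moreover have "cls [x] \<in> carrier (amalgam A B H f g)" "cls w \<in> carrier (amalgam A B H f g)"
        using x w by (auto simp: amalgam_def)
      ultimately have "\<theta>' (cls (x # w)) = \<theta>' (cls [x]) \<otimes>\<^bsub>K\<^esub> \<theta>' (cls w)" by simp
      then show ?case using Cons l r by auto
    qed
    then have "\<theta>' X = \<theta> X" if "X \<in> carrier (amalgam A B H f g)" for X
      using that \<theta> unfolding amalgam_def by force
    then show ?thesis
      by (intro extensionalityI[OF e \<open>\<theta> \<in> extensional _\<close>])
  qed
  ultimately show ?thesis by blast
qed

end

definition iso_classes :: "'a monoid set \<Rightarrow> 'a monoid set set"
  where "iso_classes \<A> = \<A> // {(G, K). G \<in> \<A> \<and> K \<in> \<A> \<and> G \<cong> K}"

end

theory Submission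
  imports Defs
begin

text \<open>
  Two amalgams \<open>P \<mu> = amalgam G1 G2 H i1 (i2 \<circ> \<mu>)\<close> and \<open>P \<nu>\<close> turn out to be isomorphic exactly if there
  are automorphisms \<open>\<alpha>\<close> of \<open>G1\<close> and \<open>\<beta>\<close> of \<open>G2\<close>, each preserving the copy of \<open>H\<close>, that match the two
  identifications of the copies of \<open>H\<close> (\<open>compatible\<close>).  If \<open>\<alpha>\<close> and \<open>\<beta>\<close> restrict to \<open>a\<close> and \<open>b\<close> on \<open>H\<close>,
  the matching condition reads \<open>\<nu> \<circ> a = b \<circ> \<mu>\<close>.  An inner automorphism of \<open>H\<close> extends to an inner
  automorphism of \<open>G2\<close>, so modulo inner automorphisms this says that \<open>\<mu>\<close> and \<open>\<nu>\<close> lie in the same double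
  coset, and counting isomorphism classes is counting double cosets.

  That compatible automorphisms glue to an isomorphism is the universal property of the amalgam.
  The converse is Bass--Serre theory, done here with words instead of trees.  Van der Waerden's
  action on normal forms shows that in \<open>P \<mu>\<close> an alternating product of elements outside \<open>H\<close> never lies
  in \<open>H\<close>; the locale \<open>amalgam_decomposition\<close> records this property of a group with two subgroups.
  The set of elements whose alternating product starts in a given factor is a half-tree: it has finite
  symmetric difference with each of its right translates, because \<open>H\<close> is finite.  A finitely
  generated group with fewer than two ends has only finite and cofinite sets of this kind.  Hence, for
  a subgroup \<open>K\<close> with fewer than two ends, the number of half-trees that separate \<open>1\<close> from \<open>k \<in> K\<close> is
  bounded independently of \<open>k\<close>, so the lengths of the elements of \<open>K\<close> are bounded, and a subgroup of
  bounded length is conjugate into a factor (\<open>OE_image_elliptic\<close>).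

  Given an isomorphism from \<open>P \<mu>\<close> to \<open>P \<nu>\<close>, this applies to the image of each factor and, the other way
  round, to the factors of \<open>P \<nu>\<close>.  A factor is contained in no conjugate of a factor other than itself,
  so the two pairs of factors agree up to conjugation and up to order.  One conjugating element
  serves both factors: otherwise, as the edge groups have the same finite order, the path
  between the vertices fixed by the two images would be fixed by one edge group, and a ping-pong argument
  would show that the two images do not generate \<open>P \<nu>\<close> (\<open>conjugate_decompositions\<close>).  If the
  order is reversed, the isomorphism induces an isomorphism from \<open>G1\<close> to \<open>G2\<close> preserving \<open>H\<close>, which was excluded;
  otherwise it induces the required automorphisms of \<open>G1\<close> and \<open>G2\<close>.
\<close>

section \<open>Almost invariant sets in groups with fewer than two ends\<close>


lemma (in group) generate_right_closed:
  assumes S: "S \<subseteq> carrier G" and D: "D \<subseteq> carrier G" 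
    and closed: "\<And>d s. d \<in> D \<Longrightarrow> s \<in> S \<Longrightarrow> d \<otimes> s \<in> D \<and> d \<otimes> inv s \<in> D"
    and g: "g \<in> generate G S" and d: "d \<in> D"
  shows "d \<otimes> g \<in> D"
  using g d
proof (induction arbitrary: d rule: generate.induct)
  case one
  then show ?case using D by auto
next
  case (eng h1 h2)
  have "h1 \<in> carrier G" "h2 \<in> carrier G"
    using eng.hyps generate_in_carrier[OF S] by auto
  then have "d \<otimes> (h1 \<otimes> h2) = d \<otimes> h1 \<otimes> h2"
    using eng.prems D by (auto simp: m_assoc)
  then show ?case using eng.IH eng.prems by simp
qed (use closed in auto)

text \<open>
  A set with finite coboundary in the Cayley graph becomes a union of components once the coboundary
  is removed.  If the set and its complement were both infinite, each would contain an infinite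
  component, since only finitely many components are left; that would be two ends.
\<close>

lemma (in group) almost_invariant_trivial:
  assumes fin: "finite S" and S: "S \<subseteq> carrier G" and gen: "generate G S = carrier G"
    and ends: "number_of_ends G S < 2"
    and B: "\<And>s. s \<in> S \<Longrightarrow> finite {k \<in> carrier G. (k \<in> B) \<noteq> (k \<otimes> s \<in> B)}"
  shows "finite (carrier G \<inter> B) \<or> finite (carrier G - B)"
proof (rule ccontr)
  assume neg: "\<not> ?thesis"
  \<comment> \<open>Adding \<open>\<one>\<close> makes \<open>K\<close> nonempty, so that every path to \<open>\<one>\<close> ends in \<open>K\<close>.\<close>
  define K where "K = insert \<one> (\<Union>s\<in>S. {k \<in> carrier G. (k \<in> B) \<noteq> (k \<otimes> s \<in> B)})"
  have finK: "finite K" and K: "K \<subseteq> carrier G" and "\<one> \<in> K"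
    using fin B by (auto simp: K_def)
  define R where "R = (cayley_edges G S \<inter> (carrier G - K) \<times> (carrier G - K))\<^sup>*"
  have symR: "sym R"
    unfolding R_def by (intro sym_rtrancl) (auto simp: sym_def cayley_edges_def)
  have R_side: "(x \<in> B) = (y \<in> B)" if "(x, y) \<in> R" for x y
    using that unfolding R_def
    by (induction rule: rtrancl_induct) (auto simp: cayley_edges_def K_def)
  define N where "N = (\<Union>k\<in>K. \<Union>s\<in>S. {k \<otimes> s, k \<otimes> inv s})"
  have finN: "finite N" using fin finK by (auto simp: N_def)
  \<comment> \<open>Walking from a vertex to the removed vertex \<open>\<one>\<close>, the last vertex before the first
     removed one lies in \<open>N\<close>; so the complement of \<open>K\<close> has only finitely many components.\<close>
  define D where "D = {c \<in> carrier G. c \<in> K \<or> (\<exists>y\<in>N. (c, y) \<in> R)}"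
  have step: "c' \<in> D" if c: "c \<in> D" "c' \<in> carrier G" "(c, c') \<in> cayley_edges G S"
    and "c \<in> K \<Longrightarrow> c' \<in> N" for c c'
  proof (cases "c \<in> K \<or> c' \<in> K")
    case True
    then show ?thesis using that by (auto simp: D_def R_def)
  next
    case False
    then have "(c, c') \<in> R" using that by (auto simp: R_def D_def)
    then have "(c', c) \<in> R" using symR by (auto dest: symD)
    moreover obtain y where "y \<in> N" "(c, y) \<in> R" using c False by (auto simp: D_def)
    ultimately have "(c', y) \<in> R" unfolding R_def by (auto intro: rtrancl_trans)
    then show ?thesis using \<open>y \<in> N\<close> that by (auto simp: D_def)
  qed
  have "d \<otimes> s \<in> D \<and> d \<otimes> inv s \<in> D" if d: "d \<in> D" and s: "s \<in> S" for d s
  proof -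
    have c: "d \<in> carrier G" "s \<in> carrier G" using d s S by (auto simp: D_def)
    then have "d = d \<otimes> inv s \<otimes> s" by (simp add: m_assoc)
    then show ?thesis
      using c s by (intro conjI step[OF d]) (auto simp: cayley_edges_def N_def)
  qed
  then have "\<one> \<otimes> g \<in> D" if "g \<in> carrier G" for g
    using generate_right_closed[OF S, of D g \<one>] that gen \<open>\<one> \<in> K\<close> by (auto simp: D_def)
  then have D: "carrier G \<subseteq> D" by auto
  have comps: "complement_components G S K = (\<lambda>x. R `` {x}) ` (carrier G - K)"
    by (auto simp: complement_components_def quotient_def R_def)
  have "R `` {x} \<in> (\<lambda>y. R `` {y}) ` N" if x: "x \<in> carrier G - K" for x
  proof -
    obtain y where "y \<in> N" "(x, y) \<in> R" using x D by (auto simp: D_def)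
    then have "R `` {x} = R `` {y}"
      using symR unfolding R_def sym_def by (auto intro: rtrancl_trans)
    then show ?thesis using \<open>y \<in> N\<close> by blast
  qed
  then have fincomps: "finite (complement_components G S K)"
    unfolding comps using finN by (meson finite_imageI finite_subset image_subsetI)
  have inf_comp: "\<exists>x \<in> carrier G - K. x \<in> X \<and> infinite (R `` {x})"
    if X: "infinite (carrier G \<inter> X)" and "X = B \<or> X = - B" for X
  proof (rule ccontr)
    assume "\<not> ?thesis"
    then have "finite (\<Union>C \<in> {C \<in> complement_components G S K. finite C}. C)"
      and "(carrier G - K) \<inter> X \<subseteq> (\<Union>C \<in> {C \<in> complement_components G S K. finite C}. C)"
      using fincomps unfolding comps by (auto simp: R_def)
    then have "finite ((carrier G - K) \<inter> X)" using finite_subset by blast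
    then have "finite ((carrier G - K) \<inter> X \<union> K)" using finK by simp
    moreover have "carrier G \<inter> X \<subseteq> (carrier G - K) \<inter> X \<union> K" by auto
    ultimately show False using X finite_subset by blast
  qed
  have "infinite (carrier G \<inter> B)" "infinite (carrier G \<inter> - B)"
    using neg by (simp_all add: Diff_eq)
  then obtain x y where x: "x \<in> carrier G - K" "x \<in> B" "infinite (R `` {x})"
    and y: "y \<in> carrier G - K" "y \<notin> B" "infinite (R `` {y})"
    using inf_comp[of B] inf_comp[of "- B"] by auto
  have "R `` {x} \<noteq> R `` {y}"
  proof
    assume "R `` {x} = R `` {y}"
    moreover have "y \<in> R `` {y}" by (simp add: R_def)
    ultimately have "(x, y) \<in> R" by blast
    then show False using R_side x y by blast
  qed
  moreover have "{R `` {x}, R `` {y}} \<subseteq> {C \<in> complement_components G S K. infinite C}"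
    using x y unfolding comps by blast
  then have "card {R `` {x}, R `` {y}} \<le> card {C \<in> complement_components G S K. infinite C}"
    using fincomps by (intro card_mono) auto
  ultimately have "2 \<le> card {C \<in> complement_components G S K. infinite C}" by simp
  then have "2 \<le> enat (card {C \<in> complement_components G S K. infinite C})"
    by (metis enat_ord_simps(1) numeral_eq_enat)
  also have "\<dots> \<le> number_of_ends G S"
    unfolding number_of_ends_def using finK K by (intro SUP_upper) auto
  finally show False using ends by simp
qed


section \<open>Alternating products and amalgam decompositions\<close>

text \<open>
  The type \<open>s\<close> of the first letter, the number \<open>n\<close> of letters and the type \<open>t\<close> of the last letter are kept
  as arguments; in an amalgam they are determined by the group element, and \<open>n\<close> is its length.
\<close>

inductive alternating ::
  "('p, 'm) monoid_scheme \<Rightarrow> (bool \<Rightarrow> 'p set) \<Rightarrow> 'p set \<Rightarrow> bool \<Rightarrow> nat \<Rightarrow> bool \<Rightarrow> 'p \<Rightarrow> bool"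
  for P A H
  where
  single: "a \<in> A s \<Longrightarrow> a \<notin> H \<Longrightarrow> alternating P A H s 1 s a"
| prepend: "a \<in> A s \<Longrightarrow> a \<notin> H \<Longrightarrow> alternating P A H (\<not> s) n t p \<Longrightarrow>
    alternating P A H s (Suc n) t (a \<otimes>\<^bsub>P\<^esub> p)"

text \<open>
  An amalgamated product seen from inside: the last assumption is the normal form theorem, and it
  together with \<open>generated\<close> characterizes the amalgam of the two factors along their intersection.
  In terms of the Bass--Serre tree, the \<open>A s\<close> are the stabilizers of the two endpoints of a base edge and
  \<open>H\<close> is the stabilizer of that edge.
\<close>

locale amalgam_decomposition = group P
  for P :: "('p, 'm) monoid_scheme" (structure) +
  fixes A :: "bool \<Rightarrow> 'p set" and H :: "'p set"
  assumes subgroup_factor: "subgroup (A s) P"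
    and edge: "A s \<inter> A (\<not> s) = H"
    and finite_edge: "finite H"
    and proper: "A s \<noteq> H"
    and generated: "generate P (A True \<union> A False) = carrier P"
    and reduced: "alternating P A H s n t p \<Longrightarrow> p \<notin> H"
begin

abbreviation alt where "alt \<equiv> alternating P A H"

text \<open>
  A half-tree: identify \<open>p\<close> with the edge \<open>p H\<close> of the Bass--Serre tree.  Removing the edge \<open>H\<close> leaves two
  half-trees, and \<open>starts s\<close> is the one that contains the vertex \<open>A s\<close>.
\<close>

definition starts :: "bool \<Rightarrow> 'p set"
  where "starts s = {p. \<exists>n t. alt s n t p}"

lemma H_factor: "H \<subseteq> A s"
  using edge[of True] by (cases s) auto

lemma subgroup_edge: "subgroup H P"
  using subgroups_Inter_pair[OF subgroup_factor subgroup_factor] edge by metis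

lemma factor_closed [simp]:
  "a \<in> A s \<Longrightarrow> a \<in> carrier P"
  "a \<in> A s \<Longrightarrow> b \<in> A s \<Longrightarrow> a \<otimes> b \<in> A s"
  "a \<in> A s \<Longrightarrow> inv a \<in> A s"
  "\<one> \<in> A s"
  using subgroup_factor[of s] by (auto simp: subgroup_def)

lemma edge_closed [simp]:
  "h \<in> H \<Longrightarrow> h \<in> A s"
  "h \<in> H \<Longrightarrow> h \<in> carrier P"
  "h \<in> H \<Longrightarrow> k \<in> H \<Longrightarrow> h \<otimes> k \<in> H"
  "h \<in> H \<Longrightarrow> inv h \<in> H"
  "\<one> \<in> H"
  using subgroup_edge H_factor by (auto simp: subgroup_def)

lemma edge_mult_iff:
  assumes h: "h \<in> H" and a: "a \<in> carrier P"
  shows "h \<otimes> a \<in> H \<longleftrightarrow> a \<in> H" "a \<otimes> h \<in> H \<longleftrightarrow> a \<in> H"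
proof -
  have c: "h \<in> carrier P" using h by simp
  have "inv h \<otimes> (h \<otimes> a) = a" "a \<otimes> h \<otimes> inv h = a"
    using c a by (simp_all add: m_assoc) (simp add: m_assoc[symmetric])
  then show "h \<otimes> a \<in> H \<longleftrightarrow> a \<in> H" "a \<otimes> h \<in> H \<longleftrightarrow> a \<in> H"
    using edge_closed(3)[of "inv h" "h \<otimes> a"] edge_closed(3)[of "a \<otimes> h" "inv h"]
      edge_closed(3)[OF h, of a] edge_closed(3)[OF _ h, of a] edge_closed(4)[OF h]
    by metis+
qed

lemma inv_edge_iff: "a \<in> carrier P \<Longrightarrow> inv a \<in> H \<longleftrightarrow> a \<in> H"
  using edge_closed(4)[of a] edge_closed(4)[of "inv a"] by auto

lemma in_both_factors: "a \<in> A s \<Longrightarrow> a \<in> A t \<Longrightarrow> s \<noteq> t \<Longrightarrow> a \<in> H"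
  using edge[of s] by (cases s; cases t) auto

lemma alt_closed: "alt s n t p \<Longrightarrow> p \<in> carrier P"
  by (induction rule: alternating.induct) auto

lemma alt_pos: "alt s n t p \<Longrightarrow> 0 < n"
  by (induction rule: alternating.induct) auto

lemma alt_append:
  "alt s n t p \<Longrightarrow> alt (\<not> t) m u q \<Longrightarrow> alt s (n + m) u (p \<otimes> q)"
proof (induction rule: alternating.induct)
  case (single a s)
  then show ?case using alternating.prepend[of a A s H P m u q] by simp
next
  case (prepend a s n t p)
  then have "alt s (Suc (n + m)) u (a \<otimes> (p \<otimes> q))"
    by (intro alternating.prepend) auto
  moreover have "a \<otimes> p \<otimes> q = a \<otimes> (p \<otimes> q)"
    using prepend by (intro m_assoc) (auto dest: alt_closed)
  ultimately show ?case by simp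
qed

lemma alt_inv: "alt s n t p \<Longrightarrow> alt t n s (inv p)"
proof (induction rule: alternating.induct)
  case (single a s)
  then show ?case by (intro alternating.single) (auto simp: inv_edge_iff)
next
  case (prepend a s n t p)
  then have "alt s 1 s (inv a)" by (intro alternating.single) (auto simp: inv_edge_iff)
  then have "alt t (n + 1) s (inv p \<otimes> inv a)" by (intro alt_append[OF prepend.IH]) simp
  moreover have "inv (a \<otimes> p) = inv p \<otimes> inv a"
    using prepend alt_closed[OF prepend(3)] by (intro inv_mult_group) auto
  ultimately show ?case by simp
qed

lemma alt_edge_left:
  assumes "h \<in> H" "alt s n t p" shows "alt s n t (h \<otimes> p)"
  using assms(2)
proof cases
  case single
  then show ?thesis using assms alternating.single[of "h \<otimes> p" A s H P]
    by (simp add: edge_mult_iff)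
next
  case (prepend a m q)
  then have "alt s (Suc m) t ((h \<otimes> a) \<otimes> q)"
    using assms(1) by (intro alternating.prepend) (auto simp: edge_mult_iff)
  moreover have "h \<otimes> a \<otimes> q = h \<otimes> (a \<otimes> q)"
    using prepend assms(1) by (intro m_assoc) (auto dest: alt_closed)
  ultimately show ?thesis using prepend by simp
qed

text \<open>
  Right multiplication by a letter changes an alternating product at its end only.  So it keeps the
  first letter, unless the product is absorbed by \<open>H\<close>; this is why half-trees are almost invariant.
\<close>

lemma alt_mult_right:
  assumes "alt s n t p" and a: "a \<in> A u"
  shows "p \<otimes> a \<in> H \<or> (\<exists>m v. alt s m v (p \<otimes> a) \<and> (u = t \<longrightarrow> m \<le> n))"
  using assms(1)
proof (induction rule: alternating.induct)
  case (single b s)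
  show ?case
  proof (cases "u = s")
    case True
    then have "b \<otimes> a \<in> A s" using single a by simp
    then show ?thesis using alternating.single[of "b \<otimes> a" A s H P] by auto
  next
    case False
    then have u: "u = (\<not> s)" by auto
    show ?thesis
    proof (cases "a \<in> H")
      case True
      then have "b \<otimes> a \<in> A s" "b \<otimes> a \<notin> H" using single by (auto simp: edge_mult_iff)
      then show ?thesis using alternating.single[of "b \<otimes> a" A s H P] False by blast
    next
      case aH: False
      then have "alt (\<not> s) 1 (\<not> s) a" using a u by (intro alternating.single) auto
      then show ?thesis using alternating.prepend[of b A s H, OF single] False by blast
    qed
  qed
next
  case (prepend b s n t p)
  have assoc: "b \<otimes> p \<otimes> a = b \<otimes> (p \<otimes> a)"
    using prepend(1) a alt_closed[OF prepend(3)] factor_closed(1) by (metis m_assoc)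
  from prepend.IH show ?case
  proof (elim disjE exE conjE)
    assume h: "p \<otimes> a \<in> H"
    then have "b \<otimes> (p \<otimes> a) \<in> A s" "b \<otimes> (p \<otimes> a) \<notin> H"
      using prepend by (auto simp: edge_mult_iff)
    then show ?thesis using alternating.single[of "b \<otimes> (p \<otimes> a)" A s H P] assoc by auto
  next
    fix m v assume "alt (\<not> s) m v (p \<otimes> a)" "u = t \<longrightarrow> m \<le> n"
    moreover from this have "alt s (Suc m) v (b \<otimes> (p \<otimes> a))"
      using prepend by (intro alternating.prepend)
    ultimately show ?thesis using assoc by (intro disjI2 exI[of _ "Suc m"] exI[of _ v]) simp
  qed
qed

lemma starts_closed: "p \<in> starts s \<Longrightarrow> p \<in> carrier P"
  by (auto simp: starts_def alt_closed)

lemma edge_or_starts: "p \<in> carrier P \<Longrightarrow> p \<in> H \<union> starts True \<union> starts False"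
proof -
  let ?D = "H \<union> starts True \<union> starts False"
  have step: "d \<otimes> a \<in> ?D" if d: "d \<in> ?D" and a: "a \<in> A u" for d a u
  proof (cases "d \<in> H")
    case True
    then have "d \<otimes> a \<in> A u" using a by simp
    then show ?thesis
      using alternating.single[of "d \<otimes> a" A u H P] by (cases u) (auto simp: starts_def)
  next
    case False
    then obtain s n t where "alt s n t d" using d by (auto simp: starts_def)
    from alt_mult_right[OF this a] show ?thesis by (cases s) (auto simp: starts_def)
  qed
  assume "p \<in> carrier P"
  have "\<one> \<otimes> p \<in> ?D"
  proof (rule generate_right_closed[where S = "A True \<union> A False" and D = ?D])
    fix d s assume d: "d \<in> ?D" and "s \<in> A True \<union> A False"
    then obtain u where "s \<in> A u" by blast
    then show "d \<otimes> s \<in> ?D \<and> d \<otimes> inv s \<in> ?D"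
      by (intro conjI step[OF d, of _ u]) auto
  next
    show "?D \<subseteq> carrier P" using starts_closed by auto
    show "p \<in> generate P (A True \<union> A False)" using \<open>p \<in> carrier P\<close> generated by simp
  qed (auto dest: factor_closed(1))
  then show "p \<in> ?D" using \<open>p \<in> carrier P\<close> by simp
qed

text \<open>
  If \<open>p\<close> could start in both factors, then \<open>inv p \<otimes> p\<close> would be an alternating product equal to \<open>\<one>\<close>.
\<close>

lemma alt_start_unique:
  assumes p: "alt s n t p" and p': "alt s' n' t' p"
  shows "s' = s"
proof (rule ccontr)
  assume "s' \<noteq> s"
  then have "s' = (\<not> s)" by auto
  then have "alt t (n + n') t' (inv p \<otimes> p)"
    using alt_append[OF alt_inv[OF p]] p' by simp
  then show False using reduced[of t "n + n'" t' \<one>] alt_closed[OF p] edge_closed(5) by simp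
qed

lemma starts_disjoint: "p \<in> starts s \<Longrightarrow> p \<notin> starts (\<not> s)" "p \<in> starts s \<Longrightarrow> p \<notin> H"
  using alt_start_unique reduced unfolding starts_def by blast+

lemma factor_not_starts: "a \<in> A s \<Longrightarrow> a \<notin> starts (\<not> s)"
  using starts_disjoint[of a "\<not> s"] alternating.single[of a A s H P] by (auto simp: starts_def)

text \<open>
  First letters of two alternating products for the same element differ by an element of \<open>H\<close>, which
  the second letter absorbs.
\<close>

lemma alt_length_unique: "alt s n t p \<Longrightarrow> alt s' n' t' p \<Longrightarrow> n' = n"
proof (induction arbitrary: s' n' t' rule: alternating.induct)
  case (single a s)
  have "s' = s" using alt_start_unique[OF alternating.single[of a A s H P] single.prems] single by simp
  from single(3) show ?case
  proof cases
    case (prepend b m q)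
    then have "inv b \<otimes> a \<in> A s" using single \<open>s' = s\<close> by simp
    moreover have "b \<in> carrier P" "q \<in> carrier P"
      using prepend alt_closed by (auto intro: factor_closed(1))
    then have "q = inv b \<otimes> a" using prepend by (simp add: m_assoc[symmetric])
    ultimately show ?thesis using factor_not_starts prepend \<open>s' = s\<close> unfolding starts_def by blast
  qed auto
next
  case (prepend a s n t p)
  note p = alt_closed[OF prepend(3)]
  have a: "a \<in> carrier P" using prepend by (auto intro: factor_closed(1))
  have s': "s' = s" by (rule alt_start_unique[OF alternating.prepend[OF prepend(1-3)] prepend.prems])
  from prepend.prems show ?case
  proof cases
    case single
    then have "inv a \<otimes> (a \<otimes> p) \<in> A s" using s' prepend by simp
    then have "p \<in> A s" using p a by (simp add: m_assoc[symmetric])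
    then show ?thesis using factor_not_starts prepend unfolding starts_def by blast
  next
    case second: (prepend b m q)
    then have b: "b \<in> carrier P" and q: "q \<in> carrier P"
      using alt_closed by (auto intro: factor_closed(1))
    define c where "c = inv b \<otimes> a"
    have "inv b \<otimes> (a \<otimes> p) = inv b \<otimes> (b \<otimes> q)" using second by simp
    then have eq: "q = c \<otimes> p" using a b p q by (simp add: c_def m_assoc[symmetric])
    have c: "c \<in> A s" using prepend(1) second s' by (simp add: c_def)
    have "c \<in> H"
    proof (rule ccontr)
      assume "c \<notin> H"
      then have "alt s (Suc n) t q" using c prepend(3) eq alternating.prepend by metis
      from alt_start_unique[OF this second(5)] s' show False by simp
    qed
    moreover from this have "p = inv c \<otimes> q" using p eq by (simp add: m_assoc[symmetric])
    ultimately have "alt (\<not> s) m t' p"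
      using alt_edge_left[of "inv c"] second(5) s' by simp
    then show ?thesis using prepend.IH second by simp
  qed
qed


end


section \<open>Subgroups with fewer than two ends are elliptic\<close>

text \<open>
  The set counts the translates \<open>x F\<close> that contain \<open>j k\<close> but not \<open>\<one>\<close>.  On a path from \<open>\<one>\<close> to \<open>k\<close> in the
  Cayley graph of \<open>G\<close>, some edge at a vertex \<open>k'\<close> crosses the boundary of \<open>x F\<close>, which confines
  \<open>y = (j k')\<inverse> x\<close> to a finite set.  For given \<open>y\<close>, the trace of \<open>y F\<close> on \<open>G\<close> is finite or cofinite; it
  contains \<open>k'\<inverse> k\<close> but not \<open>k'\<inverse>\<close>, so in either case one of these two elements ranges over a finite set whose
  size does not depend on \<open>k\<close>.
\<close>

lemma bounded_separation:
  fixes G :: "('g, 'n) monoid_scheme" and P :: "('p, 'm) monoid_scheme"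
  assumes "group G" and "group P" and j: "j \<in> hom G P" and inj: "inj_on j (carrier G)"
    and S: "finite S" "S \<subseteq> carrier G" "generate G S = carrier G" "number_of_ends G S < 2"
    and F: "\<And>g. g \<in> carrier P \<Longrightarrow> finite {p \<in> carrier P. (p \<in> F) \<noteq> (p \<otimes>\<^bsub>P\<^esub> g \<in> F)}"
  obtains C :: nat where "\<And>k. k \<in> carrier G \<Longrightarrow>
    finite {x \<in> carrier P. inv\<^bsub>P\<^esub> x \<otimes>\<^bsub>P\<^esub> j k \<in> F \<and> inv\<^bsub>P\<^esub> x \<notin> F} \<and>
    card {x \<in> carrier P. inv\<^bsub>P\<^esub> x \<otimes>\<^bsub>P\<^esub> j k \<in> F \<and> inv\<^bsub>P\<^esub> x \<notin> F} \<le> C"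
proof -
  interpret G: group G by fact
  interpret P: group P by fact
  interpret j: group_hom G P j using j by unfold_locales
  define Y where "Y = (\<Union>s\<in>S. {y \<in> carrier P. (inv\<^bsub>P\<^esub> y \<in> F) \<noteq> (inv\<^bsub>P\<^esub> y \<otimes>\<^bsub>P\<^esub> j s \<in> F)})"
  have finY: "finite Y"
    unfolding Y_def
  proof (rule finite_UN_I[OF S(1)])
    fix s assume "s \<in> S"
    then have "finite (m_inv P ` {p \<in> carrier P. (p \<in> F) \<noteq> (p \<otimes>\<^bsub>P\<^esub> j s \<in> F)})"
      using S(2) by (intro finite_imageI F) auto
    then show "finite {y \<in> carrier P. (inv\<^bsub>P\<^esub> y \<in> F) \<noteq> (inv\<^bsub>P\<^esub> y \<otimes>\<^bsub>P\<^esub> j s \<in> F)}"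
    proof (rule finite_subset[rotated], intro subsetI)
      fix y assume "y \<in> {y \<in> carrier P. (inv\<^bsub>P\<^esub> y \<in> F) \<noteq> (inv\<^bsub>P\<^esub> y \<otimes>\<^bsub>P\<^esub> j s \<in> F)}"
      then show "y \<in> m_inv P ` {p \<in> carrier P. (p \<in> F) \<noteq> (p \<otimes>\<^bsub>P\<^esub> j s \<in> F)}"
        by (intro rev_image_eqI[of "inv\<^bsub>P\<^esub> y"]) auto
    qed
  qed
  define B where "B y = {k \<in> carrier G. inv\<^bsub>P\<^esub> y \<otimes>\<^bsub>P\<^esub> j k \<in> F}" for y
  have B: "finite (B y) \<or> finite (carrier G - B y)" if y: "y \<in> carrier P" for y
  proof -
    have "finite {k \<in> carrier G. (k \<in> B y) \<noteq> (k \<otimes>\<^bsub>G\<^esub> s \<in> B y)}" if s: "s \<in> S" for s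
    proof (rule finite_imageD)
      have sG: "s \<in> carrier G" using s S(2) by auto
      show "finite ((\<lambda>k. inv\<^bsub>P\<^esub> y \<otimes>\<^bsub>P\<^esub> j k) ` {k \<in> carrier G. (k \<in> B y) \<noteq> (k \<otimes>\<^bsub>G\<^esub> s \<in> B y)})"
        by (rule finite_subset[OF _ F[of "j s"]]) (use sG y in \<open>auto simp: B_def P.m_assoc\<close>)
      show "inj_on (\<lambda>k. inv\<^bsub>P\<^esub> y \<otimes>\<^bsub>P\<^esub> j k) {k \<in> carrier G. (k \<in> B y) \<noteq> (k \<otimes>\<^bsub>G\<^esub> s \<in> B y)}"
        using y by (auto intro!: inj_onI dest: inj_onD[OF inj])
    qed
    then have "finite (carrier G \<inter> B y) \<or> finite (carrier G - B y)"
      by (intro G.almost_invariant_trivial[OF S])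
    moreover have "carrier G \<inter> B y = B y" by (auto simp: B_def)
    ultimately show ?thesis by simp
  qed
  \<comment> \<open>The finite one of the trace and its complement.\<close>
  define T where "T y = (if finite (B y) then B y else carrier G - B y)" for y
  have finT: "finite (T y)" if "y \<in> carrier P" for y
    using B[OF that] by (auto simp: T_def)
  define C where "C = (\<Sum>y\<in>Y. 2 * card (T y))"
  define cover where "cover k = (\<Union>y\<in>Y. (\<lambda>t. j (k \<otimes>\<^bsub>G\<^esub> inv\<^bsub>G\<^esub> t) \<otimes>\<^bsub>P\<^esub> y) ` T y \<union>
    (\<lambda>t. j (inv\<^bsub>G\<^esub> t) \<otimes>\<^bsub>P\<^esub> y) ` T y)" for k
  have YP: "Y \<subseteq> carrier P" by (auto simp: Y_def)
  have card_cover: "finite (cover k) \<and> card (cover k) \<le> C" for k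
  proof
    show "finite (cover k)" unfolding cover_def using finY finT YP by auto
    have "card (cover k) \<le> (\<Sum>y\<in>Y. card ((\<lambda>t. j (k \<otimes>\<^bsub>G\<^esub> inv\<^bsub>G\<^esub> t) \<otimes>\<^bsub>P\<^esub> y) ` T y \<union>
      (\<lambda>t. j (inv\<^bsub>G\<^esub> t) \<otimes>\<^bsub>P\<^esub> y) ` T y))"
      unfolding cover_def by (rule card_UN_le[OF finY])
    also have "\<dots> \<le> C"
      unfolding C_def
    proof (rule sum_mono)
      fix y assume "y \<in> Y"
      then have "finite (T y)" using finT YP by auto
      then show "card ((\<lambda>t. j (k \<otimes>\<^bsub>G\<^esub> inv\<^bsub>G\<^esub> t) \<otimes>\<^bsub>P\<^esub> y) ` T y \<union> (\<lambda>t. j (inv\<^bsub>G\<^esub> t) \<otimes>\<^bsub>P\<^esub> y) ` T y)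
        \<le> 2 * card (T y)"
        by (intro order_trans[OF card_Un_le]) (simp add: mult_2 add_mono card_image_le)
    qed
    finally show "card (cover k) \<le> C" .
  qed
  have "{x \<in> carrier P. inv\<^bsub>P\<^esub> x \<otimes>\<^bsub>P\<^esub> j k \<in> F \<and> inv\<^bsub>P\<^esub> x \<notin> F} \<subseteq> cover k"
    if k: "k \<in> carrier G" for k
  proof
    fix x assume "x \<in> {x \<in> carrier P. inv\<^bsub>P\<^esub> x \<otimes>\<^bsub>P\<^esub> j k \<in> F \<and> inv\<^bsub>P\<^esub> x \<notin> F}"
    then have x: "x \<in> carrier P" "inv\<^bsub>P\<^esub> x \<otimes>\<^bsub>P\<^esub> j k \<in> F" "inv\<^bsub>P\<^esub> x \<notin> F" by auto
    define D where "D = {d \<in> carrier G. inv\<^bsub>P\<^esub> x \<otimes>\<^bsub>P\<^esub> j d \<notin> F}"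
    have "\<one>\<^bsub>G\<^esub> \<in> D" "k \<notin> D" using x by (auto simp: D_def)
    then have "\<exists>d\<in>D. \<exists>s\<in>S. d \<otimes>\<^bsub>G\<^esub> s \<notin> D \<or> d \<otimes>\<^bsub>G\<^esub> inv\<^bsub>G\<^esub> s \<notin> D"
      using G.generate_right_closed[OF S(2), of D k "\<one>\<^bsub>G\<^esub>"] k S(3) by (auto simp: D_def)
    then obtain d s where d: "d \<in> D" "s \<in> S" "d \<otimes>\<^bsub>G\<^esub> s \<notin> D \<or> d \<otimes>\<^bsub>G\<^esub> inv\<^bsub>G\<^esub> s \<notin> D" by blast
    then have dG: "d \<in> carrier G" "s \<in> carrier G" using S(2) by (auto simp: D_def)
    then have "d \<otimes>\<^bsub>G\<^esub> inv\<^bsub>G\<^esub> s \<otimes>\<^bsub>G\<^esub> s = d" by (simp add: G.m_assoc)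
    then obtain k' where k': "k' \<in> carrier G" "(k' \<in> D) \<noteq> (k' \<otimes>\<^bsub>G\<^esub> s \<in> D)"
      using d dG by (metis G.inv_closed G.m_closed)
    define y where "y = inv\<^bsub>P\<^esub> (j k') \<otimes>\<^bsub>P\<^esub> x"
    have inv_y: "inv\<^bsub>P\<^esub> y = inv\<^bsub>P\<^esub> x \<otimes>\<^bsub>P\<^esub> j k'"
      using x k' by (simp add: y_def P.inv_mult_group)
    have "inv\<^bsub>P\<^esub> x \<otimes>\<^bsub>P\<^esub> j (k' \<otimes>\<^bsub>G\<^esub> s) = inv\<^bsub>P\<^esub> y \<otimes>\<^bsub>P\<^esub> j s"
      using k' dG x by (simp add: inv_y P.m_assoc)
    then have "(inv\<^bsub>P\<^esub> y \<in> F) \<noteq> (inv\<^bsub>P\<^esub> y \<otimes>\<^bsub>P\<^esub> j s \<in> F)"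
      using k' dG by (auto simp: D_def inv_y)
    moreover have "y \<in> carrier P" using k' x by (simp add: y_def)
    ultimately have y: "y \<in> Y" using d(2) by (auto simp: Y_def)
    have x_eq: "x = j k' \<otimes>\<^bsub>P\<^esub> y" using x k' by (simp add: y_def P.m_assoc[symmetric])
    have "j k' \<otimes>\<^bsub>P\<^esub> (inv\<^bsub>P\<^esub> (j k') \<otimes>\<^bsub>P\<^esub> j k) = j k"
      using k k' by (simp add: P.m_assoc[symmetric])
    then have "inv\<^bsub>P\<^esub> y \<otimes>\<^bsub>P\<^esub> j (inv\<^bsub>G\<^esub> k' \<otimes>\<^bsub>G\<^esub> k) = inv\<^bsub>P\<^esub> x \<otimes>\<^bsub>P\<^esub> j k"
      "inv\<^bsub>P\<^esub> y \<otimes>\<^bsub>P\<^esub> j (inv\<^bsub>G\<^esub> k') = inv\<^bsub>P\<^esub> x"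
      using x k k' by (simp_all add: inv_y P.m_assoc)
    then have "inv\<^bsub>G\<^esub> k' \<otimes>\<^bsub>G\<^esub> k \<in> B y" "inv\<^bsub>G\<^esub> k' \<in> carrier G - B y"
      using x k k' by (simp_all add: B_def)
    then consider "inv\<^bsub>G\<^esub> k' \<otimes>\<^bsub>G\<^esub> k \<in> T y" | "inv\<^bsub>G\<^esub> k' \<in> T y"
      unfolding T_def by (cases "finite (B y)") simp_all
    then show "x \<in> cover k"
    proof cases
      case 1
      have "k \<otimes>\<^bsub>G\<^esub> inv\<^bsub>G\<^esub> (inv\<^bsub>G\<^esub> k' \<otimes>\<^bsub>G\<^esub> k) = k'"
        using k k' by (simp add: G.inv_mult_group G.m_assoc[symmetric])
      then show ?thesis using 1 x_eq y unfolding cover_def by force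
    next
      case 2
      have "inv\<^bsub>G\<^esub> (inv\<^bsub>G\<^esub> k') = k'" using k' by simp
      then show ?thesis using 2 x_eq y unfolding cover_def by force
    qed
  qed
  then have "finite {x \<in> carrier P. inv\<^bsub>P\<^esub> x \<otimes>\<^bsub>P\<^esub> j k \<in> F \<and> inv\<^bsub>P\<^esub> x \<notin> F} \<and>
    card {x \<in> carrier P. inv\<^bsub>P\<^esub> x \<otimes>\<^bsub>P\<^esub> j k \<in> F \<and> inv\<^bsub>P\<^esub> x \<notin> F} \<le> C" if "k \<in> carrier G" for k
    using that card_cover[of k] by (meson card_mono finite_subset order_trans)
  then show ?thesis by (rule that)
qed

context amalgam_decomposition
begin

lemma starts_mult_right: "p \<in> starts s \<Longrightarrow> a \<in> A u \<Longrightarrow> p \<otimes> a \<in> starts s \<or> p \<otimes> a \<in> H"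
  using alt_mult_right unfolding starts_def by blast

lemma starts_almost_invariant:
  assumes "g \<in> carrier P"
  shows "finite {p \<in> carrier P. (p \<in> starts s) \<noteq> (p \<otimes> g \<in> starts s)}"
proof -
  define \<Delta> where "\<Delta> g = {p \<in> carrier P. (p \<in> starts s) \<noteq> (p \<otimes> g \<in> starts s)}" for g
  have factor: "finite (\<Delta> a)" if a: "a \<in> A u" for a u
  proof (rule finite_subset)
    have ac: "a \<in> carrier P" using a by (rule factor_closed(1))
    show "\<Delta> a \<subseteq> (\<lambda>h. h \<otimes> inv a) ` H \<union> H"
    proof
      fix p assume "p \<in> \<Delta> a"
      then have p: "p \<in> carrier P" "(p \<in> starts s) \<noteq> (p \<otimes> a \<in> starts s)" by (auto simp: \<Delta>_def)
      have eq: "p = p \<otimes> a \<otimes> inv a" using p ac by (simp add: m_assoc)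
      show "p \<in> (\<lambda>h. h \<otimes> inv a) ` H \<union> H"
      proof (cases "p \<in> starts s")
        case True
        then show ?thesis using starts_mult_right[OF True a] p eq by blast
      next
        case False
        then show ?thesis using starts_mult_right[of "p \<otimes> a" s "inv a" u] p a eq by auto
      qed
    qed
  qed (use finite_edge in simp)
  define D where "D = {g \<in> carrier P. finite (\<Delta> g)}"
  have closed: "d \<otimes> a \<in> D" if d: "d \<in> D" and a: "a \<in> A u" for d a u
  proof -
    have dc: "d \<in> carrier P" and ac: "a \<in> carrier P"
      using d a by (auto simp: D_def dest: factor_closed(1))
    have "finite ((\<lambda>q. q \<otimes> inv d) ` \<Delta> a \<union> \<Delta> d)" using factor[OF a] d by (simp add: D_def)
    moreover have "\<Delta> (d \<otimes> a) \<subseteq> (\<lambda>q. q \<otimes> inv d) ` \<Delta> a \<union> \<Delta> d"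
    proof
      fix p assume p: "p \<in> \<Delta> (d \<otimes> a)"
      then have pc: "p \<in> carrier P" by (simp add: \<Delta>_def)
      have "p = p \<otimes> d \<otimes> inv d" "p \<otimes> (d \<otimes> a) = p \<otimes> d \<otimes> a"
        using pc dc ac by (simp_all add: m_assoc)
      moreover from this have "p \<in> \<Delta> d \<or> p \<otimes> d \<in> \<Delta> a" using p pc dc by (auto simp: \<Delta>_def)
      ultimately show "p \<in> (\<lambda>q. q \<otimes> inv d) ` \<Delta> a \<union> \<Delta> d" by blast
    qed
    ultimately have "finite (\<Delta> (d \<otimes> a))" by (rule finite_subset[rotated])
    then show ?thesis using dc ac by (simp add: D_def)
  qed
  have "\<one> \<otimes> g \<in> D"
  proof (rule generate_right_closed[where S = "A True \<union> A False"])
    fix d a assume d: "d \<in> D" and "a \<in> A True \<union> A False"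
    then obtain u where "a \<in> A u" by blast
    then show "d \<otimes> a \<in> D \<and> d \<otimes> inv a \<in> D" by (intro conjI closed[OF d, of _ u]) auto
  next
    show "g \<in> generate P (A True \<union> A False)" using assms generated by simp
    show "\<one> \<in> D" by (simp add: D_def \<Delta>_def cong: conj_cong)
  qed (auto simp: D_def dest: factor_closed(1))
  then show ?thesis using assms by (simp add: D_def \<Delta>_def)
qed

text \<open>
  The \<open>n\<close> prefixes of an alternating product (starting with the empty one) give \<open>n\<close> half-trees that
  contain the product: these are the edges crossed on the way from \<open>\<one>\<close> to \<open>p\<close>.  The last clause implies that
  the half-trees do not contain \<open>\<one>\<close>, and is what the induction needs to keep them distinct.
\<close>

lemma alt_separators:
  "alt s n t p \<Longrightarrow> \<exists>X. finite X \<and> card X = n \<and>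
     (\<forall>x u. (x, u) \<in> X \<longrightarrow> x \<in> carrier P \<and> inv x \<otimes> p \<in> starts u \<and>
        (x = \<one> \<and> u = s \<or> x \<in> starts s \<and> inv x \<in> starts (\<not> u)))"
proof (induction rule: alternating.induct)
  case (single a s)
  then have "a \<in> starts s" "a \<in> carrier P"
    using alternating.single[of a A s H P] factor_closed(1) unfolding starts_def by blast+
  then show ?case by (intro exI[of _ "{(\<one>, s)}"]) auto
next
  case (prepend a s n t p)
  then obtain X where X: "finite X" "card X = n"
    and sep: "\<And>x u. (x, u) \<in> X \<Longrightarrow> x \<in> carrier P \<and> inv x \<otimes> p \<in> starts u \<and>
        (x = \<one> \<and> u = (\<not> s) \<or> x \<in> starts (\<not> s) \<and> inv x \<in> starts (\<not> u))"
    by (metis (no_types, lifting))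
  have a: "a \<in> carrier P" using prepend(1) by (rule factor_closed(1))
  have pc: "p \<in> carrier P" using prepend(3) by (rule alt_closed)
  have a_starts: "a \<in> starts s" "inv a \<in> starts s"
    using alternating.single[of a A s H P, OF prepend(1,2)] alt_inv unfolding starts_def by blast+
  have ap: "a \<otimes> p \<in> starts s"
    using alternating.prepend[of a A s H P, OF prepend(1-3)] unfolding starts_def by blast
  have prep: "a \<otimes> x \<in> starts s" if "x \<in> starts (\<not> s)" for x
    using that alternating.prepend[of a A s H P, OF prepend(1,2)] unfolding starts_def by blast
  define X' where "X' = insert (\<one>, s) ((\<lambda>(x, u). (a \<otimes> x, u)) ` X)"
  have step: "a \<otimes> x \<in> carrier P \<and> inv (a \<otimes> x) \<otimes> (a \<otimes> p) \<in> starts u \<and>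
      a \<otimes> x \<in> starts s \<and> inv (a \<otimes> x) \<in> starts (\<not> u)" if "(x, u) \<in> X" for x u
  proof -
    note x = sep[OF that]
    have ax: "a \<otimes> x \<in> starts s" using x a a_starts prep by auto
    have inv_ax: "inv (a \<otimes> x) = inv x \<otimes> inv a" using x a by (simp add: inv_mult_group)
    have "inv x \<otimes> inv a \<in> starts (\<not> u)"
    proof (cases "x = \<one>")
      case True
      then show ?thesis using x a a_starts starts_disjoint(2)[of \<one> "\<not> s"] by auto
    next
      case False
      then have "inv x \<in> starts (\<not> u)" using x by auto
      moreover have "inv x \<otimes> inv a \<notin> H"
        using starts_disjoint(2)[OF ax] inv_edge_iff[of "a \<otimes> x"] inv_ax x a by auto
      ultimately show ?thesis
        using starts_mult_right[of "inv x" "\<not> u" "inv a" s] prepend(1) by auto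
    qed
    moreover have "inv x \<otimes> inv a \<otimes> (a \<otimes> p) = inv x \<otimes> (inv a \<otimes> a) \<otimes> p"
      using x a pc by (simp only: m_assoc inv_closed m_closed)
    ultimately show ?thesis using x a ax inv_ax by simp
  qed
  have "inj_on (\<lambda>(x, u). (a \<otimes> x, u)) X"
    using a sep by (auto intro!: inj_onI)
  moreover have "(\<one>, s) \<notin> (\<lambda>(x, u). (a \<otimes> x, u)) ` X"
    using step starts_disjoint(2)[of \<one> s] by auto
  ultimately have "finite X'" "card X' = Suc n"
    using X by (simp_all add: X'_def card_image)
  moreover have "\<forall>x u. (x, u) \<in> X' \<longrightarrow> x \<in> carrier P \<and> inv x \<otimes> (a \<otimes> p) \<in> starts u \<and>
        (x = \<one> \<and> u = s \<or> x \<in> starts s \<and> inv x \<in> starts (\<not> u))"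
    using step a pc ap by (auto simp: X'_def)
  ultimately show ?case by blast
qed

text \<open>
  An alternating product of length \<open>n\<close> is separated from \<open>\<one>\<close> by \<open>n\<close> half-trees of the two types, and for
  each type \<open>bounded_separation\<close> bounds their number.
\<close>

lemma OE_image_bounded:
  assumes "OE_group G" and j: "j \<in> hom G P" "inj_on j (carrier G)"
  obtains C where "\<And>k s n t. k \<in> carrier G \<Longrightarrow> alt s n t (j k) \<Longrightarrow> n \<le> C"
proof -
  have "group P" by (rule is_group)
  obtain S where G: "group G" and S: "finite S" "S \<subseteq> carrier G" "generate G S = carrier G"
    "number_of_ends G S < 2"
    using assms by (auto simp: OE_group_def)
  define X where "X u k = {x \<in> carrier P. inv x \<otimes> j k \<in> starts u \<and> inv x \<notin> starts u}" for u k
  have "\<exists>C. \<forall>k \<in> carrier G. finite (X u k) \<and> card (X u k) \<le> C" for u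
  proof -
    obtain C where "\<And>k. k \<in> carrier G \<Longrightarrow> finite (X u k) \<and> card (X u k) \<le> C"
      unfolding X_def
      using bounded_separation[OF G \<open>group P\<close> j S starts_almost_invariant, of u] by blast
    then show ?thesis by blast
  qed
  then have "\<exists>C. \<forall>u. \<forall>k \<in> carrier G. finite (X u k) \<and> card (X u k) \<le> C u"
    by (intro choice allI)
  then obtain C where C: "\<And>u k. k \<in> carrier G \<Longrightarrow> finite (X u k) \<and> card (X u k) \<le> C u"
    by blast
  have "n \<le> C True + C False" if k: "k \<in> carrier G" and alt: "alt s n t (j k)" for k s n t
  proof -
    obtain Z where Z: "finite Z" "card Z = n"
      "\<And>x u. (x, u) \<in> Z \<Longrightarrow> x \<in> carrier P \<and> inv x \<otimes> j k \<in> starts u \<and>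
        (x = \<one> \<and> u = s \<or> x \<in> starts s \<and> inv x \<in> starts (\<not> u))"
      using alt_separators[OF alt] by (metis (no_types, lifting))
    have "(x, u) \<in> (\<lambda>x. (x, True)) ` X True k \<union> (\<lambda>x. (x, False)) ` X False k" if "(x, u) \<in> Z" for x u
    proof -
      have "inv x \<notin> starts u"
        using Z(3)[OF that] starts_disjoint(2)[of \<one> u] starts_disjoint(1)[of "inv x" u] by auto
      then show ?thesis using Z(3)[OF that] by (cases u) (auto simp: X_def)
    qed
    then have "Z \<subseteq> (\<lambda>x. (x, True)) ` X True k \<union> (\<lambda>x. (x, False)) ` X False k" by auto
    then have "n \<le> card ((\<lambda>x. (x, True)) ` X True k \<union> (\<lambda>x. (x, False)) ` X False k)"
      unfolding Z(2)[symmetric] using C[OF k] by (intro card_mono finite_UnI finite_imageI) auto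
    also have "\<dots> \<le> card (X True k) + card (X False k)"
      using C[OF k] by (intro order_trans[OF card_Un_le] add_mono card_image_le) auto
    also have "\<dots> \<le> C True + C False" using C[OF k] by (simp add: add_mono)
    finally show ?thesis .
  qed
  then show ?thesis by (rule that)
qed

end


context group
begin

definition conjugate :: "'a \<Rightarrow> 'a set \<Rightarrow> 'a set"
  where "conjugate g K = (\<lambda>k. g \<otimes> k \<otimes> inv g) ` K"

lemma cancel_left:
  "x \<in> carrier G \<Longrightarrow> y \<in> carrier G \<Longrightarrow> inv x \<otimes> (x \<otimes> y) = y"
  "x \<in> carrier G \<Longrightarrow> y \<in> carrier G \<Longrightarrow> x \<otimes> (inv x \<otimes> y) = y"
  by (simp_all add: m_assoc[symmetric])

lemma conjugate_mult:
  "g \<in> carrier G \<Longrightarrow> h \<in> carrier G \<Longrightarrow> K \<subseteq> carrier G \<Longrightarrow>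
    conjugate g (conjugate h K) = conjugate (g \<otimes> h) K"
  unfolding conjugate_def image_image
  by (intro image_cong) (auto simp: inv_mult_group m_assoc)

lemma conjugate_one: "K \<subseteq> carrier G \<Longrightarrow> conjugate \<one> K = K"
  by (force simp: conjugate_def)

lemma conjugate_mono: "K \<subseteq> L \<Longrightarrow> conjugate g K \<subseteq> conjugate g L"
  by (auto simp: conjugate_def)

lemma conjugate_closed: "g \<in> carrier G \<Longrightarrow> K \<subseteq> carrier G \<Longrightarrow> conjugate g K \<subseteq> carrier G"
  by (auto simp: conjugate_def)

lemma conjugate_subset_iff:
  assumes "g \<in> carrier G" "K \<subseteq> carrier G" "L \<subseteq> carrier G"
  shows "K \<subseteq> conjugate g L \<longleftrightarrow> conjugate (inv g) K \<subseteq> L"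
proof -
  have "conjugate (inv g) (conjugate g L) = L" "conjugate g (conjugate (inv g) K) = K"
    using assms by (simp_all add: conjugate_mult conjugate_one)
  then show ?thesis using conjugate_mono by metis
qed

lemma conjugation_iso: "g \<in> carrier G \<Longrightarrow> (\<lambda>k. g \<otimes> k \<otimes> inv g) \<in> iso G G"
proof (rule isoI)
  assume g: "g \<in> carrier G"
  show "(\<lambda>k. g \<otimes> k \<otimes> inv g) \<in> hom G G"
    using g by (intro homI) (simp_all add: m_assoc cancel_left)
  show "bij_betw (\<lambda>k. g \<otimes> k \<otimes> inv g) (carrier G) (carrier G)"
    using g by (intro bij_betw_byWitness[where f' = "\<lambda>k. inv g \<otimes> k \<otimes> g"])
      (auto simp: m_assoc cancel_left)
qed

lemma conjugate_subgroup: "subgroup K G \<Longrightarrow> g \<in> carrier G \<Longrightarrow> subgroup (conjugate g K) G"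
  unfolding conjugate_def
  using conjugation_iso[of g] by (intro group_hom.subgroup_img_is_subgroup[of G])
    (auto simp: iso_def group_hom_def group_hom_axioms_def)

lemma conjugate_self:
  assumes "subgroup K G" "k \<in> K" shows "conjugate k K = K"
proof -
  interpret K: subgroup K G by fact
  have sub: "conjugate h K \<subseteq> K" if "h \<in> K" for h using that by (auto simp: conjugate_def)
  have "K \<subseteq> conjugate k K"
    using assms sub[of "inv k"] by (subst conjugate_subset_iff) auto
  then show ?thesis using sub assms by auto
qed

end

lemma alternating_image:
  assumes "alternating P (\<lambda>s. \<theta> ` A s) (\<theta> ` H) s n t p"
    and Q: "group Q" and \<theta>: "\<theta> \<in> hom Q P" and A: "\<And>s. A s \<subseteq> carrier Q"
  shows "\<exists>q \<in> carrier Q. alternating Q A H s n t q \<and> p = \<theta> q"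
  using assms(1)
proof (induction rule: alternating.induct)
  case (single a s)
  then obtain b where "b \<in> A s" "a = \<theta> b" by auto
  moreover from this have "b \<notin> H" using single by auto
  ultimately show ?case using A alternating.single[of b A s H Q] by blast
next
  case (prepend a s n t p)
  then obtain b q where b: "b \<in> A s" "a = \<theta> b"
    and q: "q \<in> carrier Q" "alternating Q A H (\<not> s) n t q" "p = \<theta> q" by auto
  have "alternating Q A H s (Suc n) t (b \<otimes>\<^bsub>Q\<^esub> q)"
    using b q prepend by (intro alternating.prepend) auto
  moreover have bQ: "b \<in> carrier Q" using b A by auto
  then have "a \<otimes>\<^bsub>P\<^esub> p = \<theta> (b \<otimes>\<^bsub>Q\<^esub> q)" using b q \<theta> by (simp add: hom_def)
  moreover have "b \<otimes>\<^bsub>Q\<^esub> q \<in> carrier Q" using Q bQ q by (simp add: group.is_monoid monoid.m_closed)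
  ultimately show ?case by blast
qed

lemma amalgam_decomposition_image:
  assumes "amalgam_decomposition Q A H" "group P" and \<theta>: "\<theta> \<in> iso Q P"
  shows "amalgam_decomposition P (\<lambda>s. \<theta> ` A s) (\<theta> ` H)"
proof -
  interpret Q: amalgam_decomposition Q A H by fact
  interpret P: group P by fact
  have hom: "\<theta> \<in> hom Q P" and inj: "inj_on \<theta> (carrier Q)" and surj: "\<theta> ` carrier Q = carrier P"
    using \<theta> by (auto simp: iso_def bij_betw_def)
  interpret h: group_hom Q P \<theta> using hom by unfold_locales
  have AQ: "A s \<subseteq> carrier Q" for s using Q.factor_closed(1) by blast
  have HQ: "H \<subseteq> carrier Q" using Q.H_factor AQ by blast
  show ?thesis
  proof (intro amalgam_decomposition.intro amalgam_decomposition_axioms.intro)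
    show "group P" by fact
    show "subgroup (\<theta> ` A s) P" for s by (rule h.subgroup_img_is_subgroup[OF Q.subgroup_factor])
    show "\<theta> ` A s \<inter> \<theta> ` A (\<not> s) = \<theta> ` H" for s
      using inj_on_image_Int[OF inj AQ AQ, of s "\<not> s"] Q.edge by simp
    show "finite (\<theta> ` H)" using Q.finite_edge by simp
    show "\<theta> ` A s \<noteq> \<theta> ` H" for s
      using inj_on_image_eq_iff[OF inj AQ HQ, of s] Q.proper by simp
    show "generate P (\<theta> ` A True \<union> \<theta> ` A False) = carrier P"
      using h.generate_img[of "A True \<union> A False"] AQ Q.generated surj by (simp add: image_Un)
    fix s n t p assume "alternating P (\<lambda>s. \<theta> ` A s) (\<theta> ` H) s n t p"
    then have "\<exists>q \<in> carrier Q. alternating Q A H s n t q \<and> p = \<theta> q"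
      using Q.is_group hom AQ by (rule alternating_image)
    then obtain q where q: "q \<in> carrier Q" "alternating Q A H s n t q" "p = \<theta> q" by blast
    then show "p \<notin> \<theta> ` H"
      using Q.reduced[OF q(2)] inj_on_image_mem_iff[OF inj q(1) HQ] by simp
  qed
qed

context amalgam_decomposition
begin

lemma alt_single: "a \<in> A s \<Longrightarrow> a \<notin> H \<Longrightarrow> alt s 1 s a"
  by (rule alternating.single)

lemma alt_prepend: "a \<in> A s \<Longrightarrow> a \<notin> H \<Longrightarrow> alt (\<not> s) n t p \<Longrightarrow> alt s (Suc n) t (a \<otimes> p)"
  by (rule alternating.prepend)

lemma factor_alt: "a \<in> A s \<Longrightarrow> alt s' n t a \<Longrightarrow> n = 1"
  using alt_single[of a s] alt_length_unique reduced by blast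

text \<open>
  Take an element \<open>k\<close> of maximal length \<open>Suc N\<close>, with first letter \<open>a\<close>.  Multiplying by \<open>k\<close> on either side
  shows that all elements of \<open>K\<close> outside \<open>H\<close> start and end in the factor of \<open>a\<close>, since the product would
  otherwise be too long.  Comparing with \<open>inv k\<close> shows that those of maximal length have a first letter in
  \<open>a H\<close>.  So conjugation by \<open>a\<close> makes the maximal length drop, as long as \<open>k\<close> is not a single letter.
\<close>

lemma bounded_subgroup_elliptic:
  assumes "subgroup K P" "\<And>k s n t. k \<in> K \<Longrightarrow> alt s n t k \<Longrightarrow> n \<le> N"
  shows "\<exists>x \<in> carrier P. \<exists>s. K \<subseteq> conjugate x (A s)"
  using assms
proof (induction N arbitrary: K)
  case 0
  have "K \<subseteq> A True"
  proof
    fix k assume k: "k \<in> K"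
    then have "k \<in> carrier P" using 0(1) by (rule subgroup.mem_carrier[rotated])
    moreover have "\<not> alt s n t k" for s n t using 0(2)[OF k] alt_pos by fastforce
    ultimately have "k \<in> H" using edge_or_starts[of k] unfolding starts_def by blast
    then show "k \<in> A True" by simp
  qed
  moreover have "A True \<subseteq> carrier P" using factor_closed(1) by blast
  ultimately show ?case using conjugate_one[of "A True"] by (intro bexI[of _ \<one>] exI[of _ True]) auto
next
  case (Suc N)
  interpret K: subgroup K P by (rule Suc.prems)
  have AP: "A s \<subseteq> carrier P" for s using factor_closed(1) by blast
  show ?case
  proof (cases "\<exists>k\<in>K. \<exists>s t. alt s (Suc N) t k")
    case False
    have "n \<le> N" if "k \<in> K" "alt s n t k" for k s n t
      using Suc.prems(2)[OF that] False that by (metis le_Suc_eq)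
    then show ?thesis using Suc.IH[OF Suc.prems(1)] by blast
  next
    case True
    then obtain k s t where k: "k \<in> K" "alt s (Suc N) t k" by blast
    have "t = s"
    proof (rule ccontr)
      assume "t \<noteq> s"
      then have "(\<not> t) = s" by auto
      then have "alt s (Suc N + Suc N) t (k \<otimes> k)" using alt_append[OF k(2), of "Suc N" t k] k(2) by simp
      then show False using Suc.prems(2)[of "k \<otimes> k"] k(1) by fastforce
    qed
    \<comment> \<open>Otherwise a product with \<open>k\<close> would be longer than the bound.\<close>
    have ends: "s' = s \<and> t' = s" if "k' \<in> K" "alt s' n t' k'" for k' s' n t'
    proof (rule ccontr)
      assume "\<not> (s' = s \<and> t' = s)"
      then consider "s' = (\<not> s)" | "s = (\<not> t')" by auto
      then show False
      proof cases
        case 1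
        then have "alt s (Suc N + n) t' (k \<otimes> k')" using alt_append[OF k(2), of n t' k'] that \<open>t = s\<close> by simp
        then show False using Suc.prems(2)[of "k \<otimes> k'"] that k(1) alt_pos[OF that(2)] by fastforce
      next
        case 2
        then have "alt s' (n + Suc N) t (k' \<otimes> k)" using alt_append[OF that(2), of "Suc N" t k] k(2) by simp
        then show False using Suc.prems(2)[of "k' \<otimes> k"] that k(1) alt_pos[OF that(2)] by fastforce
      qed
    qed
    show ?thesis
    proof (cases "N = 0")
      case True
      have "K \<subseteq> A s"
      proof
        fix k' assume k': "k' \<in> K"
        show "k' \<in> A s"
        proof (cases "k' \<in> H")
          case False
          then obtain s' n t' where alt: "alt s' n t' k'"
            using edge_or_starts[OF K.mem_carrier[OF k']] unfolding starts_def by blast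
          from alt show ?thesis
          proof cases
            case single
            then show ?thesis using ends[OF k' alt] by simp
          next
            case (prepend a m q)
            then show ?thesis using Suc.prems(2)[OF k' alt] True alt_pos by fastforce
          qed
        qed simp
      qed
      then show ?thesis
        using conjugate_one[OF AP, of s] by (intro bexI[of _ \<one>] exI[of _ s]) auto
    next
      case N: False
      from k(2) obtain a q where a: "a \<in> A s" "a \<notin> H" and q: "alt (\<not> s) N s q" "k = a \<otimes> q"
      proof cases
        case (prepend a q)
        then show ?thesis using that \<open>t = s\<close> by simp
      qed (use N in simp)
      have ac: "a \<in> carrier P" and qc: "q \<in> carrier P"
        using a factor_closed(1) alt_closed[OF q(1)] by auto
      have short: "n \<le> N" if k': "k' \<in> K" and alt: "alt s1 n t1 (inv a \<otimes> k' \<otimes> a)" for k' s1 n t1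
      proof (cases "k' \<in> A s")
        case True
        then have "inv a \<otimes> k' \<otimes> a \<in> A s" using a by simp
        then show ?thesis using factor_alt[OF _ alt] N by fastforce
      next
        case False
        then have "k' \<notin> H" by auto
        then obtain s' n' t' where alt': "alt s' n' t' k'"
          using edge_or_starts[OF K.mem_carrier[OF k']] unfolding starts_def by blast
        have st: "s' = s" "t' = s" using ends[OF k' alt'] by auto
        from alt' obtain a' q' m where a': "a' \<in> A s" "a' \<notin> H"
          and q': "alt (\<not> s) m s q'" "k' = a' \<otimes> q'" "n' = Suc m"
        proof cases
          case single
          then show ?thesis using False st by simp
        next
          case (prepend a' m q')
          then show ?thesis using that st by simp
        qed
        have "m \<le> N" using Suc.prems(2)[OF k' alt'] q' by simp
        have a'c: "a' \<in> carrier P" and q'c: "q' \<in> carrier P"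
          using a' factor_closed(1) alt_closed[OF q'(1)] by auto
        define b where "b = inv a \<otimes> a'"
        have b: "b \<in> A s" using a a' by (simp add: b_def)
        have bq': "inv a \<otimes> k' = b \<otimes> q'" using ac a'c q'c q' by (simp add: b_def m_assoc)
        obtain s2 m2 where m2: "alt s2 m2 s (inv a \<otimes> k')" "m2 \<le> N"
        proof (cases "b \<in> H")
          case True
          then show ?thesis using that alt_edge_left[OF True q'(1)] bq' \<open>m \<le> N\<close> by simp
        next
          case bH: False
          have "inv k \<otimes> k' = inv q \<otimes> (b \<otimes> q')"
            using q q' ac qc a'c q'c by (simp add: b_def inv_mult_group m_assoc)
          moreover have "alt s (N + Suc m) s (inv q \<otimes> (b \<otimes> q'))"
            using alt_append[OF alt_inv[OF q(1)], of "Suc m" s "b \<otimes> q'"] alt_prepend[OF b bH q'(1)] by simp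
          ultimately have "alt s (N + Suc m) s (inv k \<otimes> k')" by simp
          moreover have "inv k \<otimes> k' \<in> K" using k(1) k' by simp
          ultimately have "N + Suc m \<le> Suc N" using Suc.prems(2) by blast
          then have "m = 0" by simp
          then show ?thesis using alt_pos[OF q'(1)] by simp
        qed
        then have "inv a \<otimes> k' \<otimes> a \<in> H \<or> (\<exists>m v. alt s2 m v (inv a \<otimes> k' \<otimes> a) \<and> m \<le> N)"
          using alt_mult_right[OF m2(1) a(1)] by auto
        then show ?thesis using alt reduced alt_length_unique by blast
      qed
      have conj: "conjugate (inv a) K = (\<lambda>k. inv a \<otimes> k \<otimes> a) ` K"
        using ac by (simp add: conjugate_def)
      have "\<exists>x \<in> carrier P. \<exists>s. conjugate (inv a) K \<subseteq> conjugate x (A s)"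
      proof (rule Suc.IH)
        show "subgroup (conjugate (inv a) K) P"
          using ac by (intro conjugate_subgroup K.subgroup_axioms) simp
      qed (use short conj in auto)
      then obtain x s' where x: "x \<in> carrier P" "conjugate (inv a) K \<subseteq> conjugate x (A s')"
        by blast
      then have "K \<subseteq> conjugate a (conjugate x (A s'))"
        using ac x conjugate_closed[OF x(1) AP] K.subset by (subst conjugate_subset_iff) auto
      then show ?thesis
        using x ac AP by (intro bexI[of _ "a \<otimes> x"] exI[of _ s']) (simp_all add: conjugate_mult)
    qed
  qed
qed

lemma OE_image_elliptic:
  assumes "OE_group G" and j: "j \<in> hom G P" "inj_on j (carrier G)"
  shows "\<exists>x \<in> carrier P. \<exists>s. j ` carrier G \<subseteq> conjugate x (A s)"
proof -
  obtain C where C: "\<And>k s n t. k \<in> carrier G \<Longrightarrow> alt s n t (j k) \<Longrightarrow> n \<le> C"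
    using OE_image_bounded[OF assms] by blast
  have "group G" using assms(1) by (simp add: OE_group_def)
  then interpret j: group_hom G P j
    using j is_group by (simp add: group_hom_def group_hom_axioms_def)
  show ?thesis using C by (intro bounded_subgroup_elliptic[OF j.img_is_subgroup]) blast
qed

lemma strip_left:
  assumes "p \<in> carrier P"
  obtains a q where "a \<in> A s" "q \<in> carrier P" "p = a \<otimes> q" "q = \<one> \<or> q \<in> starts (\<not> s)"
proof -
  have "p \<in> H \<or> p \<in> starts s \<or> p \<in> starts (\<not> s)"
    using edge_or_starts[OF assms] by (cases s) auto
  then show ?thesis
  proof (elim disjE)
    assume "p \<in> H"
    then show ?thesis using that[of p \<one>] assms by simp
  next
    assume "p \<in> starts s"
    then obtain n t where "alt s n t p" by (auto simp: starts_def)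
    then show ?thesis
    proof cases
      case single
      then show ?thesis using that[of p \<one>] assms by simp
    next
      case (prepend a m q)
      then show ?thesis using that[of a q] alt_closed by (auto simp: starts_def)
    qed
  next
    assume "p \<in> starts (\<not> s)"
    then show ?thesis using that[of \<one> p] assms by simp
  qed
qed

text \<open>
  A factor fixes only one vertex of the tree: if it also fixed another one, it would fix an edge at its own
  vertex and be equal to \<open>H\<close>.
\<close>

lemma factor_in_conjugate:
  assumes sub: "A s \<subseteq> conjugate z (A t)" and z: "z \<in> carrier P"
  shows "s = t \<and> z \<in> A s"
proof -
  have AP: "A s \<subseteq> carrier P" for s using factor_closed(1) by blast
  obtain a q where a: "a \<in> A s" and q: "q \<in> carrier P" "z = a \<otimes> q" "q = \<one> \<or> q \<in> starts (\<not> s)"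
    using strip_left[OF z] by blast
  have ac: "a \<in> carrier P" using a by (rule factor_closed(1))
  have "A s \<subseteq> conjugate a (conjugate q (A t))"
    using sub q ac AP by (simp add: conjugate_mult)
  then have "conjugate (inv a) (A s) \<subseteq> conjugate q (A t)"
    using ac q AP conjugate_closed[OF q(1) AP] by (simp add: conjugate_subset_iff)
  then have sub': "A s \<subseteq> conjugate q (A t)"
    using conjugate_self[OF subgroup_factor, of "inv a" s] a by simp
  have "q = \<one>"
  proof (rule ccontr)
    assume "q \<noteq> \<one>"
    then obtain n u where alt: "alt (\<not> s) n u q" using q by (auto simp: starts_def)
    obtain b where b: "b \<in> A s" "b \<notin> H" using proper[of s] H_factor[of s] by auto
    then obtain c where c: "c \<in> A t" "b = q \<otimes> c \<otimes> inv q" using sub' by (auto simp: conjugate_def)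
    have cc: "c \<in> carrier P" using c(1) by (rule factor_closed(1))
    have "alt u (n + Suc n) u (inv q \<otimes> (b \<otimes> q))"
      by (rule alt_append[OF alt_inv[OF alt]]) (use alt_prepend[OF b alt] in simp)
    moreover have "inv q \<otimes> (b \<otimes> q) = c"
      using c(2) cc q by (simp add: m_assoc cancel_left)
    ultimately have "n + Suc n = 1" using factor_alt[OF c(1)] by simp
    then show False using alt_pos[OF alt] by simp
  qed
  then have "A s \<subseteq> A t" "z = a" using sub' AP q ac by (simp_all add: conjugate_one)
  moreover have "s = t"
  proof (rule ccontr)
    assume "s \<noteq> t"
    then have "A s \<subseteq> H" using \<open>A s \<subseteq> A t\<close> in_both_factors by blast
    then show False using proper H_factor by blast
  qed
  ultimately show ?thesis using a by simp
qed

end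


section \<open>Two decompositions of the same group\<close>

context amalgam_decomposition
begin

lemma factor_subset: "A s \<subseteq> carrier P"
  using factor_closed(1) by blast

lemma startsI: "alt s n t p \<Longrightarrow> p \<in> starts s"
  by (auto simp: starts_def)

lemma factor_starts: "a \<in> A s \<Longrightarrow> a \<notin> H \<Longrightarrow> a \<in> starts s"
  using alt_single startsI by blast

lemma starts_prepend: "a \<in> A s \<Longrightarrow> a \<notin> H \<Longrightarrow> p \<in> starts (\<not> s) \<Longrightarrow> a \<otimes> p \<in> starts s"
  unfolding starts_def using alt_prepend by blast

lemma starts_append:
  assumes "p \<in> starts s" "inv p \<in> starts t" "q \<in> starts (\<not> t)"
  shows "p \<otimes> q \<in> starts s"
proof -
  obtain n t' m u k v where alts: "alt s n t' p" "alt t m u (inv p)" "alt (\<not> t) k v q"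
    using assms by (auto simp: starts_def)
  then have "t' = t" using alt_start_unique[OF alt_inv[OF alts(1)] alts(2)] by simp
  then show ?thesis using alt_append[OF alts(1)] alts(3) startsI by blast
qed

lemma strip_right:
  assumes "p \<in> carrier P"
  obtains q b where "b \<in> A s" "q \<in> carrier P" "p = q \<otimes> b" "q = \<one> \<or> inv q \<in> starts (\<not> s)"
proof -
  obtain a r where a: "a \<in> A s" "r \<in> carrier P" "inv p = a \<otimes> r" "r = \<one> \<or> r \<in> starts (\<not> s)"
    using strip_left[of "inv p" s] assms by auto
  have ac: "a \<in> carrier P" using a(1) by (rule factor_closed(1))
  have "p = inv (inv p)" using assms by simp
  then have "p = inv r \<otimes> inv a" using a ac by (simp add: inv_mult_group)
  then show ?thesis using that[of "inv a" "inv r"] a by auto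
qed

text \<open>
  Double cosets of the two factors: the representative \<open>y\<close> is trivial, or neither factor can
  shorten it.
\<close>

lemma strip_both:
  assumes "p \<in> carrier P" "t = (\<not> s)"
  obtains a y b where "a \<in> A s" "b \<in> A t" "y \<in> carrier P" "p = a \<otimes> y \<otimes> b"
    "y = \<one> \<or> y \<in> starts t \<and> inv y \<in> starts s"
proof -
  obtain a q where a: "a \<in> A s" "q \<in> carrier P" "p = a \<otimes> q" "q = \<one> \<or> q \<in> starts t"
    using strip_left[OF assms(1), of s] assms(2) by blast
  obtain y b where b: "b \<in> A t" "y \<in> carrier P" "q = y \<otimes> b" "y = \<one> \<or> inv y \<in> starts (\<not> t)"
    using strip_right[OF a(2), of t] by blast
  have ac: "a \<in> carrier P" and bc: "b \<in> carrier P"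
    using a(1) b(1) factor_closed(1) by blast+
  have p: "p = a \<otimes> y \<otimes> b" using a b ac bc by (simp add: m_assoc)
  show ?thesis
  proof (cases "y = \<one>")
    case True
    then show ?thesis using that a b p by blast
  next
    case False
    then have inv_y: "inv y \<in> starts s" using b assms(2) by simp
    have "y \<in> starts t"
    proof -
      obtain n u where "alt s n u (inv y)" using inv_y by (auto simp: starts_def)
      then have y: "y \<in> starts u" using alt_inv startsI b(2) by fastforce
      have "u \<noteq> s"
      proof
        assume "u = s"
        then have "q \<in> starts s \<or> q \<in> H" using starts_mult_right[OF y b(1)] b(3) by simp
        moreover have "q \<noteq> \<one>"
        proof
          assume "q = \<one>"
          then have "inv y = b" using b bc inv_equality[of b y] by (metis inv_comm)
          then show False using factor_not_starts[OF b(1)] inv_y assms(2) by simp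
        qed
        ultimately show False using a(4) starts_disjoint[of q t] assms(2) by auto
      qed
      then show ?thesis using y assms(2) by simp
    qed
    then show ?thesis using that a b p inv_y by blast
  qed
qed

text \<open>
  Here \<open>B True\<close> and \<open>B False\<close> are the stabilizers of vertices at distance at least three.  Their intersection
  fixes the path between them, so by the equality of orders it coincides with the stabilizer of the first and of
  the last edge.  Then alternating products over \<open>B\<close> move the base edge into one of the two
  half-trees cut off by the ends of the path, whereas \<open>y\<close> moves it to the last edge of the path; so
  \<open>B True\<close> and \<open>B False\<close> do not generate \<open>y\<close>.
\<close>

lemma no_long_conjugator:
  assumes Y: "amalgam_decomposition P B K" and card: "card K = card H"
    and BT: "B True = A u" and BF: "B False = conjugate y (A (\<not> u))"
    and y: "y \<in> starts (\<not> u)" "inv y \<in> starts u"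
  shows False
proof -
  interpret Y: amalgam_decomposition P B K by fact
  have yc: "y \<in> carrier P" using y starts_closed by blast
  have K_sub: "k \<in> H \<and> inv y \<otimes> k \<otimes> y \<in> H" if k: "k \<in> K" for k
  proof -
    have "k \<in> A u" "k \<in> B False" using Y.H_factor[of True] Y.H_factor[of False] BT k by auto
    then obtain c where c: "c \<in> A (\<not> u)" "k = y \<otimes> c \<otimes> inv y" by (auto simp: BF conjugate_def)
    have cc: "c \<in> carrier P" using c(1) by (rule factor_closed(1))
    have ky: "k \<otimes> y = y \<otimes> c" "inv y \<otimes> k \<otimes> y = c" "inv y \<otimes> k = c \<otimes> inv y"
      using c(2) cc yc by (simp_all add: m_assoc cancel_left)
    have "k \<in> H"
    proof (rule ccontr)
      assume "k \<notin> H"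
      then have "k \<otimes> y \<in> starts u" using starts_prepend \<open>k \<in> A u\<close> y by blast
      moreover have "y \<otimes> c \<in> starts (\<not> u) \<or> y \<otimes> c \<in> H"
        using starts_mult_right[OF y(1) c(1)] .
      ultimately show False using ky starts_disjoint by metis
    qed
    moreover have "c \<in> H"
    proof (rule ccontr)
      assume "c \<notin> H"
      then have "c \<otimes> inv y \<in> starts (\<not> u)" using starts_prepend[OF c(1)] y by simp
      moreover have "inv y \<otimes> k \<in> starts u \<or> inv y \<otimes> k \<in> H"
        using starts_mult_right[OF y(2) \<open>k \<in> A u\<close>] .
      ultimately show False using ky starts_disjoint by metis
    qed
    ultimately show ?thesis using ky by simp
  qed
  then have "K = H" using card finite_edge by (intro card_subset_eq) auto
  have HP: "H \<subseteq> carrier P" by auto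
  have conj_H: "conjugate (inv y) H = H"
  proof (rule card_subset_eq[OF finite_edge])
    show "conjugate (inv y) H \<subseteq> H" using K_sub yc \<open>K = H\<close> by (auto simp: conjugate_def)
    have "inj_on (\<lambda>k. inv y \<otimes> k \<otimes> inv (inv y)) (carrier P)"
      using conjugation_iso[of "inv y"] yc by (auto simp: iso_def bij_betw_def)
    then show "card (conjugate (inv y) H) = card H"
      unfolding conjugate_def by (intro card_image) (rule inj_on_subset[OF _ HP])
  qed
  have B_letter: "\<exists>c \<in> A (\<not> u). c \<notin> H \<and> inv y \<otimes> a = c \<otimes> inv y" if a: "a \<in> B False" "a \<notin> H" for a
  proof -
    obtain c where c: "c \<in> A (\<not> u)" "a = y \<otimes> c \<otimes> inv y" using a by (auto simp: BF conjugate_def)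
    have cc: "c \<in> carrier P" using c(1) by (rule factor_closed(1))
    have "c \<notin> H"
    proof
      assume "c \<in> H"
      then obtain h where h: "h \<in> H" "c = inv y \<otimes> h \<otimes> inv (inv y)"
        using conj_H unfolding conjugate_def by blast
      have "h \<in> carrier P" using h(1) by simp
      then have "a = h" using c(2) h(2) yc by (simp add: m_assoc cancel_left)
      then show False using h a by simp
    qed
    then show ?thesis using c cc yc by (auto simp: m_assoc cancel_left)
  qed
  \<comment> \<open>Ping-pong: letters of \<open>A u\<close> carry the half-tree beyond the last edge of the path into the
     one before the first edge, and letters of the conjugate do the opposite.\<close>
  have ping_pong: "(if s then p \<in> starts u else inv y \<otimes> p \<in> starts (\<not> u)) \<and> p \<in> carrier P"
    if "alternating P B K s n t p" for s n t p
    using that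
  proof (induction rule: alternating.induct)
    case (single a s)
    show ?case
    proof (cases s)
      case True
      then show ?thesis using single BT \<open>K = H\<close> factor_starts starts_closed by auto
    next
      case False
      then obtain c where "c \<in> A (\<not> u)" "c \<notin> H" "inv y \<otimes> a = c \<otimes> inv y"
        using B_letter single \<open>K = H\<close> by auto
      then show ?thesis using False starts_prepend[of c "\<not> u" "inv y"] y single Y.factor_closed(1)
        by auto
    qed
  next
    case (prepend a s n t p)
    have ac: "a \<in> carrier P" using prepend(1) by (rule Y.factor_closed(1))
    show ?case
    proof (cases s)
      case True
      then have p: "p \<in> carrier P" "inv y \<otimes> p \<in> starts (\<not> u)" using prepend.IH by auto
      then have "y \<otimes> (inv y \<otimes> p) \<in> starts (\<not> u)" using starts_append[OF y] by blast
      then have "p \<in> starts (\<not> u)" using p yc by (simp add: cancel_left)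
      then show ?thesis using True prepend BT \<open>K = H\<close> starts_prepend[of a u p] ac p by auto
    next
      case False
      then have p: "p \<in> carrier P" "p \<in> starts u" using prepend.IH by auto
      have "inv y \<otimes> p \<in> starts u"
        using starts_append[of "inv y" u "\<not> u" p] y yc p by simp
      moreover obtain c where c: "c \<in> A (\<not> u)" "c \<notin> H" "inv y \<otimes> a = c \<otimes> inv y"
        using B_letter False prepend \<open>K = H\<close> by auto
      ultimately have "c \<otimes> (inv y \<otimes> p) \<in> starts (\<not> u)" using starts_prepend[of c "\<not> u"] by simp
      moreover have "inv y \<otimes> (a \<otimes> p) = c \<otimes> (inv y \<otimes> p)"
        using c factor_closed(1)[OF c(1)] ac p yc by (metis inv_closed m_assoc)
      ultimately show ?thesis using False ac p by simp
    qed
  qed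
  consider "y \<in> K" | "y \<in> Y.starts True" | "y \<in> Y.starts False"
    using Y.edge_or_starts[OF yc] by blast
  then show False
  proof cases
    case 1
    then show ?thesis using \<open>K = H\<close> y starts_disjoint by blast
  next
    case 2
    then have "y \<in> starts u" using ping_pong unfolding Y.starts_def by fastforce
    then show ?thesis using y starts_disjoint by blast
  next
    case 3
    then have "inv y \<otimes> y \<in> starts (\<not> u)" using ping_pong unfolding Y.starts_def by fastforce
    then show ?thesis using yc starts_disjoint(2)[of \<one>] by simp
  qed
qed

text \<open>
  By \<open>factor_in_conjugate\<close> the inclusions of the factors into conjugates of each other are equalities and
  match the factors bijectively.  Conjugating one factor into place leaves a relative conjugator for
  the other, which \<open>no_long_conjugator\<close> shows to be trivial up to the factors themselves.
\<close>

theorem conjugate_decompositions: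
  assumes Y: "amalgam_decomposition P B K" and card: "card K = card H"
    and BA: "\<And>s. \<exists>x \<in> carrier P. \<exists>t. B s \<subseteq> conjugate x (A t)"
    and AB: "\<And>s. \<exists>x \<in> carrier P. \<exists>t. A s \<subseteq> conjugate x (B t)"
  obtains g u where "g \<in> carrier P" "\<And>s. B s = conjugate g (A (s = u))"
proof -
  interpret Y: amalgam_decomposition P B K by fact
  have "\<exists>x \<in> carrier P. \<exists>t. B s = conjugate x (A t) \<and> (\<exists>z \<in> carrier P. A t \<subseteq> conjugate z (B s))" for s
  proof -
    obtain x t where x: "x \<in> carrier P" "B s \<subseteq> conjugate x (A t)" using BA by blast
    obtain z r where z: "z \<in> carrier P" "A t \<subseteq> conjugate z (B r)" using AB by blast
    have "conjugate x (A t) \<subseteq> conjugate (x \<otimes> z) (B r)"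
      using conjugate_mono[OF z(2), of x] x z Y.factor_subset by (simp add: conjugate_mult)
    then have xz: "s = r" "x \<otimes> z \<in> B s"
      using x z Y.factor_in_conjugate[of s "x \<otimes> z" r] by auto
    then have "conjugate x (A t) \<subseteq> B s"
      using \<open>conjugate x (A t) \<subseteq> _\<close> conjugate_self[OF Y.subgroup_factor] by simp
    then show ?thesis using x z xz by blast
  qed
  then obtain x \<sigma> z where x: "\<And>s. x s \<in> carrier P" "\<And>s. B s = conjugate (x s) (A (\<sigma> s))"
    and z: "\<And>s. z s \<in> carrier P" "\<And>s. A (\<sigma> s) \<subseteq> conjugate (z s) (B s)"
    by metis
  have "\<sigma> True \<noteq> \<sigma> False"
  proof
    assume eq: "\<sigma> True = \<sigma> False"
    have "B True \<subseteq> conjugate (x True) (conjugate (z False) (B False))"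
      using x(2)[of True] z(2)[of False] eq conjugate_mono by simp
    then show False
      using Y.factor_in_conjugate[of True "x True \<otimes> z False" False] x z Y.factor_subset
      by (simp add: conjugate_mult)
  qed
  define u where "u = \<sigma> True"
  have \<sigma>: "\<sigma> True = u" "\<sigma> False = (\<not> u)" using \<open>\<sigma> True \<noteq> \<sigma> False\<close> by (auto simp: u_def)
  have "inv (x True) \<otimes> x False \<in> carrier P" using x by simp
  then obtain a y b where a: "a \<in> A u" and b: "b \<in> A (\<not> u)" and y: "y \<in> carrier P"
    "inv (x True) \<otimes> x False = a \<otimes> y \<otimes> b" "y = \<one> \<or> y \<in> starts (\<not> u) \<and> inv y \<in> starts u"
    using strip_both[of _ "\<not> u" u] by metis
  define g where "g = x True \<otimes> a"
  have ac: "a \<in> carrier P" and bc: "b \<in> carrier P" using a b factor_closed(1) by blast+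
  have gc: "g \<in> carrier P" using x ac by (simp add: g_def)
  have BT: "B True = conjugate g (A u)"
    using x[of True] \<sigma> a ac factor_subset conjugate_self[OF subgroup_factor a]
    by (simp add: g_def conjugate_mult[symmetric])
  have "x False = g \<otimes> y \<otimes> b"
  proof -
    have "x False = x True \<otimes> (inv (x True) \<otimes> x False)" using x by (simp add: cancel_left)
    then show ?thesis using y ac bc x by (simp add: g_def m_assoc)
  qed
  then have BF: "B False = conjugate g (conjugate y (A (\<not> u)))"
    using x(2)[of False] \<sigma> b bc gc y factor_subset conjugate_self[OF subgroup_factor b]
    by (simp add: conjugate_mult[symmetric])
  define B' where "B' s = conjugate (inv g) (B s)" for s
  have Y': "amalgam_decomposition P B' (conjugate (inv g) K)"
    unfolding B'_def conjugate_def
    using gc by (intro amalgam_decomposition_image[OF Y is_group] conjugation_iso) simp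
  have B': "B' True = A u" "B' False = conjugate y (A (\<not> u))"
    using gc y factor_subset conjugate_closed[OF y(1) factor_subset]
    by (simp_all add: B'_def BT BF conjugate_mult conjugate_one cancel_left)
  have "card (conjugate (inv g) K) = card H"
  proof -
    have "inj_on (\<lambda>k. inv g \<otimes> k \<otimes> inv (inv g)) (carrier P)"
      using conjugation_iso[of "inv g"] gc by (auto simp: iso_def bij_betw_def)
    then show ?thesis
      unfolding conjugate_def using card
      by (subst card_image) (auto intro: inj_on_subset dest: Y.edge_closed(2))
  qed
  then have "y = \<one>" using no_long_conjugator[OF Y' _ B'] y by blast
  then have "B s = conjugate g (A (s = u))" if True for s
    using BT BF conjugate_one[OF factor_subset] by (cases s; cases u) auto
  then show ?thesis using that gc by blast
qed

end


section \<open>The normal form theorem\<close>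

text \<open>
  Both groups live on the same type, indexed by \<^typ>\<open>bool\<close>, so that van der Waerden's action has to be
  constructed only once and not separately for the two sides.
\<close>

locale glued_groups = H: group H
  for H :: "('h, 'k) monoid_scheme" +
  fixes L :: "bool \<Rightarrow> 'l monoid" and e :: "bool \<Rightarrow> 'h \<Rightarrow> 'l"
  assumes group_L: "group (L s)" and e_hom: "e s \<in> hom H (L s)" and e_inj: "inj_on (e s) (carrier H)"
begin

lemma group_hom_e: "group_hom H (L s) (e s)"
  using group_L e_hom by (simp add: group_hom_def group_hom_axioms_def)

lemma L_closed [simp]:
  "a \<in> carrier (L s) \<Longrightarrow> b \<in> carrier (L s) \<Longrightarrow> a \<otimes>\<^bsub>L s\<^esub> b \<in> carrier (L s)"
  "\<one>\<^bsub>L s\<^esub> \<in> carrier (L s)"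
  "h \<in> carrier H \<Longrightarrow> e s h \<in> carrier (L s)"
  using group_L[of s] e_hom[of s] by (auto simp: group.is_monoid monoid.m_closed monoid.one_closed hom_def)

lemma L_assoc:
  "a \<in> carrier (L s) \<Longrightarrow> b \<in> carrier (L s) \<Longrightarrow> c \<in> carrier (L s) \<Longrightarrow>
    a \<otimes>\<^bsub>L s\<^esub> b \<otimes>\<^bsub>L s\<^esub> c = a \<otimes>\<^bsub>L s\<^esub> (b \<otimes>\<^bsub>L s\<^esub> c)"
  using group_L[of s] by (simp add: group.is_monoid monoid.m_assoc)

lemma L_one [simp]:
  "a \<in> carrier (L s) \<Longrightarrow> \<one>\<^bsub>L s\<^esub> \<otimes>\<^bsub>L s\<^esub> a = a"
  "a \<in> carrier (L s) \<Longrightarrow> a \<otimes>\<^bsub>L s\<^esub> \<one>\<^bsub>L s\<^esub> = a"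
  using group_L[of s] by (simp_all add: group.is_monoid monoid.l_one monoid.r_one)

lemma e_mult: "h \<in> carrier H \<Longrightarrow> k \<in> carrier H \<Longrightarrow> e s (h \<otimes>\<^bsub>H\<^esub> k) = e s h \<otimes>\<^bsub>L s\<^esub> e s k"
  using e_hom[of s] by (simp add: hom_def)

lemma e_one: "e s \<one>\<^bsub>H\<^esub> = \<one>\<^bsub>L s\<^esub>"
  using group_hom.hom_one[OF group_hom_e] .

lemma e_inv: "h \<in> carrier H \<Longrightarrow> e s h \<otimes>\<^bsub>L s\<^esub> e s (inv\<^bsub>H\<^esub> h) = \<one>\<^bsub>L s\<^esub>"
  by (simp add: e_mult[symmetric] e_one)

definition coset :: "bool \<Rightarrow> 'l \<Rightarrow> 'l set"
  where "coset s a = (\<lambda>h. a \<otimes>\<^bsub>L s\<^esub> e s h) ` carrier H"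

text \<open>
  Representatives for the left cosets of the image of \<open>H\<close>.  The trivial coset is represented by \<open>\<one>\<close>, so
  that a representative is a proper letter exactly if it lies outside that image.
\<close>

definition rep :: "bool \<Rightarrow> 'l \<Rightarrow> 'l"
  where "rep s a = (if a \<in> e s ` carrier H then \<one>\<^bsub>L s\<^esub> else (SOME b. b \<in> coset s a))"

definition rest :: "bool \<Rightarrow> 'l \<Rightarrow> 'h"
  where "rest s a = (SOME h. h \<in> carrier H \<and> a = rep s a \<otimes>\<^bsub>L s\<^esub> e s h)"

lemma L_cancel:
  assumes "a \<in> carrier (L s)" "h \<in> carrier H"
  shows "a \<otimes>\<^bsub>L s\<^esub> e s h \<otimes>\<^bsub>L s\<^esub> e s (inv\<^bsub>H\<^esub> h) = a"
  using assms by (simp add: L_assoc e_inv)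

lemma mult_edge_iff:
  assumes "a \<in> carrier (L s)" "h \<in> carrier H"
  shows "a \<otimes>\<^bsub>L s\<^esub> e s h \<in> e s ` carrier H \<longleftrightarrow> a \<in> e s ` carrier H"
proof
  assume "a \<otimes>\<^bsub>L s\<^esub> e s h \<in> e s ` carrier H"
  then obtain k where k: "k \<in> carrier H" "a \<otimes>\<^bsub>L s\<^esub> e s h = e s k" by auto
  then have "a = e s (k \<otimes>\<^bsub>H\<^esub> inv\<^bsub>H\<^esub> h)" using L_cancel[OF assms] assms by (simp add: e_mult)
  then show "a \<in> e s ` carrier H" using k assms by blast
next
  assume "a \<in> e s ` carrier H"
  then obtain k where "k \<in> carrier H" "a = e s k" by auto
  then have "a \<otimes>\<^bsub>L s\<^esub> e s h = e s (k \<otimes>\<^bsub>H\<^esub> h)" using assms by (simp add: e_mult)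
  then show "a \<otimes>\<^bsub>L s\<^esub> e s h \<in> e s ` carrier H" using \<open>k \<in> carrier H\<close> assms by blast
qed

lemma coset_eq:
  assumes "a \<in> carrier (L s)" "h \<in> carrier H"
  shows "coset s (a \<otimes>\<^bsub>L s\<^esub> e s h) = coset s a"
proof
  show "coset s (a \<otimes>\<^bsub>L s\<^esub> e s h) \<subseteq> coset s a"
  proof
    fix x assume "x \<in> coset s (a \<otimes>\<^bsub>L s\<^esub> e s h)"
    then obtain k where "k \<in> carrier H" "x = a \<otimes>\<^bsub>L s\<^esub> e s h \<otimes>\<^bsub>L s\<^esub> e s k" by (auto simp: coset_def)
    then have "x = a \<otimes>\<^bsub>L s\<^esub> e s (h \<otimes>\<^bsub>H\<^esub> k)" "h \<otimes>\<^bsub>H\<^esub> k \<in> carrier H"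
      using assms by (simp_all add: L_assoc e_mult)
    then show "x \<in> coset s a" unfolding coset_def by blast
  qed
  show "coset s a \<subseteq> coset s (a \<otimes>\<^bsub>L s\<^esub> e s h)"
  proof
    fix x assume "x \<in> coset s a"
    then obtain k where k: "k \<in> carrier H" "x = a \<otimes>\<^bsub>L s\<^esub> e s k" by (auto simp: coset_def)
    have "a \<otimes>\<^bsub>L s\<^esub> e s h \<otimes>\<^bsub>L s\<^esub> e s (inv\<^bsub>H\<^esub> h \<otimes>\<^bsub>H\<^esub> k) = a \<otimes>\<^bsub>L s\<^esub> e s (h \<otimes>\<^bsub>H\<^esub> (inv\<^bsub>H\<^esub> h \<otimes>\<^bsub>H\<^esub> k))"
      using assms k by (simp add: L_assoc e_mult)
    also have "h \<otimes>\<^bsub>H\<^esub> (inv\<^bsub>H\<^esub> h \<otimes>\<^bsub>H\<^esub> k) = k" using assms k by (simp add: H.m_assoc[symmetric])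
    finally show "x \<in> coset s (a \<otimes>\<^bsub>L s\<^esub> e s h)"
      using k assms unfolding coset_def by (metis H.inv_closed H.m_closed imageI)
  qed
qed

lemma rep_mult_edge:
  "a \<in> carrier (L s) \<Longrightarrow> h \<in> carrier H \<Longrightarrow> rep s (a \<otimes>\<^bsub>L s\<^esub> e s h) = rep s a"
  by (simp add: rep_def mult_edge_iff coset_eq)

lemma rep_edge: "h \<in> carrier H \<Longrightarrow> rep s (e s h) = \<one>\<^bsub>L s\<^esub>"
  by (simp add: rep_def)

lemma rep_rest:
  assumes a: "a \<in> carrier (L s)"
  shows "rep s a \<in> carrier (L s)" "rest s a \<in> carrier H" "a = rep s a \<otimes>\<^bsub>L s\<^esub> e s (rest s a)"
proof -
  have "rep s a \<in> carrier (L s) \<and> (\<exists>h. h \<in> carrier H \<and> a = rep s a \<otimes>\<^bsub>L s\<^esub> e s h)"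
  proof (cases "a \<in> e s ` carrier H")
    case True
    then show ?thesis by (auto simp: rep_def)
  next
    case False
    have "a \<in> coset s a" unfolding coset_def
      using a by (intro image_eqI[of _ _ "\<one>\<^bsub>H\<^esub>"]) (auto simp: e_one)
    then have "(SOME b. b \<in> coset s a) \<in> coset s a" by (rule someI)
    then have "rep s a \<in> coset s a" using False by (simp add: rep_def)
    then obtain h where h: "h \<in> carrier H" "rep s a = a \<otimes>\<^bsub>L s\<^esub> e s h" by (auto simp: coset_def)
    then have "a = rep s a \<otimes>\<^bsub>L s\<^esub> e s (inv\<^bsub>H\<^esub> h)" using a by (simp add: L_cancel)
    then show ?thesis using h a by auto
  qed
  then show "rep s a \<in> carrier (L s)" "rest s a \<in> carrier H" "a = rep s a \<otimes>\<^bsub>L s\<^esub> e s (rest s a)"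
    using someI_ex[of "\<lambda>h. h \<in> carrier H \<and> a = rep s a \<otimes>\<^bsub>L s\<^esub> e s h"] by (auto simp: rest_def)
qed

lemma rep_eq_one_iff:
  assumes "a \<in> carrier (L s)" shows "rep s a = \<one>\<^bsub>L s\<^esub> \<longleftrightarrow> a \<in> e s ` carrier H"
proof
  assume "rep s a = \<one>\<^bsub>L s\<^esub>"
  then show "a \<in> e s ` carrier H" using rep_rest[OF assms] by auto
qed (auto simp: rep_edge)

lemma rest_unique:
  assumes a: "a \<in> carrier (L s)" and h: "h \<in> carrier H" and eq: "a = rep s a \<otimes>\<^bsub>L s\<^esub> e s h"
  shows "rest s a = h"
proof -
  have "rep s a \<otimes>\<^bsub>L s\<^esub> e s (rest s a) = rep s a \<otimes>\<^bsub>L s\<^esub> e s h" using rep_rest[OF a] eq by simp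
  moreover have "rep s a \<in> Units (L s)" using group.Units_eq[OF group_L] rep_rest(1)[OF a] by blast
  ultimately have "e s (rest s a) = e s h"
    using monoid.Units_l_cancel[OF group.is_monoid[OF group_L], of "rep s a" s "e s (rest s a)" "e s h"]
      L_closed(3)[OF rep_rest(2)[OF a]] L_closed(3)[OF h] by blast
  then show ?thesis using inj_onD[OF e_inj] rep_rest[OF a] h by blast
qed

lemma rest_mult_edge:
  assumes "a \<in> carrier (L s)" "h \<in> carrier H"
  shows "rest s (a \<otimes>\<^bsub>L s\<^esub> e s h) = rest s a \<otimes>\<^bsub>H\<^esub> h"
proof (rule rest_unique)
  show "a \<otimes>\<^bsub>L s\<^esub> e s h = rep s (a \<otimes>\<^bsub>L s\<^esub> e s h) \<otimes>\<^bsub>L s\<^esub> e s (rest s a \<otimes>\<^bsub>H\<^esub> h)"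
    using assms rep_rest[OF assms(1)] by (simp add: rep_mult_edge e_mult L_assoc[symmetric])
qed (use assms rep_rest[OF assms(1)] in simp_all)

lemma rest_edge: "h \<in> carrier H \<Longrightarrow> rest s (e s h) = h"
  by (intro rest_unique) (simp_all add: rep_edge)

lemma rest_rep: "a \<in> carrier (L s) \<Longrightarrow> rep s a = a \<Longrightarrow> rest s a = \<one>\<^bsub>H\<^esub>"
  by (intro rest_unique) (simp_all add: e_one)

lemma rep_rep: "a \<in> carrier (L s) \<Longrightarrow> rep s (rep s a) = rep s a"
  using rep_mult_edge[of "rep s a" s "rest s a"] rep_rest[of a s] by simp

lemma mult_edge_left_iff:
  assumes a: "a \<in> carrier (L s)" and h: "h \<in> carrier H"
  shows "e s h \<otimes>\<^bsub>L s\<^esub> a \<in> e s ` carrier H \<longleftrightarrow> a \<in> e s ` carrier H"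
proof
  assume "e s h \<otimes>\<^bsub>L s\<^esub> a \<in> e s ` carrier H"
  then obtain k where k: "k \<in> carrier H" "e s h \<otimes>\<^bsub>L s\<^esub> a = e s k" by auto
  have "a = e s (inv\<^bsub>H\<^esub> h) \<otimes>\<^bsub>L s\<^esub> (e s h \<otimes>\<^bsub>L s\<^esub> a)"
    using a h by (simp add: L_assoc[symmetric] e_mult[symmetric] e_one)
  then have "a = e s (inv\<^bsub>H\<^esub> h \<otimes>\<^bsub>H\<^esub> k)" using k h by (simp add: e_mult)
  then show "a \<in> e s ` carrier H" using k h by blast
next
  assume "a \<in> e s ` carrier H"
  then obtain k where k: "k \<in> carrier H" "a = e s k" by auto
  then have "e s h \<otimes>\<^bsub>L s\<^esub> a = e s (h \<otimes>\<^bsub>H\<^esub> k)" using h by (simp add: e_mult)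
  then show "e s h \<otimes>\<^bsub>L s\<^esub> a \<in> e s ` carrier H" using k h by blast
qed

fun normal :: "(bool \<times> 'l) list \<Rightarrow> bool" where
  "normal [] = True"
| "normal ((s, t) # ws) = (t \<in> carrier (L s) \<and> rep s t = t \<and> t \<noteq> \<one>\<^bsub>L s\<^esub> \<and>
     (ws = [] \<or> fst (hd ws) \<noteq> s) \<and> normal ws)"

definition normal_forms :: "((bool \<times> 'l) list \<times> 'h) set"
  where "normal_forms = {(ws, k). normal ws \<and> k \<in> carrier H}"

definition avoids :: "bool \<Rightarrow> (bool \<times> 'l) list \<times> 'h \<Rightarrow> bool"
  where "avoids s x \<longleftrightarrow> fst x = [] \<or> fst (hd (fst x)) \<noteq> s"

text \<open>
  An element of \<open>H\<close> is pushed through the word from left to right until it reaches the last coordinate.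
\<close>

fun edge_act :: "'h \<Rightarrow> (bool \<times> 'l) list \<times> 'h \<Rightarrow> (bool \<times> 'l) list \<times> 'h" where
  "edge_act h ([], k) = ([], h \<otimes>\<^bsub>H\<^esub> k)"
| "edge_act h ((s, t) # ws, k) =
     apfst ((#) (s, rep s (e s h \<otimes>\<^bsub>L s\<^esub> t))) (edge_act (rest s (e s h \<otimes>\<^bsub>L s\<^esub> t)) (ws, k))"

text \<open>
  \<open>detach\<close> and \<open>attach\<close> identify the set of normal forms with pairs of a coset representative in
  \<open>L s\<close> and a normal form that does not begin with a letter of type \<open>s\<close>.  Under this identification \<open>act s\<close> is the action of \<open>L s\<close> induced from
  the action \<open>edge_act\<close> of \<open>H\<close> on the second component, which makes it an action.
\<close>

definition detach :: "bool \<Rightarrow> (bool \<times> 'l) list \<times> 'h \<Rightarrow> 'l \<times> (bool \<times> 'l) list \<times> 'h"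
  where "detach s x = (if avoids s x then (\<one>\<^bsub>L s\<^esub>, x) else (snd (hd (fst x)), apfst tl x))"

definition attach :: "bool \<Rightarrow> 'l \<Rightarrow> (bool \<times> 'l) list \<times> 'h \<Rightarrow> (bool \<times> 'l) list \<times> 'h"
  where "attach s t x = (if t = \<one>\<^bsub>L s\<^esub> then x else apfst ((#) (s, t)) x)"

definition act :: "bool \<Rightarrow> 'l \<Rightarrow> (bool \<times> 'l) list \<times> 'h \<Rightarrow> (bool \<times> 'l) list \<times> 'h"
  where "act s a x = (let (t, y) = detach s x; c = a \<otimes>\<^bsub>L s\<^esub> t
    in attach s (rep s c) (edge_act (rest s c) y))"

lemma edge_act_normal:
  "x \<in> normal_forms \<Longrightarrow> h \<in> carrier H \<Longrightarrow>
     edge_act h x \<in> normal_forms \<and> map fst (fst (edge_act h x)) = map fst (fst x)"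
proof (induction h x rule: edge_act.induct)
  case (1 h k)
  then show ?case by (simp add: normal_forms_def)
next
  case (2 h s t ws k)
  define c where "c = e s h \<otimes>\<^bsub>L s\<^esub> t"
  have t: "t \<in> carrier (L s)" "rep s t = t" "t \<noteq> \<one>\<^bsub>L s\<^esub>" "(ws, k) \<in> normal_forms"
    "ws = [] \<or> fst (hd ws) \<noteq> s"
    using 2 by (auto simp: normal_forms_def)
  have c: "c \<in> carrier (L s)" using t 2 by (simp add: c_def)
  obtain ws' k' where y: "edge_act (rest s c) (ws, k) = (ws', k')" by fastforce
  have IH: "(ws', k') \<in> normal_forms" "map fst ws' = map fst ws"
    using "2.IH"[folded c_def] t(4) rep_rest[OF c] y by auto
  have "rep s c \<noteq> \<one>\<^bsub>L s\<^esub>"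
    using t 2 c mult_edge_left_iff[OF t(1) "2.prems"(2)] rep_eq_one_iff by (metis c_def)
  moreover have "ws' = [] \<or> fst (hd ws') \<noteq> s"
    using IH(2) t(5) by (cases ws; cases ws') auto
  ultimately show ?case
    using IH rep_rest[OF c] rep_rep[OF c] y
    by (simp add: normal_forms_def c_def[symmetric])
qed

lemma avoids_edge_act:
  assumes "x \<in> normal_forms" "h \<in> carrier H"
  shows "avoids s (edge_act h x) \<longleftrightarrow> avoids s x"
proof -
  have "map fst (fst (edge_act h x)) = map fst (fst x)" using edge_act_normal[OF assms] by simp
  then show ?thesis unfolding avoids_def
    by (cases "fst x"; cases "fst (edge_act h x)") auto
qed

lemma edge_act_mult:
  "x \<in> normal_forms \<Longrightarrow> h \<in> carrier H \<Longrightarrow> h' \<in> carrier H \<Longrightarrow>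
     edge_act h' (edge_act h x) = edge_act (h' \<otimes>\<^bsub>H\<^esub> h) x"
proof (induction h x arbitrary: h' rule: edge_act.induct)
  case (1 h k)
  then show ?case by (simp add: normal_forms_def H.m_assoc)
next
  case (2 h s t ws k)
  define c where "c = e s h \<otimes>\<^bsub>L s\<^esub> t"
  have t: "t \<in> carrier (L s)" "(ws, k) \<in> normal_forms"
    using 2 by (auto simp: normal_forms_def)
  have c: "c \<in> carrier (L s)" using t 2 by (simp add: c_def)
  define d where "d = e s h' \<otimes>\<^bsub>L s\<^esub> rep s c"
  have d: "d \<in> carrier (L s)" using rep_rest[OF c] 2 by (simp add: d_def)
  obtain ws' k' where y: "edge_act (rest s c) (ws, k) = (ws', k')" by fastforce
  have "e s (h' \<otimes>\<^bsub>H\<^esub> h) \<otimes>\<^bsub>L s\<^esub> t = e s h' \<otimes>\<^bsub>L s\<^esub> c"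
    using 2 t by (simp add: c_def e_mult L_assoc)
  also have "\<dots> = d \<otimes>\<^bsub>L s\<^esub> e s (rest s c)"
    using 2 rep_rest[OF c] by (simp add: d_def L_assoc)
  finally have eq: "e s (h' \<otimes>\<^bsub>H\<^esub> h) \<otimes>\<^bsub>L s\<^esub> t = d \<otimes>\<^bsub>L s\<^esub> e s (rest s c)" .
  have "edge_act (rest s d) (ws', k') = edge_act (rest s d \<otimes>\<^bsub>H\<^esub> rest s c) (ws, k)"
    using "2.IH"[folded c_def, of "rest s d"] t rep_rest[OF c] rep_rest[OF d] y by simp
  then show ?case
    using eq rep_rest[OF c] d y
    by (simp add: c_def[symmetric] d_def[symmetric] rep_mult_edge rest_mult_edge)
qed

lemma edge_act_one: "x \<in> normal_forms \<Longrightarrow> edge_act \<one>\<^bsub>H\<^esub> x = x"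
proof (induction "\<one>\<^bsub>H\<^esub>" x rule: edge_act.induct)
  case (1 k)
  then show ?case by (simp add: normal_forms_def)
next
  case (2 s t ws k)
  then show ?case by (auto simp: normal_forms_def e_one rest_rep)
qed

lemma detach_normal:
  assumes "x \<in> normal_forms" "detach s x = (t, y)"
  shows "t \<in> carrier (L s)" "rep s t = t" "y \<in> normal_forms" "avoids s y" "attach s t y = x"
proof -
  have "t \<in> carrier (L s) \<and> rep s t = t \<and> y \<in> normal_forms \<and> avoids s y \<and> attach s t y = x"
  proof (cases "avoids s x")
    case True
    then show ?thesis
      using assms rep_edge[of "\<one>\<^bsub>H\<^esub>" s] by (auto simp: detach_def attach_def e_one)
  next
    case False
    then obtain t' ws k where "x = ((s, t') # ws, k)"
      by (cases x; cases "fst x") (auto simp: avoids_def)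
    then show ?thesis using assms False by (auto simp: detach_def attach_def normal_forms_def avoids_def)
  qed
  then show "t \<in> carrier (L s)" "rep s t = t" "y \<in> normal_forms" "avoids s y" "attach s t y = x"
    by auto
qed

lemma detach_attach: "avoids s y \<Longrightarrow> detach s (attach s t y) = (t, y)"
  by (cases y) (auto simp: detach_def attach_def avoids_def)

lemma attach_normal:
  "t \<in> carrier (L s) \<Longrightarrow> rep s t = t \<Longrightarrow> y \<in> normal_forms \<Longrightarrow> avoids s y \<Longrightarrow> attach s t y \<in> normal_forms"
  by (cases y) (auto simp: attach_def normal_forms_def avoids_def)

lemma act_eq:
  assumes "x \<in> normal_forms" "detach s x = (t, y)" "a \<in> carrier (L s)"
  shows "act s a x = attach s (rep s (a \<otimes>\<^bsub>L s\<^esub> t)) (edge_act (rest s (a \<otimes>\<^bsub>L s\<^esub> t)) y)"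
    and "act s a x \<in> normal_forms"
    and "detach s (act s a x) = (rep s (a \<otimes>\<^bsub>L s\<^esub> t), edge_act (rest s (a \<otimes>\<^bsub>L s\<^esub> t)) y)"
proof -
  note t = detach_normal[OF assms(1,2)]
  show eq: "act s a x = attach s (rep s (a \<otimes>\<^bsub>L s\<^esub> t)) (edge_act (rest s (a \<otimes>\<^bsub>L s\<^esub> t)) y)"
    by (simp add: act_def assms Let_def)
  have c: "a \<otimes>\<^bsub>L s\<^esub> t \<in> carrier (L s)" using t assms by simp
  note c' = rep_rest[OF c]
  have av: "avoids s (edge_act (rest s (a \<otimes>\<^bsub>L s\<^esub> t)) y)" using t c' avoids_edge_act by simp
  show "act s a x \<in> normal_forms"
    unfolding eq using t c' av edge_act_normal rep_rep[OF c] by (intro attach_normal) auto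
  show "detach s (act s a x) = (rep s (a \<otimes>\<^bsub>L s\<^esub> t), edge_act (rest s (a \<otimes>\<^bsub>L s\<^esub> t)) y)"
    unfolding eq by (rule detach_attach[OF av])
qed

lemma act_normal: "x \<in> normal_forms \<Longrightarrow> a \<in> carrier (L s) \<Longrightarrow> act s a x \<in> normal_forms"
  using act_eq(2) by (cases "detach s x") blast

lemma act_mult:
  assumes x: "x \<in> normal_forms" and a: "a \<in> carrier (L s)" and b: "b \<in> carrier (L s)"
  shows "act s a (act s b x) = act s (a \<otimes>\<^bsub>L s\<^esub> b) x"
proof -
  obtain t y where ty: "detach s x = (t, y)" by (metis surj_pair)
  note t = detach_normal[OF x ty]
  define c where "c = b \<otimes>\<^bsub>L s\<^esub> t"
  have c: "c \<in> carrier (L s)" using t b by (simp add: c_def)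
  define d where "d = a \<otimes>\<^bsub>L s\<^esub> rep s c"
  have d: "d \<in> carrier (L s)" using rep_rest[OF c] a by (simp add: d_def)
  have "a \<otimes>\<^bsub>L s\<^esub> b \<otimes>\<^bsub>L s\<^esub> t = a \<otimes>\<^bsub>L s\<^esub> c" using a b t by (simp add: c_def L_assoc)
  also have "\<dots> = d \<otimes>\<^bsub>L s\<^esub> e s (rest s c)" using a rep_rest[OF c] by (simp add: d_def L_assoc)
  finally have eq: "a \<otimes>\<^bsub>L s\<^esub> b \<otimes>\<^bsub>L s\<^esub> t = d \<otimes>\<^bsub>L s\<^esub> e s (rest s c)" .
  have "act s a (act s b x) = attach s (rep s d) (edge_act (rest s d) (edge_act (rest s c) y))"
    using act_eq(1)[OF act_eq(2,3)[OF x ty b] a] by (simp add: c_def d_def)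
  also have "\<dots> = attach s (rep s d) (edge_act (rest s d \<otimes>\<^bsub>H\<^esub> rest s c) y)"
    using edge_act_mult[OF t(3)] rep_rest[OF c] rep_rest[OF d] by simp
  also have "\<dots> = act s (a \<otimes>\<^bsub>L s\<^esub> b) x"
    using act_eq(1)[OF x ty, of "a \<otimes>\<^bsub>L s\<^esub> b"] a b eq rep_rest[OF c] d
    by (simp add: rep_mult_edge rest_mult_edge)
  finally show ?thesis .
qed

lemma act_one: "x \<in> normal_forms \<Longrightarrow> act s \<one>\<^bsub>L s\<^esub> x = x"
proof -
  assume x: "x \<in> normal_forms"
  obtain t y where ty: "detach s x = (t, y)" by (metis surj_pair)
  note t = detach_normal[OF x ty]
  show ?thesis using act_eq(1)[OF x ty, of "\<one>\<^bsub>L s\<^esub>"] t by (simp add: rest_rep edge_act_one)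
qed

text \<open>
  The actions of the two groups agree on \<open>H\<close>, as both are \<open>edge_act\<close> there.  Hence they fit together to an
  action of the amalgam.
\<close>

lemma act_edge:
  assumes x: "x \<in> normal_forms" and h: "h \<in> carrier H"
  shows "act s (e s h) x = edge_act h x"
proof (cases "avoids s x")
  case True
  then have "detach s x = (\<one>\<^bsub>L s\<^esub>, x)" by (simp add: detach_def)
  then show ?thesis using act_eq(1)[OF x, of s "\<one>\<^bsub>L s\<^esub>" x "e s h"] h
    by (simp add: rep_edge rest_edge attach_def)
next
  case False
  then obtain t ws k where xw: "x = ((s, t) # ws, k)"
    by (cases x; cases "fst x") (auto simp: avoids_def)
  then have sp: "detach s x = (t, (ws, k))" using False by (simp add: detach_def)
  note t = detach_normal[OF x sp]
  have "t \<noteq> \<one>\<^bsub>L s\<^esub>" using x xw by (simp add: normal_forms_def)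
  then have "rep s (e s h \<otimes>\<^bsub>L s\<^esub> t) \<noteq> \<one>\<^bsub>L s\<^esub>"
    using t(1,2) h mult_edge_left_iff[OF t(1) h] rep_eq_one_iff[OF t(1)] rep_eq_one_iff[of "e s h \<otimes>\<^bsub>L s\<^esub> t" s]
    by simp
  then show ?thesis using act_eq(1)[OF x sp, of "e s h"] h xw by (simp add: attach_def)
qed

end


locale injective_amalgam = amalgam_setting A B H f g
  for A :: "('a, 'm) monoid_scheme" and B :: "('b, 'n) monoid_scheme"
    and H :: "('h, 'k) monoid_scheme" and f :: "'h \<Rightarrow> 'a" and g :: "'h \<Rightarrow> 'b" +
  assumes f_inj: "inj_on f (carrier H)" and g_inj: "inj_on g (carrier H)"
begin

definition L :: "bool \<Rightarrow> ('a + 'b) monoid" where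
  "L s = (if s
     then \<lparr>carrier = Inl ` carrier A, mult = (\<lambda>x y. Inl (projl x \<otimes>\<^bsub>A\<^esub> projl y)), one = Inl \<one>\<^bsub>A\<^esub>\<rparr>
     else \<lparr>carrier = Inr ` carrier B, mult = (\<lambda>x y. Inr (projr x \<otimes>\<^bsub>B\<^esub> projr y)), one = Inr \<one>\<^bsub>B\<^esub>\<rparr>)"

definition e :: "bool \<Rightarrow> 'h \<Rightarrow> 'a + 'b"
  where "e s h = (if s then Inl (f h) else Inr (g h))"

lemma L_simps [simp]:
  "carrier (L True) = Inl ` carrier A" "carrier (L False) = Inr ` carrier B"
  "Inl a \<otimes>\<^bsub>L True\<^esub> Inl a' = Inl (a \<otimes>\<^bsub>A\<^esub> a')" "Inr b \<otimes>\<^bsub>L False\<^esub> Inr b' = Inr (b \<otimes>\<^bsub>B\<^esub> b')"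
  "\<one>\<^bsub>L True\<^esub> = Inl \<one>\<^bsub>A\<^esub>" "\<one>\<^bsub>L False\<^esub> = Inr \<one>\<^bsub>B\<^esub>"
  by (simp_all add: L_def)

sublocale glued_groups H L e
proof (intro glued_groups.intro glued_groups_axioms.intro)
  show "group H" by (rule H.is_group)
  fix s
  show "group (L s)"
  proof (cases s)
    case True
    have "group (L True)"
      by (rule groupI) (auto simp: A.m_assoc intro!: bexI[of _ "m_inv A _"])
    then show ?thesis using True by simp
  next
    case False
    have "group (L False)"
      by (rule groupI) (auto simp: B.m_assoc intro!: bexI[of _ "m_inv B _"])
    then show ?thesis using False by simp
  qed
  show "e s \<in> hom H (L s)"
    using f_hom g_hom by (cases s) (auto simp: e_def hom_def Pi_iff)
  show "inj_on (e s) (carrier H)"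
    using f_inj g_inj by (cases s) (auto simp: e_def inj_on_def)
qed

lemma e_simps: "e True h = Inl (f h)" "e False h = Inr (g h)"
  by (simp_all add: e_def)

abbreviation base :: "(bool \<times> ('a + 'b)) list \<times> 'h" where "base \<equiv> ([], \<one>\<^bsub>H\<^esub>)"

definition eval_word where "eval_word w x = foldr (\<lambda>l. act (isl l) l) w x"

lemma eval_word_simps [simp]:
  "eval_word [] x = x" "eval_word (l # w) x = act (isl l) l (eval_word w x)"
  "eval_word (u @ v) x = eval_word u (eval_word v x)"
  by (simp_all add: eval_word_def)

lemma letter_iff: "l \<in> carrier (L s) \<longleftrightarrow> l \<in> carrier A <+> carrier B \<and> isl l = s"
  by (cases s) auto

lemma eval_word_normal: "w \<in> W \<Longrightarrow> x \<in> normal_forms \<Longrightarrow> eval_word w x \<in> normal_forms"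
  by (induction w) (auto intro!: act_normal simp: letter_iff)

text \<open>
  The action factors through the amalgam: it respects each of the defining relations.
\<close>

lemma eval_word_eqv: "u \<approx> v \<Longrightarrow> x \<in> normal_forms \<Longrightarrow> eval_word u x = eval_word v x"
proof (induction arbitrary: x rule: amalg_eq.induct)
  case (sym u v)
  show ?case using sym.IH[OF sym.prems] by (rule HOL.sym)
next
  case (trans u v w)
  show ?case using trans.IH(1)[OF trans.prems] trans.IH(2)[OF trans.prems] by (rule HOL.trans)
next
  case (append u v u' v')
  have "eval_word v' x \<in> normal_forms"
    by (rule eval_word_normal[OF conjunct2[OF eqv_words[OF append.hyps(2)]] append.prems])
  then have "eval_word u (eval_word v' x) = eval_word v (eval_word v' x)" by (rule append.IH(1))
  then show ?case using append.IH(2)[OF append.prems] by simp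
next
  case one_left
  then show ?case using act_one[of x True] by simp
next
  case one_right
  then show ?case using act_one[of x False] by simp
next
  case (mult_left a a')
  then show ?case using act_mult[of x "Inl a" True "Inl a'"] by simp
next
  case (mult_right a a')
  then show ?case using act_mult[of x "Inr a" False "Inr a'"] by simp
next
  case (glue h)
  then show ?case using act_edge[of x h True] act_edge[of x h False] by (simp add: e_simps)
qed simp_all

lemma base_normal: "base \<in> normal_forms"
  by (simp add: normal_forms_def)

lemma act_base:
  assumes "l \<in> carrier (L s)"
  shows "act s l base = attach s (rep s l) ([], rest s l)"
proof -
  have "detach s base = (\<one>\<^bsub>L s\<^esub>, base)" by (simp add: detach_def avoids_def)
  then show ?thesis using act_eq(1)[OF base_normal _ assms] assms rep_rest(2)[OF assms] by simp
qed

definition factor :: "bool \<Rightarrow> ('a + 'b) list set set"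
  where "factor s = (\<lambda>l. cls [l]) ` carrier (L s)"

definition edge_group :: "('a + 'b) list set set"
  where "edge_group = (\<lambda>h. cls [e True h]) ` carrier H"

lemma word_letter: "l \<in> carrier (L s) \<Longrightarrow> [l] \<in> W"
  by (simp add: letter_iff)

lemma glue_edge: "h \<in> carrier H \<Longrightarrow> cls [e s h] = cls [e True h]"
  using amalgam_glue by (cases s) (simp_all add: e_simps)

lemma cls_letter_inj:
  assumes l: "l \<in> carrier (L s)" and l': "l' \<in> carrier (L s')" and eq: "cls [l] = cls [l']"
  shows "attach s (rep s l) ([], rest s l) = attach s' (rep s' l') ([], rest s' l')"
proof -
  have "[l] \<approx> [l']" using eq cls_eq_iff word_letter[OF l'] by blast
  then have "act s l base = act s' l' base"
    using eval_word_eqv[OF _ base_normal] l l' by (fastforce simp: letter_iff)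
  then show ?thesis using act_base l l' by simp
qed

lemma letter_eq: "l \<in> carrier (L s) \<Longrightarrow> l' \<in> carrier (L s) \<Longrightarrow> cls [l] = cls [l'] \<Longrightarrow> l = l'"
  using cls_letter_inj[of l s l' s] rep_rest(3)[of l s] rep_rest(3)[of l' s]
  by (auto simp: attach_def split: if_splits)

lemma in_edge_group_iff:
  assumes l: "l \<in> carrier (L s)"
  shows "cls [l] \<in> edge_group \<longleftrightarrow> l \<in> e s ` carrier H"
proof
  assume "cls [l] \<in> edge_group"
  then obtain h where h: "h \<in> carrier H" "cls [l] = cls [e s h]"
    using glue_edge[of _ s] by (auto simp: edge_group_def)
  then have "l = e s h" using letter_eq[OF l L_closed(3)] by blast
  then show "l \<in> e s ` carrier H" using h by blast
next
  assume "l \<in> e s ` carrier H"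
  then show "cls [l] \<in> edge_group" using glue_edge unfolding edge_group_def by blast
qed

lemma not_avoids_attach: "t \<noteq> \<one>\<^bsub>L s\<^esub> \<Longrightarrow> \<not> avoids s (attach s t x)"
  by (cases x) (simp add: attach_def avoids_def)

text \<open>
  Each letter of an alternating product puts a proper representative in front of the normal form,
  whereas elements of \<open>H\<close> change only the last coordinate of the trivial normal form.
\<close>

lemma alternating_moves_base:
  "alternating (amalgam A B H f g) factor edge_group s n t p \<Longrightarrow>
     \<exists>w \<in> W. p = cls w \<and> \<not> avoids s (eval_word w base)"
proof (induction rule: alternating.induct)
  case (single a s)
  then obtain l where l: "l \<in> carrier (L s)" "a = cls [l]" by (auto simp: factor_def)
  then have "rep s l \<noteq> \<one>\<^bsub>L s\<^esub>" using single in_edge_group_iff rep_eq_one_iff by simp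
  then have "\<not> avoids s (eval_word [l] base)"
    using l act_base[OF l(1)] not_avoids_attach by (simp add: letter_iff)
  then show ?case using l word_letter by blast
next
  case (prepend a s n t p)
  then obtain l where l: "l \<in> carrier (L s)" "a = cls [l]" by (auto simp: factor_def)
  obtain w where w: "w \<in> W" "p = cls w" "\<not> avoids (\<not> s) (eval_word w base)"
    using prepend.IH by blast
  have nf: "eval_word w base \<in> normal_forms" using eval_word_normal w base_normal by blast
  have "avoids s (eval_word w base)" using w(3) by (auto simp: avoids_def)
  then have "detach s (eval_word w base) = (\<one>\<^bsub>L s\<^esub>, eval_word w base)" by (simp add: detach_def)
  from act_eq(1)[OF nf this l(1)]
  have "act s l (eval_word w base) = attach s (rep s l) (edge_act (rest s l) (eval_word w base))"
    using l by simp
  moreover have "rep s l \<noteq> \<one>\<^bsub>L s\<^esub>" using l prepend in_edge_group_iff rep_eq_one_iff by simp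
  ultimately have "\<not> avoids s (eval_word (l # w) base)"
    using not_avoids_attach l by (simp add: letter_iff)
  moreover have "a \<otimes>\<^bsub>amalgam A B H f g\<^esub> p = cls (l # w)" "l # w \<in> W"
    using mult_cls[OF word_letter[OF l(1)] w(1)] l w by (simp_all add: letter_iff)
  ultimately show ?case by blast
qed

theorem amalgam_decomposition_amalgam:
  assumes fin: "finite (carrier H)" and f: "f ` carrier H \<noteq> carrier A" and g: "g ` carrier H \<noteq> carrier B"
  shows "amalgam_decomposition (amalgam A B H f g) factor edge_group"
proof (intro amalgam_decomposition.intro amalgam_decomposition_axioms.intro)
  let ?P = "amalgam A B H f g"
  show P: "group ?P" by (rule group_amalgam)
  interpret P: group ?P by (rule P)
  have factor_eq: "factor True = (\<lambda>a. cls [Inl a]) ` carrier A" "factor False = (\<lambda>b. cls [Inr b]) ` carrier B"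
    by (simp_all add: factor_def image_image)
  show sub: "subgroup (factor s) ?P" for s
  proof -
    interpret a: group_hom A ?P "\<lambda>a. cls [Inl a]"
      using amalgam_inl_hom by unfold_locales
    interpret b: group_hom B ?P "\<lambda>b. cls [Inr b]"
      using amalgam_inr_hom by unfold_locales
    show ?thesis
      using factor_eq a.img_is_subgroup b.img_is_subgroup by (cases s) simp_all
  qed
  have edge_le: "edge_group \<subseteq> factor s" for s
  proof
    fix p assume "p \<in> edge_group"
    then obtain h where "h \<in> carrier H" "p = cls [e s h]"
      using glue_edge[of _ s] by (auto simp: edge_group_def)
    then show "p \<in> factor s" using L_closed(3) unfolding factor_def by blast
  qed
  show "factor s \<inter> factor (\<not> s) = edge_group" for s
  proof
    show "factor s \<inter> factor (\<not> s) \<subseteq> edge_group"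
    proof
      fix p assume "p \<in> factor s \<inter> factor (\<not> s)"
      then obtain l l' where l: "l \<in> carrier (L s)" "p = cls [l]"
        and l': "l' \<in> carrier (L (\<not> s))" "p = cls [l']"
        unfolding factor_def by blast
      have "rep s l = \<one>\<^bsub>L s\<^esub>"
        using cls_letter_inj[OF l(1) l'(1)] l l' by (auto simp: attach_def split: if_splits)
      then show "p \<in> edge_group" using l in_edge_group_iff rep_eq_one_iff by simp
    qed
  qed (use edge_le in auto)
  show "finite edge_group" using fin by (simp add: edge_group_def)
  show "factor s \<noteq> edge_group" for s
  proof
    assume eq: "factor s = edge_group"
    have "l \<in> e s ` carrier H" if "l \<in> carrier (L s)" for l
      using that eq in_edge_group_iff[OF that] by (auto simp: factor_def)
    then have "carrier (L s) = e s ` carrier H" by auto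
    moreover have "carrier (L True) = Inl ` carrier A" "e True ` carrier H = Inl ` f ` carrier H"
      "carrier (L False) = Inr ` carrier B" "e False ` carrier H = Inr ` g ` carrier H"
      by (auto simp: e_simps)
    ultimately show False using f g by (cases s) (simp_all add: inj_image_eq_iff)
  qed
  show "generate ?P (factor True \<union> factor False) = carrier ?P"
  proof
    have F: "factor s \<subseteq> carrier ?P" for s using subgroup.subset[OF sub] .
    then show "generate ?P (factor True \<union> factor False) \<subseteq> carrier ?P"
      using P.generate_incl[of "factor True \<union> factor False"] by blast
    have "cls w \<in> generate ?P (factor True \<union> factor False)" if "w \<in> W" for w
      using that
    proof (induction w)
      case Nil
      then show ?case using generate.one[of ?P] by (simp add: amalgam_def)
    next
      case (Cons l w)
      then have l: "l \<in> carrier (L (isl l))" and w: "w \<in> W" by (auto simp: letter_iff)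
      have "cls [l] \<in> factor True \<union> factor False"
        using l unfolding factor_def by (cases "isl l") auto
      then have "cls [l] \<otimes>\<^bsub>?P\<^esub> cls w \<in> generate ?P (factor True \<union> factor False)"
        by (intro generate.eng generate.incl Cons.IH)
      then show ?case using mult_cls[OF word_letter[OF l] w] by simp
    qed
    then show "carrier ?P \<subseteq> generate ?P (factor True \<union> factor False)" by (auto simp: amalgam_def)
  qed
  fix s n t p
  assume "alternating ?P factor edge_group s n t p"
  from alternating_moves_base[OF this]
  obtain w where w: "w \<in> W" "p = cls w" "\<not> avoids s (eval_word w base)" by blast
  show "p \<notin> edge_group"
  proof
    assume "p \<in> edge_group"
    then obtain h where h: "h \<in> carrier H" "cls w = cls [e True h]"
      using w by (auto simp: edge_group_def)
    then have "w \<approx> [e True h]" using cls_eq_iff word_letter[OF L_closed(3)] by blast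
    then have "eval_word w base = eval_word [e True h] base"
      using eval_word_eqv base_normal by blast
    also have "\<dots> = ([], h)"
      using act_edge[OF base_normal h(1), of True] h by (simp add: e_simps)
    finally show False using w(3) by (simp add: avoids_def)
  qed
qed

end


section \<open>Isomorphisms of amalgams\<close>

lemma autoD:
  assumes "\<alpha> \<in> auto G"
  shows "\<alpha> \<in> hom G G" "inj_on \<alpha> (carrier G)" "\<alpha> ` carrier G = carrier G"
    "x \<in> carrier G \<Longrightarrow> \<alpha> x \<in> carrier G"
  using assms by (auto simp: auto_def Bij_def bij_betw_def hom_def)

lemma (in group) auto_inverse:
  assumes \<alpha>: "\<alpha> \<in> auto G"
  obtains \<beta> where "\<beta> \<in> auto G" "\<And>x. x \<in> carrier G \<Longrightarrow> \<beta> (\<alpha> x) = x" "\<And>x. x \<in> carrier G \<Longrightarrow> \<alpha> (\<beta> x) = x"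
    "\<And>X. X \<subseteq> carrier G \<Longrightarrow> \<alpha> ` X = X \<Longrightarrow> \<beta> ` X = X"
proof
  let ?\<beta> = "restrict (inv_into (carrier G) \<alpha>) (carrier G)"
  show "?\<beta> \<in> auto G"
    using \<alpha> restrict_inv_into_hom[of \<alpha>] restrict_inv_into_Bij[of \<alpha> "carrier G"]
    unfolding auto_def by blast
  show left: "\<And>x. x \<in> carrier G \<Longrightarrow> ?\<beta> (\<alpha> x) = x"
    using autoD[OF \<alpha>] by simp
  show "\<And>x. x \<in> carrier G \<Longrightarrow> \<alpha> (?\<beta> x) = x"
    using autoD[OF \<alpha>] by (simp add: f_inv_into_f)
  fix X assume X: "X \<subseteq> carrier G" "\<alpha> ` X = X"
  have "(\<lambda>x. ?\<beta> (\<alpha> x)) ` X = (\<lambda>x. x) ` X" using X(1) by (intro image_cong refl left) auto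
  then show "?\<beta> ` X = X" using X(2) by (metis image_ident image_image)
qed

lemma iso_of_equal_images:
  assumes "group G" "group G'" and j: "j \<in> hom G P" "inj_on j (carrier G)"
    and k: "k \<in> hom G' P" "inj_on k (carrier G')" and img: "j ` carrier G = k ` carrier G'"
  obtains \<gamma> where "\<gamma> \<in> iso G G'" "\<gamma> \<in> extensional (carrier G)"
    "\<And>a. a \<in> carrier G \<Longrightarrow> k (\<gamma> a) = j a"
proof
  define \<gamma> where "\<gamma> = (\<lambda>a\<in>carrier G. inv_into (carrier G') k (j a))"
  show "\<gamma> \<in> extensional (carrier G)" by (simp add: \<gamma>_def)
  have mem: "\<gamma> a \<in> carrier G'" and eq: "k (\<gamma> a) = j a" if "a \<in> carrier G" for a
  proof -
    have "j a \<in> k ` carrier G'" using that img by blast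
    then show "\<gamma> a \<in> carrier G'" "k (\<gamma> a) = j a"
      using that by (simp_all add: \<gamma>_def inv_into_into f_inv_into_f)
  qed
  show "\<And>a. a \<in> carrier G \<Longrightarrow> k (\<gamma> a) = j a" by (rule eq)
  show "\<gamma> \<in> iso G G'"
  proof (rule isoI)
    show "\<gamma> \<in> hom G G'"
    proof (rule homI)
      fix a b assume ab: "a \<in> carrier G" "b \<in> carrier G"
      then have abG: "a \<otimes>\<^bsub>G\<^esub> b \<in> carrier G" using assms(1) by (simp add: group.is_monoid monoid.m_closed)
      then have "k (\<gamma> (a \<otimes>\<^bsub>G\<^esub> b)) = j a \<otimes>\<^bsub>P\<^esub> j b" using eq ab j(1) by (simp add: hom_def)
      also have "\<dots> = k (\<gamma> a \<otimes>\<^bsub>G'\<^esub> \<gamma> b)" using eq mem ab k(1) by (simp add: hom_def)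
      finally show "\<gamma> (a \<otimes>\<^bsub>G\<^esub> b) = \<gamma> a \<otimes>\<^bsub>G'\<^esub> \<gamma> b"
        using mem ab abG assms(2) by (intro inj_onD[OF k(2)]) (simp_all add: group.is_monoid monoid.m_closed)
    qed (rule mem)
    show "bij_betw \<gamma> (carrier G) (carrier G')"
    proof (rule bij_betw_imageI)
      show "inj_on \<gamma> (carrier G)" using eq inj_onD[OF j(2)] by (metis inj_onI)
      show "\<gamma> ` carrier G = carrier G'"
      proof
        show "carrier G' \<subseteq> \<gamma> ` carrier G"
        proof
          fix b assume b: "b \<in> carrier G'"
          then obtain a where a: "a \<in> carrier G" "k b = j a" using img by blast
          then have "\<gamma> a = b" using inj_onD[OF k(2)] eq mem b by metis
          then show "b \<in> \<gamma> ` carrier G" using a by blast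
        qed
      qed (use mem in auto)
    qed
  qed
qed

context amalgam_setting
begin

lemma hom_eqI:
  assumes "group K" and h: "\<theta> \<in> hom (amalgam A B H f g) K" "\<theta>' \<in> hom (amalgam A B H f g) K"
    and l: "\<And>a. a \<in> carrier A \<Longrightarrow> \<theta> (cls [Inl a]) = \<theta>' (cls [Inl a])"
    and r: "\<And>b. b \<in> carrier B \<Longrightarrow> \<theta> (cls [Inr b]) = \<theta>' (cls [Inr b])"
    and x: "x \<in> carrier (amalgam A B H f g)"
  shows "\<theta> x = \<theta>' x"
proof -
  interpret P: group "amalgam A B H f g" by (rule group_amalgam)
  interpret t: group_hom "amalgam A B H f g" K \<theta>
    using assms by (simp add: group_hom_def group_hom_axioms_def P.is_group)
  interpret t': group_hom "amalgam A B H f g" K \<theta>'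
    using assms by (simp add: group_hom_def group_hom_axioms_def P.is_group)
  have "\<theta> (cls w) = \<theta>' (cls w)" if "w \<in> W" for w
    using that
  proof (induction w)
    case Nil
    then show ?case using t.hom_one t'.hom_one by (simp add: amalgam_def)
  next
    case (Cons y w)
    then have y: "[y] \<in> W" and w: "w \<in> W" by auto
    have c: "cls [y] \<in> carrier (amalgam A B H f g)" "cls w \<in> carrier (amalgam A B H f g)"
      using y w by (auto simp: amalgam_def)
    have eq: "cls (y # w) = cls [y] \<otimes>\<^bsub>amalgam A B H f g\<^esub> cls w" using mult_cls[OF y w] by simp
    have "\<theta> (cls [y]) = \<theta>' (cls [y])" using Cons l r by auto
    moreover have "\<theta> (cls w) = \<theta>' (cls w)" using Cons by auto
    ultimately show ?case unfolding eq using c by simp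
  qed
  then show ?thesis using x by (auto simp: amalgam_def)
qed

end

locale amalgamation_data = G1: group G1 + G2: group G2 + H: group H
  for G1 :: "('a, 'm) monoid_scheme" and G2 :: "('b, 'n) monoid_scheme"
    and H :: "('h, 'k) monoid_scheme" +
  fixes i1 :: "'h \<Rightarrow> 'a" and i2 :: "'h \<Rightarrow> 'b"
  assumes OE1: "OE_group G1" and OE2: "OE_group G2" and finite_H: "finite (carrier H)"
    and i1_hom: "i1 \<in> hom H G1" and i1_inj: "inj_on i1 (carrier H)"
    and i2_hom: "i2 \<in> hom H G2" and i2_inj: "inj_on i2 (carrier H)"
    and proper1: "i1 ` carrier H \<noteq> carrier G1" and proper2: "i2 ` carrier H \<noteq> carrier G2"
begin

abbreviation P where "P \<mu> \<equiv> amalgam G1 G2 H i1 (i2 \<circ> \<mu>)"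

definition stabilizer1 :: "('a \<Rightarrow> 'a) set"
  where "stabilizer1 = {\<alpha> \<in> auto G1. \<alpha> ` (i1 ` carrier H) = i1 ` carrier H}"

definition stabilizer2 :: "('b \<Rightarrow> 'b) set"
  where "stabilizer2 = {\<alpha> \<in> auto G2. \<alpha> ` (i2 ` carrier H) = i2 ` carrier H}"

text \<open>
  The condition says \<open>\<nu> \<circ> a = b \<circ> \<mu>\<close> for the restrictions \<open>a\<close> and \<open>b\<close> of \<open>\<alpha>\<close> and \<open>\<beta>\<close> to \<open>H\<close>.  In the present form it
  mentions neither restrictions nor inverses, so that inverting both automorphisms simply swaps
  \<open>\<mu>\<close> and \<open>\<nu>\<close>.
\<close>

definition compatible :: "('h \<Rightarrow> 'h) \<Rightarrow> ('h \<Rightarrow> 'h) \<Rightarrow> ('a \<Rightarrow> 'a) \<Rightarrow> ('b \<Rightarrow> 'b) \<Rightarrow> bool"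
  where "compatible \<mu> \<nu> \<alpha> \<beta> \<longleftrightarrow> \<alpha> \<in> stabilizer1 \<and> \<beta> \<in> stabilizer2 \<and>
    (\<forall>h\<in>carrier H. \<forall>h'\<in>carrier H. \<alpha> (i1 h) = i1 h' \<longrightarrow> \<beta> (i2 (\<mu> h)) = i2 (\<nu> h'))"

lemma injective_amalgam: "\<mu> \<in> auto H \<Longrightarrow> injective_amalgam G1 G2 H i1 (i2 \<circ> \<mu>)"
proof
  assume \<mu>: "\<mu> \<in> auto H"
  note m = autoD[OF \<mu>]
  show "i1 \<in> hom H G1" "inj_on i1 (carrier H)" by (rule i1_hom i1_inj)+
  show "i2 \<circ> \<mu> \<in> hom H G2" by (rule Group.hom_compose[OF m(1) i2_hom])
  show "inj_on (i2 \<circ> \<mu>) (carrier H)" using m i2_inj by (simp add: comp_inj_on)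
qed

lemma group_P: "\<mu> \<in> auto H \<Longrightarrow> group (P \<mu>)"
  by (rule amalgam_setting.group_amalgam[OF injective_amalgam.axioms(1)[OF injective_amalgam]])

lemma stabilizer1_inverse:
  assumes "\<alpha> \<in> stabilizer1"
  obtains \<beta> where "\<beta> \<in> stabilizer1" "\<And>x. x \<in> carrier G1 \<Longrightarrow> \<beta> (\<alpha> x) = x" "\<And>x. x \<in> carrier G1 \<Longrightarrow> \<alpha> (\<beta> x) = x"
proof -
  have \<alpha>: "\<alpha> \<in> auto G1" "\<alpha> ` (i1 ` carrier H) = i1 ` carrier H"
    using assms by (auto simp: stabilizer1_def)
  obtain \<beta> where \<beta>: "\<beta> \<in> auto G1" "\<And>x. x \<in> carrier G1 \<Longrightarrow> \<beta> (\<alpha> x) = x" "\<And>x. x \<in> carrier G1 \<Longrightarrow> \<alpha> (\<beta> x) = x"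
    "\<beta> ` (i1 ` carrier H) = i1 ` carrier H"
    using G1.auto_inverse[OF \<alpha>(1)] hom_carrier[OF i1_hom] \<alpha>(2) by metis
  then show ?thesis using that \<alpha> \<beta> by (simp add: stabilizer1_def)
qed

lemma stabilizer2_inverse:
  assumes "\<alpha> \<in> stabilizer2"
  obtains \<beta> where "\<beta> \<in> stabilizer2" "\<And>x. x \<in> carrier G2 \<Longrightarrow> \<beta> (\<alpha> x) = x" "\<And>x. x \<in> carrier G2 \<Longrightarrow> \<alpha> (\<beta> x) = x"
proof -
  have \<alpha>: "\<alpha> \<in> auto G2" "\<alpha> ` (i2 ` carrier H) = i2 ` carrier H"
    using assms by (auto simp: stabilizer2_def)
  obtain \<beta> where \<beta>: "\<beta> \<in> auto G2" "\<And>x. x \<in> carrier G2 \<Longrightarrow> \<beta> (\<alpha> x) = x" "\<And>x. x \<in> carrier G2 \<Longrightarrow> \<alpha> (\<beta> x) = x"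
    "\<beta> ` (i2 ` carrier H) = i2 ` carrier H"
    using G2.auto_inverse[OF \<alpha>(1)] hom_carrier[OF i2_hom] \<alpha>(2) by metis
  then show ?thesis using that \<alpha> \<beta> by (simp add: stabilizer2_def)
qed

lemma stabilizer1_edge: "\<alpha> \<in> stabilizer1 \<Longrightarrow> h \<in> carrier H \<Longrightarrow> \<exists>h'\<in>carrier H. \<alpha> (i1 h) = i1 h'"
  unfolding stabilizer1_def by blast

lemma compatible_hom:
  assumes \<mu>: "\<mu> \<in> auto H" and \<nu>: "\<nu> \<in> auto H" and c: "compatible \<mu> \<nu> \<alpha> \<beta>"
  obtains \<theta> where "\<theta> \<in> hom (P \<mu>) (P \<nu>)"
    "\<And>a. a \<in> carrier G1 \<Longrightarrow> \<theta> (amalg_class G1 G2 H i1 (i2 \<circ> \<mu>) [Inl a]) = amalg_class G1 G2 H i1 (i2 \<circ> \<nu>) [Inl (\<alpha> a)]"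
    "\<And>b. b \<in> carrier G2 \<Longrightarrow> \<theta> (amalg_class G1 G2 H i1 (i2 \<circ> \<mu>) [Inr b]) = amalg_class G1 G2 H i1 (i2 \<circ> \<nu>) [Inr (\<beta> b)]"
proof -
  interpret M: injective_amalgam G1 G2 H i1 "i2 \<circ> \<mu>" using \<mu> by (rule injective_amalgam)
  interpret N: injective_amalgam G1 G2 H i1 "i2 \<circ> \<nu>" using \<nu> by (rule injective_amalgam)
  have \<alpha>: "\<alpha> \<in> auto G1" and \<beta>: "\<beta> \<in> auto G2"
    using c by (auto simp: compatible_def stabilizer1_def stabilizer2_def)
  have "(\<lambda>a. N.cls [Inl (\<alpha> a)]) \<in> hom G1 (P \<nu>)"
    using Group.hom_compose[OF autoD(1)[OF \<alpha>] N.amalgam_inl_hom] by (simp add: comp_def)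
  moreover have "(\<lambda>b. N.cls [Inr (\<beta> b)]) \<in> hom G2 (P \<nu>)"
    using Group.hom_compose[OF autoD(1)[OF \<beta>] N.amalgam_inr_hom] by (simp add: comp_def)
  moreover have "N.cls [Inl (\<alpha> (i1 h))] = N.cls [Inr (\<beta> ((i2 \<circ> \<mu>) h))]" if h: "h \<in> carrier H" for h
  proof -
    obtain h' where h': "h' \<in> carrier H" "\<alpha> (i1 h) = i1 h'"
      using c h stabilizer1_edge unfolding compatible_def by blast
    then have "\<beta> (i2 (\<mu> h)) = i2 (\<nu> h')" using c h unfolding compatible_def by blast
    then show ?thesis using N.amalgam_glue[OF h'(1)] h' by simp
  qed
  ultimately obtain \<theta> where "\<theta> \<in> hom (P \<mu>) (P \<nu>)"
    "\<forall>a\<in>carrier G1. \<theta> (M.cls [Inl a]) = N.cls [Inl (\<alpha> a)]"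
    "\<forall>b\<in>carrier G2. \<theta> (M.cls [Inr b]) = N.cls [Inr (\<beta> b)]"
    using ex1_implies_ex[OF M.amalgam_universal[OF group_P[OF \<nu>],
        of "\<lambda>a. N.cls [Inl (\<alpha> a)]" "\<lambda>b. N.cls [Inr (\<beta> b)]"]] by blast
  then show ?thesis by (intro that) blast+
qed

lemma compatible_inverse:
  assumes c: "compatible \<mu> \<nu> \<alpha> \<beta>" and \<mu>: "\<mu> \<in> auto H" and \<nu>: "\<nu> \<in> auto H"
    and \<alpha>': "\<alpha>' \<in> stabilizer1" "\<And>x. x \<in> carrier G1 \<Longrightarrow> \<alpha> (\<alpha>' x) = x"
    and \<beta>': "\<beta>' \<in> stabilizer2" "\<And>x. x \<in> carrier G2 \<Longrightarrow> \<beta>' (\<beta> x) = x"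
  shows "compatible \<nu> \<mu> \<alpha>' \<beta>'"
proof -
  have "\<beta>' (i2 (\<nu> h)) = i2 (\<mu> h')" if h: "h \<in> carrier H" "h' \<in> carrier H" "\<alpha>' (i1 h) = i1 h'" for h h'
  proof -
    have "\<alpha> (i1 h') = i1 h" using \<alpha>'(2)[of "i1 h"] h hom_in_carrier[OF i1_hom] by simp
    then have "\<beta> (i2 (\<mu> h')) = i2 (\<nu> h)" using c h unfolding compatible_def by blast
    moreover have "i2 (\<mu> h') \<in> carrier G2" using h autoD(4)[OF \<mu>] hom_in_carrier[OF i2_hom] by blast
    ultimately show ?thesis using \<beta>'(2) by metis
  qed
  then show ?thesis using \<alpha>' \<beta>' by (auto simp: compatible_def)
qed

lemma compatible_imp_iso:
  assumes \<mu>: "\<mu> \<in> auto H" and \<nu>: "\<nu> \<in> auto H" and c: "compatible \<mu> \<nu> \<alpha> \<beta>"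
  shows "P \<mu> \<cong> P \<nu>"
proof -
  interpret M: injective_amalgam G1 G2 H i1 "i2 \<circ> \<mu>" using \<mu> by (rule injective_amalgam)
  interpret N: injective_amalgam G1 G2 H i1 "i2 \<circ> \<nu>" using \<nu> by (rule injective_amalgam)
  have \<alpha>: "\<alpha> \<in> stabilizer1" and \<beta>: "\<beta> \<in> stabilizer2" using c by (auto simp: compatible_def)
  obtain \<alpha>' where \<alpha>': "\<alpha>' \<in> stabilizer1" "\<And>x. x \<in> carrier G1 \<Longrightarrow> \<alpha>' (\<alpha> x) = x" "\<And>x. x \<in> carrier G1 \<Longrightarrow> \<alpha> (\<alpha>' x) = x"
    using stabilizer1_inverse[OF \<alpha>] by blast
  obtain \<beta>' where \<beta>': "\<beta>' \<in> stabilizer2" "\<And>x. x \<in> carrier G2 \<Longrightarrow> \<beta>' (\<beta> x) = x" "\<And>x. x \<in> carrier G2 \<Longrightarrow> \<beta> (\<beta>' x) = x"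
    using stabilizer2_inverse[OF \<beta>] by blast
  have c': "compatible \<nu> \<mu> \<alpha>' \<beta>'"
    by (rule compatible_inverse[OF c \<mu> \<nu> \<alpha>'(1,3) \<beta>'(1,2)])
  have auts: "\<alpha> \<in> auto G1" "\<alpha>' \<in> auto G1" "\<beta> \<in> auto G2" "\<beta>' \<in> auto G2"
    using \<alpha> \<alpha>'(1) \<beta> \<beta>'(1) by (auto simp: stabilizer1_def stabilizer2_def)
  obtain \<theta> where \<theta>: "\<theta> \<in> hom (P \<mu>) (P \<nu>)"
    "\<And>a. a \<in> carrier G1 \<Longrightarrow> \<theta> (M.cls [Inl a]) = N.cls [Inl (\<alpha> a)]"
    "\<And>b. b \<in> carrier G2 \<Longrightarrow> \<theta> (M.cls [Inr b]) = N.cls [Inr (\<beta> b)]"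
    using compatible_hom[OF \<mu> \<nu> c] by blast
  obtain \<theta>' where \<theta>': "\<theta>' \<in> hom (P \<nu>) (P \<mu>)"
    "\<And>a. a \<in> carrier G1 \<Longrightarrow> \<theta>' (N.cls [Inl a]) = M.cls [Inl (\<alpha>' a)]"
    "\<And>b. b \<in> carrier G2 \<Longrightarrow> \<theta>' (N.cls [Inr b]) = M.cls [Inr (\<beta>' b)]"
    using compatible_hom[OF \<nu> \<mu> c'] by blast
  have gM: "group (P \<mu>)" and gN: "group (P \<nu>)" using \<mu> \<nu> group_P by auto
  have "(\<theta>' \<circ> \<theta>) x = (\<lambda>x. x) x" if "x \<in> carrier (P \<mu>)" for x
  proof (rule M.hom_eqI[OF gM _ _ _ _ that])
    show "\<theta>' \<circ> \<theta> \<in> hom (P \<mu>) (P \<mu>)" using Group.hom_compose[OF \<theta>(1) \<theta>'(1)] .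
    show "(\<lambda>x. x) \<in> hom (P \<mu>) (P \<mu>)" by (simp add: hom_def)
  qed (use \<theta> \<theta>' \<alpha>' \<beta>' autoD(4)[OF auts(1)] autoD(4)[OF auts(3)] in simp_all)
  moreover have "(\<theta> \<circ> \<theta>') x = (\<lambda>x. x) x" if "x \<in> carrier (P \<nu>)" for x
  proof (rule N.hom_eqI[OF gN _ _ _ _ that])
    show "\<theta> \<circ> \<theta>' \<in> hom (P \<nu>) (P \<nu>)" using Group.hom_compose[OF \<theta>'(1) \<theta>(1)] .
    show "(\<lambda>x. x) \<in> hom (P \<nu>) (P \<nu>)" by (simp add: hom_def)
  qed (use \<theta> \<theta>' \<alpha>' \<beta>' autoD(4)[OF auts(2)] autoD(4)[OF auts(4)] in simp_all)
  ultimately have "bij_betw \<theta> (carrier (P \<mu>)) (carrier (P \<nu>))"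
    using hom_carrier[OF \<theta>(1)] hom_carrier[OF \<theta>'(1)]
    by (intro bij_betw_byWitness[where f' = \<theta>']) auto
  then show ?thesis using isoI[OF \<theta>(1)] is_isoI by blast
qed

end


context injective_amalgam
begin

lemma inl_inj: "inj_on (\<lambda>a. cls [Inl a]) (carrier A)"
  using letter_eq[of "Inl _" True "Inl _"] by (auto intro!: inj_onI)

lemma inr_inj: "inj_on (\<lambda>b. cls [Inr b]) (carrier B)"
  using letter_eq[of "Inr _" False "Inr _"] by (auto intro!: inj_onI)

lemma factor_eq:
  "factor True = (\<lambda>a. cls [Inl a]) ` carrier A" "factor False = (\<lambda>b. cls [Inr b]) ` carrier B"
  by (simp_all add: factor_def image_image)

lemma edge_group_inl: "a \<in> carrier A \<Longrightarrow> cls [Inl a] \<in> edge_group \<longleftrightarrow> a \<in> f ` carrier H"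
  using in_edge_group_iff[of "Inl a" True] by (auto simp: e_simps)

lemma edge_group_inr: "b \<in> carrier B \<Longrightarrow> cls [Inr b] \<in> edge_group \<longleftrightarrow> b \<in> g ` carrier H"
  using in_edge_group_iff[of "Inr b" False] by (auto simp: e_simps)

lemma card_edge_group: "card edge_group = card (carrier H)"
  unfolding edge_group_def
proof (rule card_image, rule inj_onI)
  fix h h' assume h: "h \<in> carrier H" "h' \<in> carrier H" "cls [e True h] = cls [e True h']"
  then have "e True h = e True h'" using letter_eq[of "e True h" True "e True h'"] L_closed(3) by blast
  then show "h = h'" using inj_onD[OF e_inj] h by blast
qed

text \<open>
  Each factor is an embedded copy of a group with fewer than two ends, so every embedding of the
  amalgam into a group with a decomposition makes it elliptic there.
\<close>

lemma OE_factor_elliptic: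
  assumes OE: "OE_group A" "OE_group B" and Q: "amalgam_decomposition Q C K"
    and \<psi>: "\<psi> \<in> hom (amalgam A B H f g) Q" "inj_on \<psi> (carrier (amalgam A B H f g))"
  shows "\<exists>x \<in> carrier Q. \<exists>t. \<psi> ` factor s \<subseteq> group.conjugate Q x (C t)"
proof (cases s)
  case True
  have "(\<psi> \<circ> (\<lambda>a. cls [Inl a])) \<in> hom A Q" by (rule Group.hom_compose[OF amalgam_inl_hom \<psi>(1)])
  moreover have "inj_on (\<psi> \<circ> (\<lambda>a. cls [Inl a])) (carrier A)"
    using inl_inj \<psi>(2) hom_carrier[OF amalgam_inl_hom] by (blast intro: comp_inj_on inj_on_subset)
  ultimately have "\<exists>x \<in> carrier Q. \<exists>t. (\<psi> \<circ> (\<lambda>a. cls [Inl a])) ` carrier A \<subseteq> group.conjugate Q x (C t)"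
    by (rule amalgam_decomposition.OE_image_elliptic[OF Q OE(1)])
  then show ?thesis using True unfolding image_comp[symmetric] factor_eq(1)[symmetric] by simp
next
  case False
  have "(\<psi> \<circ> (\<lambda>b. cls [Inr b])) \<in> hom B Q" by (rule Group.hom_compose[OF amalgam_inr_hom \<psi>(1)])
  moreover have "inj_on (\<psi> \<circ> (\<lambda>b. cls [Inr b])) (carrier B)"
    using inr_inj \<psi>(2) hom_carrier[OF amalgam_inr_hom] by (blast intro: comp_inj_on inj_on_subset)
  ultimately have "\<exists>x \<in> carrier Q. \<exists>t. (\<psi> \<circ> (\<lambda>b. cls [Inr b])) ` carrier B \<subseteq> group.conjugate Q x (C t)"
    by (rule amalgam_decomposition.OE_image_elliptic[OF Q OE(2)])
  then show ?thesis using False unfolding image_comp[symmetric] factor_eq(2)[symmetric] by simp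
qed

end

context amalgamation_data
begin

lemma edge_image_eq:
  assumes "\<gamma> ` (i ` carrier H) \<subseteq> j ` carrier H" "inj_on \<gamma> (i ` carrier H)"
    and "inj_on i (carrier H)" "inj_on j (carrier H)"
  shows "\<gamma> ` (i ` carrier H) = j ` carrier H"
  using assms finite_H by (intro card_subset_eq) (simp_all add: card_image)

text \<open>
  The given isomorphism transports the decomposition of \<open>P \<mu>\<close> to a second decomposition of \<open>P \<nu>\<close>.
  All factors are elliptic with respect to both of them, so the two are conjugate, and an
  inner automorphism aligns them.
\<close>

lemma iso_aligned:
  assumes \<mu>: "\<mu> \<in> auto H" and \<nu>: "\<nu> \<in> auto H" and iso: "P \<mu> \<cong> P \<nu>"
  obtains \<Theta> u where "\<Theta> \<in> iso (P \<mu>) (P \<nu>)"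
    "\<And>s. \<Theta> ` injective_amalgam.factor G1 G2 H i1 (i2 \<circ> \<mu>) s =
      injective_amalgam.factor G1 G2 H i1 (i2 \<circ> \<nu>) (s = u)"
    "\<Theta> ` injective_amalgam.edge_group G1 G2 H i1 (i2 \<circ> \<mu>) =
      injective_amalgam.edge_group G1 G2 H i1 (i2 \<circ> \<nu>)"
proof -
  interpret M: injective_amalgam G1 G2 H i1 "i2 \<circ> \<mu>" using \<mu> by (rule injective_amalgam)
  interpret N: injective_amalgam G1 G2 H i1 "i2 \<circ> \<nu>" using \<nu> by (rule injective_amalgam)
  have img: "(i2 \<circ> \<mu>) ` carrier H \<noteq> carrier G2" "(i2 \<circ> \<nu>) ` carrier H \<noteq> carrier G2"
    using autoD(3)[OF \<mu>] autoD(3)[OF \<nu>] proper2 unfolding image_comp[symmetric] by simp_all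
  interpret DM: amalgam_decomposition "P \<mu>" M.factor M.edge_group
    by (rule M.amalgam_decomposition_amalgam[OF finite_H proper1 img(1)])
  interpret DN: amalgam_decomposition "P \<nu>" N.factor N.edge_group
    by (rule N.amalgam_decomposition_amalgam[OF finite_H proper1 img(2)])
  obtain \<theta> where \<theta>: "\<theta> \<in> iso (P \<mu>) (P \<nu>)" using iso by (auto simp: is_iso_def)
  have \<theta>_hom: "\<theta> \<in> hom (P \<mu>) (P \<nu>)" and \<theta>_inj: "inj_on \<theta> (carrier (P \<mu>))"
    using \<theta> by (auto simp: iso_def bij_betw_def)
  have Y: "amalgam_decomposition (P \<nu>) (\<lambda>s. \<theta> ` M.factor s) (\<theta> ` M.edge_group)"
    by (rule amalgam_decomposition_image[OF DM.amalgam_decomposition_axioms DN.is_group \<theta>])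
  have edge_sub: "M.edge_group \<subseteq> carrier (P \<mu>)" using DM.edge_closed(2) by blast
  have "card (\<theta> ` M.edge_group) = card N.edge_group"
    using card_image[OF inj_on_subset[OF \<theta>_inj edge_sub]] M.card_edge_group N.card_edge_group by simp
  moreover have "\<exists>x \<in> carrier (P \<nu>). \<exists>t. \<theta> ` M.factor s \<subseteq> DN.conjugate x (N.factor t)" for s
    by (rule M.OE_factor_elliptic[OF OE1 OE2 DN.amalgam_decomposition_axioms \<theta>_hom \<theta>_inj])
  moreover have "\<exists>x \<in> carrier (P \<nu>). \<exists>t. N.factor s \<subseteq> DN.conjugate x (\<theta> ` M.factor t)" for s
    using N.OE_factor_elliptic[OF OE1 OE2 Y, of "\<lambda>x. x" s] by (simp add: hom_def)
  ultimately obtain p u where p: "p \<in> carrier (P \<nu>)"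
    "\<And>s. \<theta> ` M.factor s = DN.conjugate p (N.factor (s = u))"
    using DN.conjugate_decompositions[OF Y] by metis
  define \<Theta> where "\<Theta> = (\<lambda>k. inv\<^bsub>P \<nu>\<^esub> p \<otimes>\<^bsub>P \<nu>\<^esub> k \<otimes>\<^bsub>P \<nu>\<^esub> inv\<^bsub>P \<nu>\<^esub> (inv\<^bsub>P \<nu>\<^esub> p)) \<circ> \<theta>"
  have \<Theta>_image: "\<Theta> ` X = DN.conjugate (inv\<^bsub>P \<nu>\<^esub> p) (\<theta> ` X)" for X
    by (simp add: \<Theta>_def DN.conjugate_def image_comp)
  have \<Theta>: "\<Theta> \<in> iso (P \<mu>) (P \<nu>)"
    unfolding \<Theta>_def using DN.conjugation_iso[of "inv\<^bsub>P \<nu>\<^esub> p"] p(1)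
    by (intro iso_set_trans[OF \<theta>]) simp
  have factors: "\<Theta> ` M.factor s = N.factor (s = u)" for s
    unfolding \<Theta>_image p(2) using p(1) DN.factor_subset
    by (simp add: DN.conjugate_mult DN.conjugate_one)
  have "\<Theta> ` (M.factor True \<inter> M.factor False) = \<Theta> ` M.factor True \<inter> \<Theta> ` M.factor False"
    using \<Theta> DM.factor_subset by (intro inj_on_image_Int) (auto simp: iso_def bij_betw_def)
  moreover have "N.factor (True = u) \<inter> N.factor (False = u) = N.edge_group"
    using DN.edge[of u] by (cases u) (simp_all add: Int_commute)
  ultimately have "\<Theta> ` M.edge_group = N.edge_group"
    using DM.edge[of True] by (simp add: factors)
  then show ?thesis using that[OF \<Theta> factors] by blast
qed

text \<open>
  An aligned isomorphism either exchanges the factors, which yields an isomorphism from \<open>G1\<close> to \<open>G2\<close> respecting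
  \<open>H\<close>, or restricts to automorphisms of both factors.  The latter are compatible because \<open>i1 h\<close> and
  \<open>i2 (\<mu> h)\<close> are the same element of \<open>P \<mu>\<close>.
\<close>

lemma iso_imp_compatible:
  assumes \<mu>: "\<mu> \<in> auto H" and \<nu>: "\<nu> \<in> auto H" and iso: "P \<mu> \<cong> P \<nu>"
    and no_swap: "\<not> (\<exists>\<gamma> \<in> iso G1 G2. \<gamma> ` (i1 ` carrier H) = i2 ` carrier H)"
  shows "\<exists>\<alpha> \<beta>. compatible \<mu> \<nu> \<alpha> \<beta>"
proof -
  interpret M: injective_amalgam G1 G2 H i1 "i2 \<circ> \<mu>" using \<mu> by (rule injective_amalgam)
  interpret N: injective_amalgam G1 G2 H i1 "i2 \<circ> \<nu>" using \<nu> by (rule injective_amalgam)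
  obtain \<Theta> u where \<Theta>: "\<Theta> \<in> iso (P \<mu>) (P \<nu>)" and factors: "\<And>s. \<Theta> ` M.factor s = N.factor (s = u)"
    and edge: "\<Theta> ` M.edge_group = N.edge_group"
    using iso_aligned[OF \<mu> \<nu> iso] by blast
  have \<Theta>_hom: "\<Theta> \<in> hom (P \<mu>) (P \<nu>)" and \<Theta>_inj: "inj_on \<Theta> (carrier (P \<mu>))"
    using \<Theta> by (auto simp: iso_def bij_betw_def)
  have img: "(i2 \<circ> \<mu>) ` carrier H = i2 ` carrier H" "(i2 \<circ> \<nu>) ` carrier H = i2 ` carrier H"
    using autoD(3)[OF \<mu>] autoD(3)[OF \<nu>] unfolding image_comp[symmetric] by simp_all
  have i1c: "i1 h \<in> carrier G1" and i2c: "i2 h \<in> carrier G2" if "h \<in> carrier H" for h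
    using that hom_in_carrier[OF i1_hom] hom_in_carrier[OF i2_hom] by auto
  define j1 where "j1 a = \<Theta> (M.cls [Inl a])" for a
  define j2 where "j2 b = \<Theta> (M.cls [Inr b])" for b
  have j1: "j1 \<in> hom G1 (P \<nu>)" "inj_on j1 (carrier G1)"
  proof -
    have "\<Theta> \<circ> (\<lambda>a. M.cls [Inl a]) \<in> hom G1 (P \<nu>)" "inj_on (\<Theta> \<circ> (\<lambda>a. M.cls [Inl a])) (carrier G1)"
      using Group.hom_compose[OF M.amalgam_inl_hom \<Theta>_hom] M.inl_inj
        inj_on_subset[OF \<Theta>_inj hom_carrier[OF M.amalgam_inl_hom]] by (simp_all add: comp_inj_on)
    then show "j1 \<in> hom G1 (P \<nu>)" "inj_on j1 (carrier G1)" by (simp_all add: comp_def j1_def[abs_def])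
  qed
  have j2: "j2 \<in> hom G2 (P \<nu>)" "inj_on j2 (carrier G2)"
  proof -
    have "\<Theta> \<circ> (\<lambda>b. M.cls [Inr b]) \<in> hom G2 (P \<nu>)" "inj_on (\<Theta> \<circ> (\<lambda>b. M.cls [Inr b])) (carrier G2)"
      using Group.hom_compose[OF M.amalgam_inr_hom \<Theta>_hom] M.inr_inj
        inj_on_subset[OF \<Theta>_inj hom_carrier[OF M.amalgam_inr_hom]] by (simp_all add: comp_inj_on)
    then show "j2 \<in> hom G2 (P \<nu>)" "inj_on j2 (carrier G2)" by (simp_all add: comp_def j2_def[abs_def])
  qed
  have j1_img: "j1 ` carrier G1 = N.factor (True = u)" and j2_img: "j2 ` carrier G2 = N.factor (False = u)"
    using factors[of True] factors[of False] by (simp_all add: M.factor_eq j1_def j2_def image_image)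
  have j1_edge: "j1 (i1 h) \<in> N.edge_group" and j2_edge: "j2 (i2 h) \<in> N.edge_group"
    if h: "h \<in> carrier H" for h
  proof -
    have "M.cls [Inl (i1 h)] \<in> M.edge_group" "M.cls [Inr (i2 h)] \<in> M.edge_group"
      using M.edge_group_inl M.edge_group_inr i1c i2c h img(1) by auto
    then show "j1 (i1 h) \<in> N.edge_group" "j2 (i2 h) \<in> N.edge_group"
      using edge unfolding j1_def j2_def by blast+
  qed
  show ?thesis
  proof (cases u)
    case False
    then have "j1 ` carrier G1 = (\<lambda>b. N.cls [Inr b]) ` carrier G2" using j1_img N.factor_eq by simp
    from iso_of_equal_images[OF G1.is_group G2.is_group j1 N.amalgam_inr_hom N.inr_inj this]
    obtain \<gamma> where \<gamma>: "\<gamma> \<in> iso G1 G2" "\<And>a. a \<in> carrier G1 \<Longrightarrow> N.cls [Inr (\<gamma> a)] = j1 a"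
      by blast
    have \<gamma>_bij: "bij_betw \<gamma> (carrier G1) (carrier G2)" using \<gamma>(1) by (simp add: iso_def)
    have "\<gamma> ` (i1 ` carrier H) \<subseteq> i2 ` carrier H"
    proof clarify
      fix h assume h: "h \<in> carrier H"
      then have "N.cls [Inr (\<gamma> (i1 h))] \<in> N.edge_group" using \<gamma>(2) i1c j1_edge by simp
      moreover have "\<gamma> (i1 h) \<in> carrier G2" using bij_betwE[OF \<gamma>_bij] i1c[OF h] by blast
      ultimately show "\<gamma> (i1 h) \<in> i2 ` carrier H" using N.edge_group_inr img(2) by blast
    qed
    moreover have "inj_on \<gamma> (i1 ` carrier H)"
      using \<gamma>_bij i1c by (auto simp: bij_betw_def intro: inj_on_subset)
    ultimately have "\<gamma> ` (i1 ` carrier H) = i2 ` carrier H"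
      using i1_inj i2_inj by (intro edge_image_eq)
    then show ?thesis using no_swap \<gamma>(1) by blast
  next
    case True
    then have "j1 ` carrier G1 = (\<lambda>a. N.cls [Inl a]) ` carrier G1"
      and "j2 ` carrier G2 = (\<lambda>b. N.cls [Inr b]) ` carrier G2"
      using j1_img j2_img N.factor_eq by simp_all
    from iso_of_equal_images[OF G1.is_group G1.is_group j1 N.amalgam_inl_hom N.inl_inj this(1)]
      iso_of_equal_images[OF G2.is_group G2.is_group j2 N.amalgam_inr_hom N.inr_inj this(2)]
    obtain \<alpha> \<beta> where \<alpha>: "\<alpha> \<in> iso G1 G1" "\<alpha> \<in> extensional (carrier G1)"
        "\<And>a. a \<in> carrier G1 \<Longrightarrow> N.cls [Inl (\<alpha> a)] = j1 a"
      and \<beta>: "\<beta> \<in> iso G2 G2" "\<beta> \<in> extensional (carrier G2)"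
        "\<And>b. b \<in> carrier G2 \<Longrightarrow> N.cls [Inr (\<beta> b)] = j2 b"
      by metis
    have auts: "\<alpha> \<in> auto G1" "\<beta> \<in> auto G2"
      using \<alpha> \<beta> by (simp_all add: auto_def Bij_def iso_def)
    have "\<alpha> ` (i1 ` carrier H) = i1 ` carrier H"
    proof (rule edge_image_eq[OF _ _ i1_inj i1_inj])
      show "\<alpha> ` (i1 ` carrier H) \<subseteq> i1 ` carrier H"
      proof clarify
        fix h assume h: "h \<in> carrier H"
        then have "N.cls [Inl (\<alpha> (i1 h))] \<in> N.edge_group" using \<alpha>(3) i1c j1_edge by simp
        then show "\<alpha> (i1 h) \<in> i1 ` carrier H"
          using N.edge_group_inl autoD(4)[OF auts(1)] i1c[OF h] by blast
      qed
      show "inj_on \<alpha> (i1 ` carrier H)"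
        using autoD(2)[OF auts(1)] i1c by (auto intro: inj_on_subset)
    qed
    moreover have "\<beta> ` (i2 ` carrier H) = i2 ` carrier H"
    proof (rule edge_image_eq[OF _ _ i2_inj i2_inj])
      show "\<beta> ` (i2 ` carrier H) \<subseteq> i2 ` carrier H"
      proof clarify
        fix h assume h: "h \<in> carrier H"
        then have "N.cls [Inr (\<beta> (i2 h))] \<in> N.edge_group" using \<beta>(3) i2c j2_edge by simp
        then show "\<beta> (i2 h) \<in> i2 ` carrier H"
          using N.edge_group_inr autoD(4)[OF auts(2)] i2c[OF h] img(2) by blast
      qed
      show "inj_on \<beta> (i2 ` carrier H)"
        using autoD(2)[OF auts(2)] i2c by (auto intro: inj_on_subset)
    qed
    moreover have "\<beta> (i2 (\<mu> h)) = i2 (\<nu> h')"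
      if h: "h \<in> carrier H" "h' \<in> carrier H" "\<alpha> (i1 h) = i1 h'" for h h'
    proof -
      have c: "i2 (\<mu> h) \<in> carrier G2" "i2 (\<nu> h') \<in> carrier G2"
        using autoD(4)[OF \<mu> h(1)] autoD(4)[OF \<nu> h(2)] i2c by auto
      have "N.cls [Inr (\<beta> (i2 (\<mu> h)))] = \<Theta> (M.cls [Inr (i2 (\<mu> h))])"
        using \<beta>(3)[OF c(1)] by (simp add: j2_def)
      also have "M.cls [Inr (i2 (\<mu> h))] = M.cls [Inl (i1 h)]"
        using M.amalgam_glue[OF h(1)] by simp
      also have "\<Theta> (M.cls [Inl (i1 h)]) = N.cls [Inl (i1 h')]"
        using \<alpha>(3)[OF i1c[OF h(1)]] h(3) by (simp add: j1_def)
      also have "\<dots> = N.cls [Inr (i2 (\<nu> h'))]" using N.amalgam_glue[OF h(2)] by simp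
      finally show ?thesis
        using inj_onD[OF N.inr_inj] autoD(4)[OF auts(2) c(1)] c(2) by blast
    qed
    ultimately have "compatible \<mu> \<nu> \<alpha> \<beta>"
      using auts unfolding compatible_def stabilizer1_def stabilizer2_def by blast
    then show ?thesis by blast
  qed
qed

end


section \<open>Counting double cosets\<close>

lemma restrict_auto_props:
  assumes "group H" "group G" and i: "i \<in> hom H G" "inj_on i (carrier H)"
    and \<alpha>: "\<alpha> \<in> auto G" "\<alpha> ` (i ` carrier H) = i ` carrier H"
  shows "restrict_auto H i \<alpha> \<in> auto H"
    and "h \<in> carrier H \<Longrightarrow> i (restrict_auto H i \<alpha> h) = \<alpha> (i h)"
proof -
  have iG: "i ` carrier H \<subseteq> carrier G" by (rule hom_carrier[OF i(1)])
  have "\<alpha> \<circ> i \<in> hom H G" "inj_on (\<alpha> \<circ> i) (carrier H)"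
    using Group.hom_compose[OF i(1) autoD(1)[OF \<alpha>(1)]]
      comp_inj_on[OF i(2) inj_on_subset[OF autoD(2)[OF \<alpha>(1)] iG]] by simp_all
  moreover have "(\<alpha> \<circ> i) ` carrier H = i ` carrier H" using \<alpha>(2) by (simp add: image_comp)
  ultimately obtain \<gamma> where \<gamma>: "\<gamma> \<in> iso H H" "\<gamma> \<in> extensional (carrier H)"
    "\<And>h. h \<in> carrier H \<Longrightarrow> i (\<gamma> h) = (\<alpha> \<circ> i) h"
    using iso_of_equal_images[OF assms(1,1) _ _ i] by blast
  have mem: "\<gamma> h \<in> carrier H" if "h \<in> carrier H" for h
    using \<gamma>(1) that by (auto simp: iso_def bij_betw_def)
  have "restrict_auto H i \<alpha> = \<gamma>"
  proof
    fix h show "restrict_auto H i \<alpha> h = \<gamma> h"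
    proof (cases "h \<in> carrier H")
      case True
      then have "inv_into (carrier H) i (\<alpha> (i h)) = \<gamma> h"
        using \<gamma>(3)[OF True] mem[OF True] inv_into_f_f[OF i(2), of "\<gamma> h"] by simp
      then show ?thesis using True by (simp add: restrict_auto_def)
    next
      case False
      then show ?thesis using \<gamma>(2) by (simp add: restrict_auto_def extensional_def)
    qed
  qed
  then show "restrict_auto H i \<alpha> \<in> auto H"
    and "h \<in> carrier H \<Longrightarrow> i (restrict_auto H i \<alpha> h) = \<alpha> (i h)"
    using \<gamma> by (simp_all add: auto_def Bij_def iso_def)
qed

lemma mult_AutoGroup:
  "\<phi> \<in> auto G \<Longrightarrow> \<psi> \<in> auto G \<Longrightarrow> \<phi> \<otimes>\<^bsub>AutoGroup G\<^esub> \<psi> = compose (carrier G) \<phi> \<psi>"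
  by (simp add: AutoGroup_def BijGroup_def auto_def)

lemma carrier_AutoGroup: "carrier (AutoGroup G) = auto G"
  by (simp add: AutoGroup_def)

lemma card_image_cong_kernel:
  assumes "\<And>x y. x \<in> S \<Longrightarrow> y \<in> S \<Longrightarrow> f x = f y \<longleftrightarrow> g x = g y"
  shows "card (f ` S) = card (g ` S)"
proof -
  define k where "k y = g (inv_into S f y)" for y
  have k: "k (f x) = g x" if "x \<in> S" for x
  proof -
    have "inv_into S f (f x) \<in> S" "f (inv_into S f (f x)) = f x"
      using that by (auto intro: inv_into_into f_inv_into_f)
    then show ?thesis using assms that unfolding k_def by blast
  qed
  have "bij_betw k (f ` S) (g ` S)"
    using k assms by (intro bij_betw_imageI inj_onI) (auto simp: image_iff)
  then show ?thesis by (rule bij_betw_same_card)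
qed

context amalgamation_data
begin

abbreviation outer :: "('h \<Rightarrow> 'h) \<Rightarrow> ('h \<Rightarrow> 'h) set"
  where "outer \<mu> \<equiv> Inn H #>\<^bsub>AutoGroup H\<^esub> \<mu>"

abbreviation double_coset :: "('h \<Rightarrow> 'h) \<Rightarrow> ('h \<Rightarrow> 'h) set set"
  where "double_coset \<mu> \<equiv> Aut_tilde G2 H i2 <#>\<^bsub>Out H\<^esub> {outer \<mu>} <#>\<^bsub>Out H\<^esub> Aut_tilde G1 H i1"

lemma restrict1:
  assumes "\<alpha> \<in> stabilizer1"
  shows "restrict_auto H i1 \<alpha> \<in> auto H"
    and "h \<in> carrier H \<Longrightarrow> i1 (restrict_auto H i1 \<alpha> h) = \<alpha> (i1 h)"
  using restrict_auto_props[OF H.is_group G1.is_group i1_hom i1_inj] assms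
  by (auto simp: stabilizer1_def)

lemma restrict2:
  assumes "\<beta> \<in> stabilizer2"
  shows "restrict_auto H i2 \<beta> \<in> auto H"
    and "h \<in> carrier H \<Longrightarrow> i2 (restrict_auto H i2 \<beta> h) = \<beta> (i2 h)"
  using restrict_auto_props[OF H.is_group G2.is_group i2_hom i2_inj] assms
  by (auto simp: stabilizer2_def)

lemma double_coset_eq:
  assumes \<mu>: "\<mu> \<in> auto H"
  shows "double_coset \<mu> = {outer (restrict_auto H i2 \<beta> \<otimes>\<^bsub>AutoGroup H\<^esub> \<mu> \<otimes>\<^bsub>AutoGroup H\<^esub> restrict_auto H i1 \<alpha>) |
    \<alpha> \<beta>. \<alpha> \<in> stabilizer1 \<and> \<beta> \<in> stabilizer2}"
proof -
  interpret Aut: group "AutoGroup H" by (rule H.AutoGroup)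
  have prod: "outer (restrict_auto H i2 \<beta>) \<otimes>\<^bsub>Out H\<^esub> outer \<mu> \<otimes>\<^bsub>Out H\<^esub> outer (restrict_auto H i1 \<alpha>) =
      outer (restrict_auto H i2 \<beta> \<otimes>\<^bsub>AutoGroup H\<^esub> \<mu> \<otimes>\<^bsub>AutoGroup H\<^esub> restrict_auto H i1 \<alpha>)"
    if "\<alpha> \<in> stabilizer1" "\<beta> \<in> stabilizer2" for \<alpha> \<beta>
  proof -
    have c: "restrict_auto H i2 \<beta> \<in> carrier (AutoGroup H)" "\<mu> \<in> carrier (AutoGroup H)"
      "restrict_auto H i1 \<alpha> \<in> carrier (AutoGroup H)"
      using restrict1 restrict2 that \<mu> by (simp_all add: carrier_AutoGroup)
    then show ?thesis
      by (simp add: Out_def normal.rcos_sum[OF H.Inn_normal])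
  qed
  have tilde: "Aut_tilde G1 H i1 = (\<lambda>\<alpha>. outer (restrict_auto H i1 \<alpha>)) ` stabilizer1"
    "Aut_tilde G2 H i2 = (\<lambda>\<beta>. outer (restrict_auto H i2 \<beta>)) ` stabilizer2"
    by (auto simp: Aut_tilde_def stabilizer1_def stabilizer2_def)
  have "double_coset \<mu> = {outer (restrict_auto H i2 \<beta>) \<otimes>\<^bsub>Out H\<^esub> outer \<mu> \<otimes>\<^bsub>Out H\<^esub> outer (restrict_auto H i1 \<alpha>) |
    \<alpha> \<beta>. \<alpha> \<in> stabilizer1 \<and> \<beta> \<in> stabilizer2}"
    unfolding tilde set_mult_def by blast
  also have "\<dots> = {outer (restrict_auto H i2 \<beta> \<otimes>\<^bsub>AutoGroup H\<^esub> \<mu> \<otimes>\<^bsub>AutoGroup H\<^esub> restrict_auto H i1 \<alpha>) |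
    \<alpha> \<beta>. \<alpha> \<in> stabilizer1 \<and> \<beta> \<in> stabilizer2}"
    using prod by (intro Collect_cong) metis
  finally show ?thesis .
qed

lemma compatible_imp_double_coset:
  assumes \<mu>: "\<mu> \<in> auto H" and \<nu>: "\<nu> \<in> auto H" and c: "compatible \<mu> \<nu> \<alpha> \<beta>"
  shows "outer \<nu> \<in> double_coset \<mu>"
proof -
  interpret Aut: group "AutoGroup H" by (rule H.AutoGroup)
  have \<alpha>: "\<alpha> \<in> stabilizer1" and \<beta>: "\<beta> \<in> stabilizer2" using c by (auto simp: compatible_def)
  obtain \<alpha>' where \<alpha>': "\<alpha>' \<in> stabilizer1" "\<And>x. x \<in> carrier G1 \<Longrightarrow> \<alpha> (\<alpha>' x) = x"
    using stabilizer1_inverse[OF \<alpha>] by blast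
  define a where "a = restrict_auto H i1 \<alpha>'"
  define b where "b = restrict_auto H i2 \<beta>"
  have a: "a \<in> auto H" "\<And>h. h \<in> carrier H \<Longrightarrow> i1 (a h) = \<alpha>' (i1 h)"
    using restrict1[OF \<alpha>'(1)] by (simp_all add: a_def)
  have b: "b \<in> auto H" "\<And>h. h \<in> carrier H \<Longrightarrow> i2 (b h) = \<beta> (i2 h)"
    using restrict2[OF \<beta>] by (simp_all add: b_def)
  have "\<nu> h = b (\<mu> (a h))" if h: "h \<in> carrier H" for h
  proof -
    have ah: "a h \<in> carrier H" using autoD(4)[OF a(1) h] .
    have "\<alpha> (i1 (a h)) = i1 h" using a(2)[OF h] \<alpha>'(2) hom_in_carrier[OF i1_hom h] by simp
    then have "\<beta> (i2 (\<mu> (a h))) = i2 (\<nu> h)" using c ah h unfolding compatible_def by blast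
    then have "i2 (b (\<mu> (a h))) = i2 (\<nu> h)" using b(2)[OF autoD(4)[OF \<mu> ah]] by simp
    then show ?thesis
      using inj_onD[OF i2_inj, of "\<nu> h" "b (\<mu> (a h))"] autoD(4)[OF \<nu> h] autoD(4)[OF b(1) autoD(4)[OF \<mu> ah]]
      by simp
  qed
  moreover have "b \<otimes>\<^bsub>AutoGroup H\<^esub> \<mu> \<in> auto H"
    using Aut.m_closed[of b \<mu>] b(1) \<mu> by (simp add: carrier_AutoGroup)
  moreover have "\<nu> \<in> extensional (carrier H)" using \<nu> by (simp add: auto_def Bij_def)
  ultimately have "b \<otimes>\<^bsub>AutoGroup H\<^esub> \<mu> \<otimes>\<^bsub>AutoGroup H\<^esub> a = \<nu>"
    using a b \<mu> autoD(4)[OF a(1)]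
    by (subst mult_AutoGroup, simp, simp, subst mult_AutoGroup)
      (auto simp: compose_def intro!: extensionalityI[of _ "carrier H"])
  then show ?thesis unfolding double_coset_eq[OF \<mu>] using \<alpha>' \<beta> by (auto simp: a_def b_def)
qed

text \<open>
  Equality in \<open>Out H\<close> holds only up to an inner automorphism of \<open>H\<close>, say by \<open>c\<close>.  Composing \<open>\<beta>\<close> with
  conjugation by \<open>i2 c\<close>, an inner automorphism of \<open>G2\<close>, absorbs it.
\<close>

lemma double_coset_imp_compatible:
  assumes \<mu>: "\<mu> \<in> auto H" and \<nu>: "\<nu> \<in> auto H" and D: "outer \<nu> \<in> double_coset \<mu>"
  shows "\<exists>\<alpha> \<beta>. compatible \<mu> \<nu> \<alpha> \<beta>"
proof -
  interpret Aut: group "AutoGroup H" by (rule H.AutoGroup)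
  interpret I: normal "Inn H" "AutoGroup H" by (rule H.Inn_normal)
  obtain \<alpha>' \<beta> where \<alpha>': "\<alpha>' \<in> stabilizer1" and \<beta>: "\<beta> \<in> stabilizer2"
    and eq: "outer \<nu> = outer (restrict_auto H i2 \<beta> \<otimes>\<^bsub>AutoGroup H\<^esub> \<mu> \<otimes>\<^bsub>AutoGroup H\<^esub> restrict_auto H i1 \<alpha>')"
    using D unfolding double_coset_eq[OF \<mu>] by blast
  define a where "a = restrict_auto H i1 \<alpha>'"
  define b where "b = restrict_auto H i2 \<beta>"
  have a: "a \<in> auto H" "\<And>h. h \<in> carrier H \<Longrightarrow> i1 (a h) = \<alpha>' (i1 h)"
    using restrict1[OF \<alpha>'] by (simp_all add: a_def)
  have b: "b \<in> auto H" "\<And>h. h \<in> carrier H \<Longrightarrow> i2 (b h) = \<beta> (i2 h)"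
    using restrict2[OF \<beta>] by (simp_all add: b_def)
  have b\<mu>: "b \<otimes>\<^bsub>AutoGroup H\<^esub> \<mu> \<in> auto H"
    using Aut.m_closed[of b \<mu>] b(1) \<mu> by (simp add: carrier_AutoGroup)
  have b\<mu>a: "b \<otimes>\<^bsub>AutoGroup H\<^esub> \<mu> \<otimes>\<^bsub>AutoGroup H\<^esub> a \<in> auto H"
    using Aut.m_closed[of "b \<otimes>\<^bsub>AutoGroup H\<^esub> \<mu>" a] a(1) b\<mu> by (simp add: carrier_AutoGroup)
  have "\<nu> \<in> outer (b \<otimes>\<^bsub>AutoGroup H\<^esub> \<mu> \<otimes>\<^bsub>AutoGroup H\<^esub> a)"
    using Aut.rcos_self[OF _ I.subgroup_axioms, of \<nu>] \<nu> eq by (simp add: a_def b_def carrier_AutoGroup)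
  then obtain \<iota> where "\<iota> \<in> Inn H" and \<nu>_eq: "\<nu> = \<iota> \<otimes>\<^bsub>AutoGroup H\<^esub> (b \<otimes>\<^bsub>AutoGroup H\<^esub> \<mu> \<otimes>\<^bsub>AutoGroup H\<^esub> a)"
    by (auto simp: r_coset_def)
  then obtain c where c: "c \<in> carrier H" "\<iota> = (\<lambda>x\<in>carrier H. c \<otimes>\<^bsub>H\<^esub> x \<otimes>\<^bsub>H\<^esub> inv\<^bsub>H\<^esub> c)"
    by (auto simp: Inn_def)
  have \<iota>: "\<iota> \<in> auto H" using \<open>\<iota> \<in> Inn H\<close> H.Inn_subset_auto by blast
  have \<nu>: "\<nu> h = c \<otimes>\<^bsub>H\<^esub> b (\<mu> (a h)) \<otimes>\<^bsub>H\<^esub> inv\<^bsub>H\<^esub> c" if h: "h \<in> carrier H" for h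
  proof -
    have ah: "a h \<in> carrier H" using autoD(4)[OF a(1) h] .
    have "b (\<mu> (a h)) \<in> carrier H" using autoD(4)[OF b(1) autoD(4)[OF \<mu> ah]] .
    moreover have "(b \<otimes>\<^bsub>AutoGroup H\<^esub> \<mu> \<otimes>\<^bsub>AutoGroup H\<^esub> a) h = (b \<otimes>\<^bsub>AutoGroup H\<^esub> \<mu>) (a h)"
      using h by (simp only: mult_AutoGroup[OF b\<mu> a(1)] compose_eq)
    moreover have "(b \<otimes>\<^bsub>AutoGroup H\<^esub> \<mu>) (a h) = b (\<mu> (a h))"
      using ah by (simp only: mult_AutoGroup[OF b(1) \<mu>] compose_eq)
    moreover have "\<nu> h = \<iota> ((b \<otimes>\<^bsub>AutoGroup H\<^esub> \<mu> \<otimes>\<^bsub>AutoGroup H\<^esub> a) h)"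
      unfolding \<nu>_eq mult_AutoGroup[OF \<iota> b\<mu>a] using h by (rule compose_eq)
    ultimately show ?thesis using c(2) by simp
  qed
  have ic: "i2 c \<in> carrier G2" using hom_in_carrier[OF i2_hom c(1)] .
  define \<kappa> where "\<kappa> = (\<lambda>x\<in>carrier G2. i2 c \<otimes>\<^bsub>G2\<^esub> x \<otimes>\<^bsub>G2\<^esub> inv\<^bsub>G2\<^esub> (i2 c))"
  have \<kappa>: "\<kappa> \<in> auto G2" using G2.Inn_subset_auto ic by (auto simp: \<kappa>_def Inn_def)
  have \<kappa>_i2: "\<kappa> (i2 h) = i2 (c \<otimes>\<^bsub>H\<^esub> h \<otimes>\<^bsub>H\<^esub> inv\<^bsub>H\<^esub> c)" if h: "h \<in> carrier H" for h
  proof -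
    interpret i2: group_hom H G2 i2 using i2_hom by unfold_locales
    show ?thesis using h c(1) by (simp add: \<kappa>_def)
  qed
  define \<beta>' where "\<beta>' = \<kappa> \<otimes>\<^bsub>AutoGroup G2\<^esub> \<beta>"
  have \<beta>_auto: "\<beta> \<in> auto G2" using \<beta> by (simp add: stabilizer2_def)
  have \<beta>'_eq: "\<beta>' x = \<kappa> (\<beta> x)" if "x \<in> carrier G2" for x
    using that by (simp add: \<beta>'_def mult_AutoGroup[OF \<kappa> \<beta>_auto] compose_def)
  have \<beta>'_auto: "\<beta>' \<in> auto G2"
    using monoid.m_closed[OF group.is_monoid[OF G2.AutoGroup], of \<kappa> \<beta>] \<kappa> \<beta>_auto
    by (simp add: \<beta>'_def carrier_AutoGroup)
  have i2c: "i2 h \<in> carrier G2" if "h \<in> carrier H" for h using hom_in_carrier[OF i2_hom that] .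
  have "\<beta>' ` (i2 ` carrier H) = i2 ` carrier H"
  proof (rule edge_image_eq[OF _ _ i2_inj i2_inj])
    show "\<beta>' ` (i2 ` carrier H) \<subseteq> i2 ` carrier H"
    proof clarify
      fix h assume h: "h \<in> carrier H"
      then have "\<beta>' (i2 h) = i2 (c \<otimes>\<^bsub>H\<^esub> b h \<otimes>\<^bsub>H\<^esub> inv\<^bsub>H\<^esub> c)"
        using \<beta>'_eq[OF i2c[OF h]] b(2)[OF h] \<kappa>_i2[OF autoD(4)[OF b(1) h]] by simp
      then show "\<beta>' (i2 h) \<in> i2 ` carrier H" using c(1) autoD(4)[OF b(1) h] by simp
    qed
    show "inj_on \<beta>' (i2 ` carrier H)"
      using autoD(2)[OF \<beta>'_auto] i2c by (auto intro: inj_on_subset)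
  qed
  then have \<beta>'_stab: "\<beta>' \<in> stabilizer2" using \<beta>'_auto by (simp add: stabilizer2_def)
  obtain \<alpha> where \<alpha>: "\<alpha> \<in> stabilizer1" "\<And>x. x \<in> carrier G1 \<Longrightarrow> \<alpha>' (\<alpha> x) = x"
    using stabilizer1_inverse[OF \<alpha>'] by blast
  have "\<beta>' (i2 (\<mu> h)) = i2 (\<nu> h')"
    if h: "h \<in> carrier H" "h' \<in> carrier H" "\<alpha> (i1 h) = i1 h'" for h h'
  proof -
    have "i1 (a h') = i1 h" using a(2)[OF h(2)] \<alpha>(2)[OF hom_in_carrier[OF i1_hom h(1)]] h(3) by simp
    then have "a h' = h" using inj_onD[OF i1_inj] autoD(4)[OF a(1) h(2)] h(1) by blast
    moreover have \<mu>h: "\<mu> h \<in> carrier H" using autoD(4)[OF \<mu> h(1)] .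
    ultimately show ?thesis
      using \<beta>'_eq[OF i2c[OF \<mu>h]] b(2)[OF \<mu>h] \<kappa>_i2[OF autoD(4)[OF b(1) \<mu>h]] \<nu>[OF h(2)] by simp
  qed
  then have "compatible \<mu> \<nu> \<alpha> \<beta>'" using \<alpha>(1) \<beta>'_stab unfolding compatible_def by blast
  then show ?thesis by blast
qed

text \<open>
  Membership of \<open>outer \<nu>\<close> in the double coset of \<open>\<mu>\<close> is the same as isomorphism of \<open>P \<mu>\<close> and \<open>P \<nu>\<close>.  So double
  cosets and isomorphism classes are images of \<open>auto H\<close> under two maps with the same fibres.
\<close>

theorem card_iso_classes:
  assumes no_swap: "\<not> (\<exists>\<gamma> \<in> iso G1 G2. \<gamma> ` (i1 ` carrier H) = i2 ` carrier H)"
  shows "card (iso_classes {P \<mu> | \<mu>. \<mu> \<in> auto H}) =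
         card (double_cosets (Out H) (Aut_tilde G2 H i2) (Aut_tilde G1 H i1))"
proof -
  have iso_iff: "P \<mu> \<cong> P \<nu> \<longleftrightarrow> outer \<nu> \<in> double_coset \<mu>" if "\<mu> \<in> auto H" "\<nu> \<in> auto H" for \<mu> \<nu>
    using that iso_imp_compatible no_swap compatible_imp_iso compatible_imp_double_coset
      double_coset_imp_compatible by metis
  have sym: "P \<nu> \<cong> P \<mu>" if "\<mu> \<in> auto H" "P \<mu> \<cong> P \<nu>" for \<mu> \<nu>
    using that group.iso_sym[OF group_P] by blast
  define iso_class where "iso_class \<mu> = {K. (\<exists>\<nu>\<in>auto H. K = P \<nu>) \<and> P \<mu> \<cong> K}" for \<mu>
  have classes: "iso_classes {P \<mu> | \<mu>. \<mu> \<in> auto H} = iso_class ` auto H"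
    unfolding iso_classes_def quotient_def iso_class_def by auto
  have cosets: "double_cosets (Out H) (Aut_tilde G2 H i2) (Aut_tilde G1 H i1) = double_coset ` auto H"
    unfolding double_cosets_def Out_def carrier_FactGroup carrier_AutoGroup by auto
  have sub: "double_coset \<mu> \<subseteq> outer ` auto H" if \<mu>: "\<mu> \<in> auto H" for \<mu>
  proof -
    interpret Aut: group "AutoGroup H" by (rule H.AutoGroup)
    show ?thesis
      unfolding double_coset_eq[OF \<mu>] using restrict1 restrict2 \<mu> Aut.m_closed
      by (fastforce simp: carrier_AutoGroup)
  qed
  have class_eq: "iso_class \<mu> = iso_class \<nu> \<longleftrightarrow> P \<mu> \<cong> P \<nu>" if "\<mu> \<in> auto H" "\<nu> \<in> auto H" for \<mu> \<nu>
  proof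
    assume "iso_class \<mu> = iso_class \<nu>"
    moreover have "P \<nu> \<in> iso_class \<nu>" using that by (auto simp: iso_class_def)
    ultimately show "P \<mu> \<cong> P \<nu>" by (auto simp: iso_class_def)
  next
    assume "P \<mu> \<cong> P \<nu>"
    then show "iso_class \<mu> = iso_class \<nu>"
      using sym[OF that(1)] unfolding iso_class_def by (blast intro: iso_trans)
  qed
  have coset_eq: "double_coset \<mu> = double_coset \<nu> \<longleftrightarrow> P \<mu> \<cong> P \<nu>" if "\<mu> \<in> auto H" "\<nu> \<in> auto H" for \<mu> \<nu>
  proof
    assume "double_coset \<mu> = double_coset \<nu>"
    moreover have "outer \<nu> \<in> double_coset \<nu>" using iso_iff[OF that(2,2)] by simp
    ultimately show "P \<mu> \<cong> P \<nu>" using iso_iff[OF that] by simp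
  next
    assume iso: "P \<mu> \<cong> P \<nu>"
    have "outer \<zeta> \<in> double_coset \<mu> \<longleftrightarrow> outer \<zeta> \<in> double_coset \<nu>" if \<zeta>: "\<zeta> \<in> auto H" for \<zeta>
      using iso_iff[OF \<open>\<mu> \<in> auto H\<close> \<zeta>] iso_iff[OF \<open>\<nu> \<in> auto H\<close> \<zeta>]
        iso_trans[OF iso, of "P \<zeta>"] iso_trans[OF sym[OF \<open>\<mu> \<in> auto H\<close> iso], of "P \<zeta>"] by blast
    then show "double_coset \<mu> = double_coset \<nu>"
      using sub[OF that(1)] sub[OF that(2)] by blast
  qed
  show ?thesis
    unfolding classes cosets using class_eq coset_eq by (intro card_image_cong_kernel) simp
qed

end

theorem theorem4p12:
  fixes G1 :: "'a monoid" and G2 :: "'b monoid" and H :: "'h monoid"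
    and i1 :: "'h \<Rightarrow> 'a" and i2 :: "'h \<Rightarrow> 'b"
  assumes "OE_group G1" and "OE_group G2"
    and "group H" and "finite (carrier H)"
    and "i1 \<in> mon H G1" and "i2 \<in> mon H G2"
    and "i1 ` carrier H \<noteq> carrier G1" and "i2 ` carrier H \<noteq> carrier G2"
    and "\<not> (\<exists>\<gamma> \<in> iso G1 G2. \<gamma> ` (i1 ` carrier H) = i2 ` carrier H)"
  shows "card (iso_classes {amalgam G1 G2 H i1 (i2 \<circ> \<mu>) | \<mu>. \<mu> \<in> auto H}) =
         card (double_cosets (Out H) (Aut_tilde G2 H i2) (Aut_tilde G1 H i1))"
proof -
  have "group G1" "group G2" using assms(1,2) by (simp_all add: OE_group_def)
  then interpret amalgamation_data G1 G2 H i1 i2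
    using assms by (simp add: amalgamation_data_def amalgamation_data_axioms_def mon_def)
  show ?thesis by (rule card_iso_classes[OF assms(9)])
qed

end
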